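(* Let $k$, $u_0$ and $\alpha$ be real numbers. For the Morse potential $V_k(u)=\frac14 e^{2u}+ke^u$ on $[u_0,\infty)$ with boundary condition $(\cos\alpha)\,\psi(u_0)+(\sin\alpha)\,\psi'(u_0)=0$, let $N(T;\alpha,u_0)$ be the number of eigenvalues $E<T$ of the Schrödinger operator $-\frac{d^2}{du^2}+V_k(u)$. Then $$N(T;\alpha,u_0) = \frac1\pi\sqrt{T}\,\log\sqrt{T} + \frac1\pi\left(2\log 2-1-u_0\right)\sqrt{T} + O(1)$$ as $T\to\infty$, where the implied constant in the $O$-symbol depends on both $k$ and $u_0$.
   Context: The operator acts on $L^2((u_0,\infty),du)$ by $f\mapsto -f''+V_kf$ with domain all $f\in L^2((u_0,\infty),du)\cap C^1[u_0,\infty)$ such that $f'$ is locally absolutely continuous on $[u_0,\infty)$, $-f''+V_kf\in L^2((u_0,\infty),du)$, and $(\cos\alpha)f(u_0)+(\sin\alpha)f'(u_0)=0$. It is self-adjoint with pure discrete simple spectrum bounded below. *)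

theory Defs
  imports "HOL-Analysis.Analysis"
begin

text \<open>
  The epsilon-delta notion of absolute continuity for functions of a real variable. A set \<open>p\<close> with
  \<open>p division_of \<Union>p\<close> is a finite family of nonoverlapping nonempty compact intervals, not necessarily
  adjacent; one-point intervals may occur, but they contribute \<open>0\<close> to both sums.
\<close>

definition absolutely_continuous_on :: "real set \<Rightarrow> (real \<Rightarrow> 'a::real_normed_vector) \<Rightarrow> bool" where
  "absolutely_continuous_on S f \<longleftrightarrow>
     (\<forall>\<epsilon>>0. \<exists>\<delta>>0. \<forall>p. p division_of \<Union>p \<longrightarrow> \<Union>p \<subseteq> S \<longrightarrow>
        (\<Sum>K\<in>p. measure lborel K) < \<delta> \<longrightarrow> (\<Sum>K\<in>p. norm (f (Sup K) - f (Inf K))) < \<epsilon>)"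

definition locally_absolutely_continuous_on :: "real set \<Rightarrow> (real \<Rightarrow> 'a::real_normed_vector) \<Rightarrow> bool" where
  "locally_absolutely_continuous_on S f \<longleftrightarrow>
     (\<forall>a b. {a..b} \<subseteq> S \<longrightarrow> absolutely_continuous_on {a..b} f)"

definition square_integrable_on :: "(real \<Rightarrow> complex) \<Rightarrow> real set \<Rightarrow> bool" where
  "square_integrable_on f S \<longleftrightarrow>
     set_borel_measurable lebesgue S f \<and> set_integrable lebesgue S (\<lambda>x. (cmod (f x))\<^sup>2)"

text \<open>
  Derivative on the closed half-line \<open>[u0, \<infinity>)\<close>: one-sided at \<open>u0\<close>, the usual derivative elsewhere.
\<close>

definition half_line_deriv :: "real \<Rightarrow> (real \<Rightarrow> complex) \<Rightarrow> real \<Rightarrow> complex" where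
  "half_line_deriv u0 f x = vector_derivative f (at x within {u0..})"

definition C1_half_line :: "real \<Rightarrow> (real \<Rightarrow> complex) \<Rightarrow> bool" where
  "C1_half_line u0 f \<longleftrightarrow> f differentiable_on {u0..} \<and> continuous_on {u0..} (half_line_deriv u0 f)"

definition morse_potential :: "real \<Rightarrow> real \<Rightarrow> real" where
  "morse_potential k u = 1 / 4 * exp (2 * u) + k * exp u"

text \<open>
  The function \<open>-f'' + V f\<close>. For \<open>f\<close> in the domain below, \<open>f''\<close> exists almost everywhere on
  \<open>(u0, \<infinity>)\<close>, and the unspecified values of \<^const>\<open>vector_derivative\<close> on the exceptional null set
  affect neither Lebesgue measurability nor any integral.
\<close>

definition schroedinger :: "(real \<Rightarrow> real) \<Rightarrow> real \<Rightarrow> (real \<Rightarrow> complex) \<Rightarrow> real \<Rightarrow> complex" where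
  "schroedinger V u0 f x =
     - vector_derivative (half_line_deriv u0 f) (at x) + complex_of_real (V x) * f x"

text \<open>
  An element of the domain, a class in \<open>L\<^sup>2((u0, \<infinity>))\<close>, is represented by any function that agrees on
  \<open>[u0, \<infinity>)\<close> with its unique continuous representative; values to the left of \<open>u0\<close> are irrelevant.
\<close>

definition schroedinger_domain :: "(real \<Rightarrow> real) \<Rightarrow> real \<Rightarrow> real \<Rightarrow> (real \<Rightarrow> complex) set" where
  "schroedinger_domain V u0 \<alpha> =
     {f. square_integrable_on f {u0<..} \<and>
         C1_half_line u0 f \<and>
         locally_absolutely_continuous_on {u0..} (half_line_deriv u0 f) \<and>
         square_integrable_on (schroedinger V u0 f) {u0<..} \<and>
         complex_of_real (cos \<alpha>) * f u0 + complex_of_real (sin \<alpha>) * half_line_deriv u0 f u0 = 0}"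

text \<open>
  The operator equation is an equality in \<open>L\<^sup>2\<close>, hence almost everywhere. By continuity, \<open>f\<close> is nonzero
  in \<open>L\<^sup>2\<close> iff it is nonzero at some point of \<open>(u0, \<infinity>)\<close>.
\<close>

definition schroedinger_eigenvalue :: "(real \<Rightarrow> real) \<Rightarrow> real \<Rightarrow> real \<Rightarrow> complex \<Rightarrow> bool" where
  "schroedinger_eigenvalue V u0 \<alpha> E \<longleftrightarrow>
     (\<exists>f \<in> schroedinger_domain V u0 \<alpha>.
        (\<exists>x\<in>{u0<..}. f x \<noteq> 0) \<and>
        (AE x in lebesgue. x \<in> {u0<..} \<longrightarrow> schroedinger V u0 f x = E * f x))"

text \<open>
  The spectrum is simple, so distinct eigenvalues are counted.
\<close>

definition morse_count :: "real \<Rightarrow> real \<Rightarrow> real \<Rightarrow> real \<Rightarrow> nat" where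
  "morse_count k T \<alpha> u0 =
     card {E :: real. schroedinger_eigenvalue (morse_potential k) u0 \<alpha> (complex_of_real E) \<and> E < T}"

end

theory Submission
  imports Defs "HOL-Real_Asymp.Real_Asymp"
begin

text \<open>
  The Morse equation \<open>-f'' + V f = E f\<close> has, for every real \<open>E\<close> and up to a factor, exactly one solution
  \<open>\<psi>\<^sub>E\<close> that decays at infinity, and \<open>E\<close> is an eigenvalue iff \<open>\<psi>\<^sub>E\<close> satisfies the boundary condition at
  \<open>u0\<close>. In polar coordinates \<open>\<psi>\<^sub>E = r sin \<theta>\<close>, \<open>\<psi>\<^sub>E' = r cos \<theta>\<close> (Pruefer angle, normalised to lie in \<open>(0, \<pi>)\<close>
  near infinity) the boundary condition reads \<open>sin (\<theta> + \<alpha>) = 0\<close> at \<open>u0\<close>. The angle \<open>\<theta>(u0, E)\<close> is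
  continuous and strictly decreasing in \<open>E\<close> and stays below \<open>\<pi>\<close>, so the number of eigenvalues
  below \<open>T\<close> is \<open>-\<theta>(u0, T) / \<pi>\<close> with an error of at most \<open>2\<close>, whatever \<open>\<alpha>\<close> is (\<open>count_crossings\<close>). It
  remains to evaluate one angle with a bounded error (\<open>pruefer_angle_asymptotics\<close>).

  For \<open>E = -(k + 1/2)\<^sup>2\<close> the decaying solution is elementary: \<open>exp (-e\<^sup>u/2 - (k + 1/2) u)\<close>. For other
  \<open>E\<close> it is this function times a power series in \<open>E + (k + 1/2)\<^sup>2\<close> whose coefficients are iterated
  integrals from infinity. The series converges like an exponential series, locally uniformly in \<open>(u, E)\<close>, which
  gives existence, decay and joint continuity at once (\<open>psi_deriv\<close> to \<open>psi_eventually_pos\<close>).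

  An eigenfunction in the operator domain solves the equation only almost everywhere
  and has an absolutely continuous derivative; it is shown to be a classical solution
  (\<open>eigenfunction_classical\<close>). Its Wronskian with \<open>\<psi>\<^sub>E\<close> is constant, and a nonzero constant would keep
  the eigenfunction away from \<open>0\<close> near infinity, against square integrability. So the eigenfunction is a
  multiple of \<open>\<psi>\<^sub>E\<close> (\<open>eigenvalue_iff\<close>). Monotonicity of the angle in \<open>E\<close> is a comparison argument run
  from infinity towards \<open>u0\<close> (\<open>pruefer_angle_decreasing\<close>).

  To compute the angle at energy \<open>T\<close>, put \<open>p = sqrt (T - e\<^sup>2\<^sup>u/4)\<close>. Up to the turning region the Liouville-Green
  transformed curve \<open>(p \<psi>, \<psi>' + (p'/2p) \<psi>)\<close> rotates with speed \<open>p\<close> plus an error whose integral is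
  bounded as long as \<open>p \<ge> T\<^sup>1\<^sup>/\<^sup>3\<close>; the term \<open>k e\<^sup>u\<close> of the potential belongs to this error because the
  integral of \<open>e\<^sup>u/p\<close> is an arcsine (\<open>wkb_region_estimate\<close>). The turning region has length \<open>O(T\<^sup>-\<^sup>1\<^sup>/\<^sup>3)\<close>, and there the
  curve \<open>(T\<^sup>1\<^sup>/\<^sup>3 \<psi>, \<psi>')\<close> has speed \<open>O(T\<^sup>1\<^sup>/\<^sup>3)\<close> (\<open>bounded_rotation\<close>). Beyond it
  \<open>\<psi>\<close> has no zero (\<open>no_rotation_beyond_turning_point\<close>). Two curves whose first coordinates have
  the same sign, and whose second coordinates have the same sign at the zeros of the first, turn by
  the same angle up to \<open>2\<pi>\<close> (\<open>polar_lift_compare\<close>), so the transformations cost only a bounded error.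
  The integral of \<open>p\<close> is elementary and yields the two main terms.
\<close>

section \<open>Integrals over half-lines and series of functions\<close>

text \<open>
  Continuity on the whole line is included, so that \<open>exp_decaying f\<close> alone makes the integral of \<open>f\<close>
  over every half-line \<open>[u, \<infinity>)\<close> meaningful and differentiable in \<open>u\<close>.
\<close>

definition exp_decaying :: "(real \<Rightarrow> real) \<Rightarrow> bool" where
  "exp_decaying f \<longleftrightarrow> continuous_on UNIV f \<and> (\<exists>C. \<forall>\<^sub>F u in at_top. \<bar>f u\<bar> \<le> C * exp (- u))"

definition tail :: "(real \<Rightarrow> real) \<Rightarrow> real \<Rightarrow> real" where
  "tail f u = integral {u..} f"

lemma exp_decayingI:
  assumes "continuous_on UNIV f" "\<forall>\<^sub>F u in at_top. \<bar>f u\<bar> \<le> C * exp (- u)"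
  shows "exp_decaying f"
  using assms unfolding exp_decaying_def by blast

lemma exp_decaying_mono:
  assumes g: "exp_decaying g" and "continuous_on UNIV f"
    and "\<forall>\<^sub>F u in at_top. \<bar>f u\<bar> \<le> C * \<bar>g u\<bar>" and C: "C \<ge> 0"
  shows "exp_decaying f"
proof -
  obtain D where D: "\<forall>\<^sub>F u in at_top. \<bar>g u\<bar> \<le> D * exp (- u)"
    using g unfolding exp_decaying_def by blast
  have "\<forall>\<^sub>F u in at_top. \<bar>f u\<bar> \<le> (C * D) * exp (- u)"
    using assms(3) D
  proof eventually_elim
    case (elim u)
    have "C * \<bar>g u\<bar> \<le> C * (D * exp (- u))" using elim C by (intro mult_left_mono) auto
    then show ?case using elim by (simp add: mult_ac)
  qed
  then show ?thesis by (rule exp_decayingI[OF assms(2)])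
qed

lemma exp_decaying_tendsto:
  assumes "exp_decaying f" shows "(f \<longlongrightarrow> 0) at_top"
proof -
  obtain D where D: "\<forall>\<^sub>F u in at_top. \<bar>f u\<bar> \<le> D * exp (- u)"
    using assms unfolding exp_decaying_def by blast
  have "((\<lambda>u. D * exp (- u)) \<longlongrightarrow> 0) at_top" by real_asymp
  then show ?thesis by (rule Lim_null_comparison[rotated]) (use D in simp)
qed

lemma exp_decaying_integrable:
  assumes "exp_decaying f" shows "f integrable_on {u..}"
proof -
  obtain D where D: "\<forall>\<^sub>F u in at_top. \<bar>f u\<bar> \<le> D * exp (- u)" and c: "continuous_on UNIV f"
    using assms unfolding exp_decaying_def by blast
  then obtain b0 where b0: "\<And>u. u \<ge> b0 \<Longrightarrow> \<bar>f u\<bar> \<le> D * exp (- u)"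
    unfolding eventually_at_top_linorder by blast
  define b where "b = max b0 u"
  have "(\<lambda>x. D * exp (-1 * x)) integrable_on {b..}"
    by (intro integrable_on_mult_right integrable_on_exp_minus_to_infinity) simp
  then have g: "(\<lambda>x. D * exp (- x)) integrable_on {b..}" by simp
  have m: "f \<in> borel_measurable (lebesgue_on {b..})"
    by (rule continuous_imp_measurable_on_sets_lebesgue[OF continuous_on_subset[OF c]]) auto
  have 1: "f integrable_on {b..}"
    by (rule measurable_bounded_by_integrable_imp_integrable[OF m g]) (simp_all add: b_def b0)
  have 2: "f integrable_on {u..b}"
    by (rule integrable_continuous_interval) (rule continuous_on_subset[OF c], simp)
  have "{u..b} \<inter> {b..} = {b}" "{u..b} \<union> {b..} = {u..}" by (auto simp: b_def)
  then show ?thesis by (intro integrable_Un'[OF 2 1]) auto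
qed

lemma tail_split:
  assumes "exp_decaying f" "u \<le> v"
  shows "tail f u = integral {u..v} f + tail f v"
proof -
  have c: "continuous_on UNIV f" using assms unfolding exp_decaying_def by blast
  have 2: "f integrable_on {u..v}"
    by (rule integrable_continuous_interval) (rule continuous_on_subset[OF c], simp)
  have e: "{u..v} \<inter> {v..} = {v}" "{u..v} \<union> {v..} = {u..}" using assms by auto
  have "integral ({u..v} \<union> {v..}) f = integral {u..v} f + integral {v..} f"
    by (rule integral_Un) (use 2 exp_decaying_integrable[OF assms(1)] e in auto)
  then show ?thesis unfolding tail_def e .
qed

lemma tail_deriv:
  assumes "exp_decaying f"
  shows "(tail f has_real_derivative - f u) (at u)"
proof -
  have c: "continuous_on UNIV f" using assms unfolding exp_decaying_def by blast
  have "((\<lambda>v. integral {u-1..v} f) has_real_derivative f u) (at u within {u-1..u+1})"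
    by (rule integral_has_real_derivative[OF continuous_on_subset[OF c]]) simp_all
  then have 1: "((\<lambda>v. integral {u-1..v} f) has_real_derivative f u) (at u)"
    by (simp add: at_within_Icc_at)
  have 2: "((\<lambda>v. tail f (u-1) - integral {u-1..v} f) has_real_derivative - f u) (at u)"
    using DERIV_diff[OF DERIV_const[of "tail f (u-1)"] 1] by simp
  show ?thesis
  proof (rule has_field_derivative_transform_within_open[OF 2])
    show "open {u-1<..}" "u \<in> {u-1<..}" by auto
    show "tail f (u - 1) - integral {u - 1..x} f = tail f x" if "x \<in> {u - 1<..}" for x
      using tail_split[OF assms, of "u-1" x] that by simp
  qed
qed

lemma tail_mono:
  assumes "exp_decaying f" "exp_decaying g" "\<And>x. x \<ge> u \<Longrightarrow> f x \<le> g x"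
  shows "tail f u \<le> tail g u"
  unfolding tail_def by (rule integral_le) (use assms exp_decaying_integrable in auto)

lemma tail_nonneg:
  assumes "\<And>x. f x \<ge> 0"
  shows "tail f u \<ge> 0"
proof (cases "f integrable_on {u..}")
  case True then show ?thesis unfolding tail_def using assms by (intro integral_nonneg) auto
qed (simp add: tail_def not_integrable_integral)

lemma exp_decaying_tail:
  assumes "exp_decaying f" shows "exp_decaying (tail f)"
proof -
  obtain D where D: "\<forall>\<^sub>F u in at_top. \<bar>f u\<bar> \<le> D * exp (- u)"
    using assms unfolding exp_decaying_def by blast
  then obtain b where b: "\<And>u. u \<ge> b \<Longrightarrow> \<bar>f u\<bar> \<le> D * exp (- u)"
    unfolding eventually_at_top_linorder by blast
  have "\<bar>tail f u\<bar> \<le> D * exp (- u)" if "u \<ge> b" for u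
  proof -
    have i: "((\<lambda>x. D * exp (- x)) has_integral D * exp (- u)) {u..}"
      using has_integral_mult_right[OF has_integral_exp_minus_to_infinity[of 1 u]] by simp
    have "norm (integral {u..} f) \<le> integral {u..} (\<lambda>x. D * exp (- x))"
      by (rule integral_norm_bound_integral)
         (use exp_decaying_integrable[OF assms] i b that in \<open>auto simp: has_integral_integrable\<close>)
    then show ?thesis unfolding integral_unique[OF i] tail_def by simp
  qed
  then have "\<forall>\<^sub>F u in at_top. \<bar>tail f u\<bar> \<le> D * exp (- u)"
    unfolding eventually_at_top_linorder by blast
  moreover have "continuous_on UNIV (tail f)"
    by (rule DERIV_continuous_on[OF has_field_derivative_at_within[OF tail_deriv[OF assms]]])
  ultimately show ?thesis by (intro exp_decayingI)
qed

lemma tail_antimono: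
  assumes "exp_decaying f" "\<And>x. f x \<ge> 0" "u \<le> v"
  shows "tail f v \<le> tail f u"
proof -
  have c: "continuous_on UNIV f" using assms unfolding exp_decaying_def by blast
  have "f integrable_on {u..v}"
    by (rule integrable_continuous_interval) (rule continuous_on_subset[OF c], simp)
  then have "0 \<le> integral {u..v} f" by (rule integral_nonneg) (use assms in auto)
  then show ?thesis using tail_split[OF assms(1,3)] by simp
qed

text \<open>
  Both sides have the same derivative and the same limit at infinity.
\<close>

lemma tail_eqI:
  assumes f: "exp_decaying f" and d: "\<And>u. (F has_real_derivative - f u) (at u)" and l: "(F \<longlongrightarrow> 0) at_top"
  shows "tail f u = F u"
proof -
  have z: "((\<lambda>u. tail f u - F u) has_real_derivative 0) (at u)" for u
    using DERIV_diff[OF tail_deriv[OF f] d, of u] by simp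
  have const: "tail f v - F v = tail f u - F u" for v
    using DERIV_isconst_all[of "\<lambda>u. tail f u - F u" v u] z by simp
  have "((\<lambda>v. tail f v - F v) \<longlongrightarrow> 0 - 0) at_top"
    by (intro tendsto_diff exp_decaying_tendsto exp_decaying_tail f l)
  moreover have "(\<lambda>v. tail f v - F v) = (\<lambda>v. tail f u - F u)" by (intro ext const)
  ultimately have lim: "((\<lambda>v::real. tail f u - F u) \<longlongrightarrow> 0) at_top" by (simp only: diff_zero)
  have "0 = tail f u - F u" by (rule tendsto_unique[OF _ lim tendsto_const]) simp
  then show ?thesis by simp
qed

text \<open>
  The difference of the two sides is monotone on \<open>[b, \<infinity>)\<close> and tends to \<open>0\<close>. It serves where the integral has no closed form but
  an explicit function decreases at least as fast.
\<close>

lemma tail_le: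
  assumes f: "exp_decaying f" and d: "\<And>u. u \<ge> b \<Longrightarrow> (F has_real_derivative F' u) (at u)"
    and le: "\<And>u. u \<ge> b \<Longrightarrow> f u \<le> - F' u"
    and l: "(F \<longlongrightarrow> 0) at_top" and u: "u \<ge> b"
  shows "tail f u \<le> F u"
proof -
  have mono: "tail f u - F u \<le> tail f v - F v" if "u \<le> v" for v
  proof (rule DERIV_nonneg_imp_nondecreasing[OF that])
    fix x assume "u \<le> x" "x \<le> v"
    then have "x \<ge> b" using u by simp
    have "((\<lambda>u. tail f u - F u) has_real_derivative - f x - F' x) (at x)"
      by (intro DERIV_diff tail_deriv[OF f] d \<open>x \<ge> b\<close>)
    then show "\<exists>y. ((\<lambda>u. tail f u - F u) has_real_derivative y) (at x) \<and> 0 \<le> y"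
      using le[OF \<open>x \<ge> b\<close>] by force
  qed
  have "((\<lambda>v. tail f v - F v) \<longlongrightarrow> 0 - 0) at_top"
    by (intro tendsto_diff exp_decaying_tendsto exp_decaying_tail f l)
  then have "tail f u - F u \<le> 0 - 0"
    by (rule tendsto_lowerbound) (rule eventually_mono[OF eventually_ge_at_top[of u] mono], simp_all)
  then show ?thesis by simp
qed

lemma tail_cmult: "tail (\<lambda>x. c * f x) u = c * tail f u"
  unfolding tail_def by simp

lemma continuous_on_suminf:
  fixes f :: "nat \<Rightarrow> 'a::metric_space \<Rightarrow> real"
  assumes c: "\<And>n. continuous_on UNIV (f n)"
    and b: "\<And>p. \<exists>U M. open U \<and> p \<in> U \<and> summable M \<and> (\<forall>n. \<forall>q\<in>U. \<bar>f n q\<bar> \<le> M n)"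
  shows "continuous_on UNIV (\<lambda>q. \<Sum>n. f n q)"
proof -
  have "isCont (\<lambda>q. \<Sum>n. f n q) p" for p
  proof -
    obtain U M where U: "open U" "p \<in> U" "summable M" "\<And>n q. q \<in> U \<Longrightarrow> \<bar>f n q\<bar> \<le> M n"
      using b[of p] by blast
    have ul: "uniform_limit U (\<lambda>N q. \<Sum>n<N. f n q) (\<lambda>q. \<Sum>n. f n q) sequentially"
      by (rule Weierstrass_m_test) (use U in auto)
    have "continuous_on U (\<lambda>q. \<Sum>n<N. f n q)" for N
      by (intro continuous_on_sum continuous_on_subset[OF c]) simp
    then have "continuous_on U (\<lambda>q. \<Sum>n. f n q)"
      by (intro uniform_limit_theorem[OF _ ul]) simp_all
    then show ?thesis using U(1,2) by (simp add: continuous_on_eq_continuous_at)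
  qed
  then show ?thesis by (simp add: continuous_at_imp_continuous_on)
qed

lemma suminf_deriv:
  fixes f :: "nat \<Rightarrow> real \<Rightarrow> real"
  assumes d: "\<And>n x. (f n has_real_derivative f' n x) (at x)"
    and s: "summable (\<lambda>n. f n x)"
    and M: "summable M" "\<And>n y. \<bar>y - x\<bar> \<le> 1 \<Longrightarrow> \<bar>f' n y\<bar> \<le> M n"
  shows "((\<lambda>x. \<Sum>n. f n x) has_real_derivative (\<Sum>n. f' n x)) (at x)"
proof -
  have 1: "uniformly_convergent_on {x - 1..x + 1} (\<lambda>n x. \<Sum>i<n. f' i x)"
  proof (rule Weierstrass_m_test'[OF _ M(1)])
    fix n y assume "y \<in> {x-1..x+1}"
    then have "\<bar>y - x\<bar> \<le> 1" by (simp add: abs_le_iff)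
    then show "norm (f' n y) \<le> M n" using M(2) by simp
  qed
  have 2: "(f n has_real_derivative f' n y) (at y within {x-1..x+1})" for n y
    by (rule has_field_derivative_at_within[OF d])
  have 3: "x \<in> {x-1..x+1}" "x \<in> interior {x-1..x+1}" by auto
  show ?thesis
    by (rule has_field_derivative_series'(2)[OF convex_real_interval(5) 2 1 3(1) s 3(2)])
qed

section \<open>The decaying solution of the Morse equation\<close>

context fixes k :: real begin

definition base_logderiv :: "real \<Rightarrow> real" where "base_logderiv u = - exp u / 2 - (k + 1/2)"

text \<open>
  The exponent \<open>-(k + 1/2)\<close> makes \<open>w''/w\<close> differ from the potential by a constant, so that this function \<open>w\<close> solves the Morse
  equation at the energy \<open>-(k + 1/2)\<^sup>2\<close>. The decaying solutions for other energies are perturbations of it.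
\<close>

definition base_sol :: "real \<Rightarrow> real" where "base_sol u = exp (- exp u / 2 - (k + 1/2) * u)"

lemma base_sol_pos: "base_sol u > 0" by (simp add: base_sol_def)

lemma base_sol_deriv: "(base_sol has_real_derivative base_logderiv u * base_sol u) (at u)"
  unfolding base_sol_def base_logderiv_def by (auto intro!: derivative_eq_intros simp: field_simps)

lemma base_sol_cont: "continuous_on A base_sol" unfolding base_sol_def by (intro continuous_intros) auto

lemma base_logderiv_deriv: "(base_logderiv has_real_derivative - exp u / 2) (at u)"
  unfolding base_logderiv_def by (auto intro!: derivative_eq_intros)

lemma base_logderiv_cont: "continuous_on A base_logderiv" unfolding base_logderiv_def by (intro continuous_intros) auto

text \<open>
  The Riccati form of the equation for \<open>base_sol\<close>: the left-hand side is the derivative of the logarithmic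
  derivative plus its square.
\<close>

lemma base_logderiv_riccati: "- exp u / 2 + base_logderiv u ^ 2 = morse_potential k u + (k + 1/2)^2"
proof -
  have "exp (2 * u) = exp u ^ 2" by (simp add: exp_double)
  then show ?thesis by (simp add: base_logderiv_def morse_potential_def power2_eq_square field_simps)
qed

lemma base_sol_exp_decaying: "exp_decaying base_sol"
proof (rule exp_decayingI[OF base_sol_cont, of 1])
  have "((\<lambda>u. base_sol u / exp (- u)) \<longlongrightarrow> 0) at_top" unfolding base_sol_def by real_asymp
  then have "\<forall>\<^sub>F u in at_top. base_sol u / exp (- u) < 1" by (rule order_tendstoD) simp
  then show "\<forall>\<^sub>F u in at_top. \<bar>base_sol u\<bar> \<le> 1 * exp (- u)"
    by eventually_elim (use base_sol_pos in \<open>simp add: field_simps less_imp_le\<close>)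
qed

lemma base_sol_deriv_exp_decaying: "exp_decaying (\<lambda>u. base_logderiv u * base_sol u)"
proof (rule exp_decayingI[of _ 1])
  show "continuous_on UNIV (\<lambda>u. base_logderiv u * base_sol u)" by (intro continuous_intros base_sol_cont base_logderiv_cont)
  have "((\<lambda>u. \<bar>base_logderiv u * base_sol u\<bar> / exp (- u)) \<longlongrightarrow> 0) at_top" unfolding base_sol_def base_logderiv_def by real_asymp
  then have "\<forall>\<^sub>F u in at_top. \<bar>base_logderiv u * base_sol u\<bar> / exp (- u) < 1" by (rule order_tendstoD) simp
  then show "\<forall>\<^sub>F u in at_top. \<bar>base_logderiv u * base_sol u\<bar> \<le> 1 * exp (- u)"
    by eventually_elim (simp add: field_simps less_imp_le)
qed

lemma base_sol_sq_exp_decaying: "exp_decaying (\<lambda>u. base_sol u ^ 2)"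
proof (rule exp_decayingI[of _ 1])
  show "continuous_on UNIV (\<lambda>u. base_sol u ^ 2)" by (intro continuous_intros base_sol_cont)
  have "((\<lambda>u. base_sol u ^ 2 / exp (- u)) \<longlongrightarrow> 0) at_top" unfolding base_sol_def by real_asymp
  then have "\<forall>\<^sub>F u in at_top. base_sol u ^ 2 / exp (- u) < 1" by (rule order_tendstoD) simp
  then show "\<forall>\<^sub>F u in at_top. \<bar>base_sol u ^ 2\<bar> \<le> 1 * exp (- u)"
    by eventually_elim (simp add: field_simps less_imp_le)
qed

definition base_tail :: "real \<Rightarrow> real" where "base_tail = tail (\<lambda>u. base_sol u ^ 2)"

definition base_tail_ratio :: "real \<Rightarrow> real" where "base_tail_ratio u = base_tail u / base_sol u ^ 2"

lemma base_tail_nonneg: "base_tail u \<ge> 0" unfolding base_tail_def by (rule tail_nonneg) simp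

lemma base_tail_ratio_nonneg: "base_tail_ratio u \<ge> 0" unfolding base_tail_ratio_def by (simp add: base_tail_nonneg)

lemma base_tail_exp_decaying: "exp_decaying base_tail"
  unfolding base_tail_def by (rule exp_decaying_tail[OF base_sol_sq_exp_decaying])

lemma exp_decaying_cont: "exp_decaying f \<Longrightarrow> continuous_on A f"
  unfolding exp_decaying_def by (metis continuous_on_subset subset_UNIV)

text \<open>
  The integral of \<open>w\<^sup>2\<close> over \<open>[u, \<infinity>)\<close> is asymptotically \<open>e\<^sup>-\<^sup>u w\<^sup>2\<close>, because \<open>w\<^sup>2\<close> decays like
  \<open>exp (-e\<^sup>u)\<close>; twice this function is a majorant for large \<open>u\<close>.
\<close>

lemma base_tail_ratio_exp_decaying: "exp_decaying base_tail_ratio"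
proof (rule exp_decayingI[of _ 2])
  show "continuous_on UNIV base_tail_ratio" unfolding base_tail_ratio_def
    using base_sol_pos by (intro continuous_intros base_sol_cont exp_decaying_cont[OF base_tail_exp_decaying])
      (metis less_irrefl zero_less_power)
  define F where "F = (\<lambda>u. 2 * exp (- u) * base_sol u ^ 2)"
  have "\<forall>\<^sub>F u in at_top. - 4 * base_logderiv u - 2 \<ge> exp u - 4 * \<bar>k + 1/2\<bar> + exp u - 2" 
    unfolding base_logderiv_def by (intro always_eventually allI) (simp add: abs_if)
  moreover have "\<forall>\<^sub>F u in at_top. exp u \<ge> 4 * \<bar>k + 1/2\<bar> + (2::real)" by real_asymp
  ultimately have "\<forall>\<^sub>F u in at_top. 2 - 4 * base_logderiv u \<ge> exp u"
    by eventually_elim simp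
  then obtain b where b: "\<And>u. u \<ge> b \<Longrightarrow> 2 - 4 * base_logderiv u \<ge> exp u"
    unfolding eventually_at_top_linorder by blast
  have "base_tail u \<le> F u" if "u \<ge> b" for u unfolding base_tail_def
  proof (rule tail_le[OF base_sol_sq_exp_decaying _ _ _ that])
    fix u assume u: "u \<ge> b"
    show "(F has_real_derivative (- (2 - 4 * base_logderiv u) * exp (- u) * base_sol u ^ 2)) (at u)"
      unfolding F_def by (auto intro!: derivative_eq_intros base_sol_deriv simp: power2_eq_square algebra_simps)
    have "exp u * (exp (- u) * base_sol u ^ 2) \<le> (2 - 4 * base_logderiv u) * (exp (- u) * base_sol u ^ 2)"
      by (rule mult_right_mono[OF b[OF u]]) simp
    then show "(base_sol u)\<^sup>2 \<le> - (- (2 - 4 * base_logderiv u) * exp (- u) * (base_sol u)\<^sup>2)"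
      by (simp add: exp_minus field_simps)
  next
    show "(F \<longlongrightarrow> 0) at_top" unfolding F_def base_sol_def by real_asymp
  qed
  then have "\<forall>\<^sub>F u in at_top. base_tail u \<le> F u" unfolding eventually_at_top_linorder by blast
  then show "\<forall>\<^sub>F u in at_top. \<bar>base_tail_ratio u\<bar> \<le> 2 * exp (- u)"
  proof eventually_elim
    case (elim u)
    then have "base_tail_ratio u \<le> 2 * exp (- u)" unfolding base_tail_ratio_def F_def using base_sol_pos[of u] by (simp add: field_simps)
    then show ?case using base_tail_ratio_nonneg[of u] by simp
  qed
qed

definition base_weight :: "real \<Rightarrow> real" where "base_weight = tail base_tail_ratio"

lemma base_weight_nonneg: "base_weight u \<ge> 0" unfolding base_weight_def by (rule tail_nonneg) (rule base_tail_ratio_nonneg)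
lemma base_weight_deriv: "(base_weight has_real_derivative - base_tail_ratio u) (at u)"
  unfolding base_weight_def by (rule tail_deriv[OF base_tail_ratio_exp_decaying])
lemma base_weight_antimono: "u \<le> v \<Longrightarrow> base_weight v \<le> base_weight u"
  unfolding base_weight_def by (rule tail_antimono[OF base_tail_ratio_exp_decaying base_tail_ratio_nonneg])
lemma base_weight_exp_decaying: "exp_decaying base_weight"
  unfolding base_weight_def by (rule exp_decaying_tail[OF base_tail_ratio_exp_decaying])
lemma base_weight_tendsto: "(base_weight \<longlongrightarrow> 0) at_top" by (rule exp_decaying_tendsto[OF base_weight_exp_decaying])
lemma base_tail_antimono: "u \<le> v \<Longrightarrow> base_tail v \<le> base_tail u"
  unfolding base_tail_def by (rule tail_antimono[OF base_sol_sq_exp_decaying]) simp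

text \<open>
  Writing a solution as \<open>w h\<close>, where \<open>w\<close> is \<open>base_sol\<close>, turns the equation at energy \<open>l - (k + 1/2)\<^sup>2\<close> into
  \<open>(w\<^sup>2 h')' = - l w\<^sup>2 h\<close>. With \<open>h = 1\<close> at infinity this is solved by
  iteration, and these are the coefficients of \<open>(-l)\<^sup>n\<close> in the result.
\<close>

primrec iter_term :: "nat \<Rightarrow> real \<Rightarrow> real" where
  "iter_term 0 = (\<lambda>_. 1)"
| "iter_term (Suc n) = tail (\<lambda>s. tail (\<lambda>t. base_sol t ^ 2 * iter_term n t) s / base_sol s ^ 2)"

definition iter_flux :: "nat \<Rightarrow> real \<Rightarrow> real" where "iter_flux n = tail (\<lambda>t. base_sol t ^ 2 * iter_term n t)"

lemma iter_term_Suc: "iter_term (Suc n) = tail (\<lambda>s. iter_flux n s / base_sol s ^ 2)" by (simp add: iter_flux_def)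

text \<open>
  \<open>base_weight\<close> has derivative \<open>- base_tail_ratio\<close>, so the integrand is an exact derivative. This is the
  source of the factorials in \<open>iter_term_bounds\<close>.
\<close>

lemma base_weight_power: 
  "exp_decaying (\<lambda>s. base_tail_ratio s * (base_weight s ^ n / fact n))"
  "tail (\<lambda>s. base_tail_ratio s * (base_weight s ^ n / fact n)) u = base_weight u ^ Suc n / fact (Suc n)"
proof -
  have "\<forall>\<^sub>F s in at_top. \<bar>base_tail_ratio s * (base_weight s ^ n / fact n)\<bar> \<le> 1 * \<bar>base_tail_ratio s\<bar>"
    using order_tendstoD(2)[OF base_weight_tendsto, of 1, OF zero_less_one]
  proof eventually_elim
    case (elim s)
    then have "base_weight s ^ n \<le> 1" using base_weight_nonneg[of s] by (simp add: power_le_one)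
    then have "base_weight s ^ n \<le> fact n" using fact_ge_1[of n, where 'a=real] by linarith
    then have "base_weight s ^ n / fact n \<le> 1" by simp
    then have "base_tail_ratio s * (base_weight s ^ n / fact n) \<le> base_tail_ratio s * 1" by (rule mult_left_mono[OF _ base_tail_ratio_nonneg])
    then show ?case using base_tail_ratio_nonneg[of s] base_weight_nonneg[of s] by (simp add: abs_mult)
  qed
  moreover have "continuous_on UNIV (\<lambda>s. base_tail_ratio s * (base_weight s ^ n / fact n))"
    by (intro continuous_intros exp_decaying_cont base_tail_ratio_exp_decaying base_weight_exp_decaying) simp
  ultimately show 1: "exp_decaying (\<lambda>s. base_tail_ratio s * (base_weight s ^ n / fact n))"
    by (intro exp_decaying_mono[OF base_tail_ratio_exp_decaying, of _ 1]) auto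
  have *: "fact (Suc n) = (1 + real n) * fact n" by simp
  show "tail (\<lambda>s. base_tail_ratio s * (base_weight s ^ n / fact n)) u = base_weight u ^ Suc n / fact (Suc n)"
  proof (rule tail_eqI[OF 1])
    show "((\<lambda>u. base_weight u ^ Suc n / fact (Suc n)) has_real_derivative - (base_tail_ratio u * (base_weight u ^ n / fact n))) (at u)" for u
      unfolding * by (rule derivative_eq_intros base_weight_deriv | simp)+ 
    have "((\<lambda>u. base_weight u ^ Suc n / fact (Suc n)) \<longlongrightarrow> 0 ^ Suc n / fact (Suc n)) at_top"
      by (intro tendsto_intros base_weight_tendsto) simp
    then show "((\<lambda>u. base_weight u ^ Suc n / fact (Suc n)) \<longlongrightarrow> 0) at_top" by simp
  qed
qed

text \<open>
  All parts of the statement are needed at once for the induction step: the bound for \<open>iter_term k n\<close>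
  passes through \<open>iter_flux k n\<close> to the next term because \<open>base_weight\<close> is nonincreasing, and each integral
  exists only because the previous functions decay.
\<close>

lemma iter_term_bounds: "continuous_on UNIV (iter_term n) \<and> (\<forall>u. 0 \<le> iter_term n u \<and> iter_term n u \<le> base_weight u ^ n / fact n)
   \<and> exp_decaying (\<lambda>t. base_sol t ^ 2 * iter_term n t)
   \<and> (\<forall>u. 0 \<le> iter_flux n u \<and> iter_flux n u \<le> base_tail u * (base_weight u ^ n / fact n))
   \<and> exp_decaying (\<lambda>s. iter_flux n s / base_sol s ^ 2)"
proof (induction n)
  case 0
  have "iter_flux 0 = base_tail" by (simp add: iter_flux_def base_tail_def)
  then show ?case using base_sol_sq_exp_decaying base_tail_nonneg base_tail_ratio_exp_decaying by (auto simp: base_tail_ratio_def[abs_def])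
next
  case (Suc n)
  have ed: "exp_decaying (\<lambda>s. iter_flux n s / base_sol s ^ 2)" using Suc by blast
  have le: "iter_flux n s / base_sol s ^ 2 \<le> base_tail_ratio s * (base_weight s ^ n / fact n)" for s
  proof -
    have "iter_flux n s / base_sol s ^ 2 \<le> (base_tail s * (base_weight s ^ n / fact n)) / base_sol s ^ 2"
      by (rule divide_right_mono) (use Suc in auto)
    then show ?thesis by (simp add: base_tail_ratio_def mult.commute)
  qed
  have c: "continuous_on UNIV (iter_term (Suc n))" unfolding iter_term_Suc
    by (rule exp_decaying_cont[OF exp_decaying_tail[OF ed]])
  have lo: "0 \<le> iter_term (Suc n) u" for u unfolding iter_term_Suc
    by (rule tail_nonneg) (use Suc in auto)
  have hi: "iter_term (Suc n) u \<le> base_weight u ^ Suc n / fact (Suc n)" for u unfolding iter_term_Suc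
    using tail_mono[OF ed base_weight_power(1) le] base_weight_power(2) by metis
  have w2: "exp_decaying (\<lambda>t. base_sol t ^ 2 * iter_term (Suc n) t)"
  proof (rule exp_decaying_mono[OF base_sol_sq_exp_decaying, of _ 1])
    show "continuous_on UNIV (\<lambda>t. base_sol t ^ 2 * iter_term (Suc n) t)"
      by (intro continuous_intros base_sol_cont c)
    show "\<forall>\<^sub>F u in at_top. \<bar>(base_sol u)\<^sup>2 * iter_term (Suc n) u\<bar> \<le> 1 * \<bar>(base_sol u)\<^sup>2\<bar>"
      using order_tendstoD(2)[OF base_weight_tendsto, of 1, OF zero_less_one]
    proof eventually_elim
      case (elim s)
      then have "base_weight s ^ Suc n \<le> 1" using base_weight_nonneg[of s] by (intro power_le_one) auto
      then have "base_weight s ^ Suc n / fact (Suc n) \<le> 1" using fact_ge_1[of "Suc n", where 'a=real] 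
        by (subst divide_le_eq_1_pos) (auto intro: order_trans simp del: fact_Suc)
      then have "iter_term (Suc n) s \<le> 1" using hi[of s] by linarith
      then have "base_sol s ^ 2 * iter_term (Suc n) s \<le> base_sol s ^ 2 * 1" by (rule mult_left_mono) simp
      then show ?case using lo[of s] by (simp add: abs_mult del: iter_term.simps)
    qed
  qed simp
  have rlo: "0 \<le> iter_flux (Suc n) u" for u unfolding iter_flux_def by (rule tail_nonneg) (use lo in auto)
  have rhi: "iter_flux (Suc n) u \<le> base_tail u * (base_weight u ^ Suc n / fact (Suc n))" for u
  proof -
    define c where "c = base_weight u ^ Suc n / fact (Suc n)"
    have "c \<ge> 0" unfolding c_def using base_weight_nonneg[of u] by auto
    have e: "exp_decaying (\<lambda>t. c * base_sol t ^ 2)"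
      by (rule exp_decaying_mono[OF base_sol_sq_exp_decaying, of _ "\<bar>c\<bar>"])
        (auto intro!: continuous_intros base_sol_cont simp: abs_mult)
    have "iter_flux (Suc n) u \<le> tail (\<lambda>t. c * base_sol t ^ 2) u"
      unfolding iter_flux_def
    proof (rule tail_mono[OF w2 e])
      fix x assume "u \<le> x"
      then have "base_weight x ^ Suc n \<le> base_weight u ^ Suc n" using base_weight_antimono base_weight_nonneg by (intro power_mono) auto
      then have "base_weight x ^ Suc n / fact (Suc n) \<le> c" unfolding c_def by (rule divide_right_mono) simp
      then have "iter_term (Suc n) x \<le> c" using hi[of x] by linarith
      then show "(base_sol x)\<^sup>2 * iter_term (Suc n) x \<le> c * (base_sol x)\<^sup>2" 
        by (subst mult.commute) (rule mult_right_mono, auto)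
    qed
    then show ?thesis unfolding tail_cmult by (simp add: base_tail_def c_def mult.commute del: fact_Suc power_Suc)
  qed
  have "exp_decaying (\<lambda>s. iter_flux (Suc n) s / base_sol s ^ 2)"
  proof (rule exp_decaying_mono[OF base_weight_power(1)[of "Suc n"], of _ 1])
    show "continuous_on UNIV (\<lambda>s. iter_flux (Suc n) s / base_sol s ^ 2)" unfolding iter_flux_def using base_sol_pos
      by (intro continuous_intros base_sol_cont exp_decaying_cont[OF exp_decaying_tail[OF w2]])
        (metis less_irrefl zero_less_power)
    have "iter_flux (Suc n) s / base_sol s ^ 2 \<le> base_tail_ratio s * (base_weight s ^ Suc n / fact (Suc n))" for s
    proof -
      have "iter_flux (Suc n) s / base_sol s ^ 2 \<le> (base_tail s * (base_weight s ^ Suc n / fact (Suc n))) / base_sol s ^ 2"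
        by (rule divide_right_mono[OF rhi]) simp
      then show ?thesis by (simp add: base_tail_ratio_def mult.commute)
    qed
    note le_bound = this
    show "\<forall>\<^sub>F u in at_top. \<bar>iter_flux (Suc n) u / (base_sol u)\<^sup>2\<bar> \<le> 1 * \<bar>base_tail_ratio u * (base_weight u ^ Suc n / fact (Suc n))\<bar>"
    proof (intro always_eventually allI)
      fix u
      have "0 \<le> iter_flux (Suc n) u / base_sol u ^ 2" using rlo by simp
      then show "\<bar>iter_flux (Suc n) u / (base_sol u)\<^sup>2\<bar> \<le> 1 * \<bar>base_tail_ratio u * (base_weight u ^ Suc n / fact (Suc n))\<bar>"
        using le_bound[of u] by linarith
    qed
  qed simp
  then show ?case using c lo hi w2 rlo rhi by blast
qed

lemma iter_term_deriv: "(iter_term (Suc n) has_real_derivative - (iter_flux n u / base_sol u ^ 2)) (at u)"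
  unfolding iter_term_Suc by (rule tail_deriv) (use iter_term_bounds in blast)

lemma iter_flux_deriv: "(iter_flux n has_real_derivative - (base_sol u ^ 2 * iter_term n u)) (at u)"
  unfolding iter_flux_def by (rule tail_deriv) (use iter_term_bounds in blast)

lemma iter_flux_cont: "continuous_on UNIV (iter_flux n)"
  unfolding iter_flux_def by (rule exp_decaying_cont, rule exp_decaying_tail) (use iter_term_bounds in blast)

definition pert_series :: "real \<Rightarrow> real \<Rightarrow> real" where "pert_series l u = (\<Sum>n. (- l) ^ n * iter_term n u)"
definition pert_flux :: "real \<Rightarrow> real \<Rightarrow> real" where "pert_flux l u = (\<Sum>n. (- l) ^ n * iter_flux n u)"

lemma exp_sum_bound: "summable (\<lambda>n. c * (x ^ n / fact n))" "(\<Sum>n. c * (x ^ n / fact n)) = c * exp (x::real)"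
proof -
  have "(\<lambda>n. x ^ n / fact n) sums exp x" using exp_converges[of x] by (simp add: divide_inverse mult.commute)
  then have "(\<lambda>n. c * (x ^ n / fact n)) sums (c * exp x)" by (rule sums_mult)
  then show "summable (\<lambda>n. c * (x ^ n / fact n))" "(\<Sum>n. c * (x ^ n / fact n)) = c * exp x"
    by (simp_all add: sums_iff)
qed

lemma iter_term_term: assumes "\<bar>l\<bar> \<le> L" "a \<le> u"
  shows "\<bar>(- l) ^ n * iter_term n u\<bar> \<le> 1 * ((L * base_weight a) ^ n / fact n)"
proof -
  have "\<bar>(- l) ^ n\<bar> \<le> L ^ n" using assms by (simp add: power_abs power_mono)
  moreover have "\<bar>iter_term n u\<bar> \<le> base_weight u ^ n / fact n" using iter_term_bounds[of n] by simp
  moreover have "base_weight u ^ n / fact n \<le> base_weight a ^ n / fact n"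
    using base_weight_antimono[OF assms(2)] base_weight_nonneg by (intro divide_right_mono power_mono) auto
  ultimately have "\<bar>(- l) ^ n\<bar> * \<bar>iter_term n u\<bar> \<le> L ^ n * (base_weight a ^ n / fact n)"
    using assms by (intro mult_mono) auto
  then show ?thesis by (simp add: abs_mult power_mult_distrib)
qed

lemma iter_flux_term: assumes "\<bar>l\<bar> \<le> L" "a \<le> u"
  shows "\<bar>(- l) ^ n * iter_flux n u\<bar> \<le> base_tail u * ((L * base_weight a) ^ n / fact n)"
proof -
  have "\<bar>(- l) ^ n\<bar> \<le> L ^ n" using assms by (simp add: power_abs power_mono)
  moreover have "\<bar>iter_flux n u\<bar> \<le> base_tail u * (base_weight u ^ n / fact n)" using iter_term_bounds[of n] by simp
  moreover have "base_tail u * (base_weight u ^ n / fact n) \<le> base_tail u * (base_weight a ^ n / fact n)"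
    using base_weight_antimono[OF assms(2)] base_weight_nonneg by (intro divide_right_mono power_mono mult_left_mono base_tail_nonneg) auto
  ultimately have "\<bar>(- l) ^ n\<bar> * \<bar>iter_flux n u\<bar> \<le> L ^ n * (base_tail u * (base_weight a ^ n / fact n))"
    using assms by (intro mult_mono) auto
  then show ?thesis by (simp add: abs_mult power_mult_distrib mult_ac)
qed

lemma pert_series_summable: "summable (\<lambda>n. (- l) ^ n * iter_term n u)"
  by (rule summable_comparison_test'[OF exp_sum_bound(1)[of 1 "\<bar>l\<bar> * base_weight u"], of 0])
    (use iter_term_term[of l "\<bar>l\<bar>" u u] in simp)

lemma pert_flux_summable: "summable (\<lambda>n. (- l) ^ n * iter_flux n u)"
  by (rule summable_comparison_test'[OF exp_sum_bound(1)[of "base_tail u" "\<bar>l\<bar> * base_weight u"], of 0]) (use iter_flux_term[of l "\<bar>l\<bar>" u u] in simp_all)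

lemma pert_flux_deriv: "(pert_flux l has_real_derivative - (base_sol u ^ 2 * pert_series l u)) (at u)"
proof -
  define M where "M n = Sup (base_sol ` {u-1..u+1}) ^ 2 * ((\<bar>l\<bar> * base_weight (u-1)) ^ n / fact n)" for n
  have bd: "bdd_above (base_sol ` {u-1..u+1})"
    by (intro bounded_imp_bdd_above compact_imp_bounded compact_continuous_image base_sol_cont) simp
  have "(pert_flux l has_real_derivative (\<Sum>n. (- l) ^ n * - (base_sol u ^ 2 * iter_term n u))) (at u)"
    unfolding pert_flux_def
  proof (rule suminf_deriv[where M=M])
    show "summable (\<lambda>n. (- l) ^ n * iter_flux n u)" by (rule pert_flux_summable)
    show "((\<lambda>x. (- l) ^ n * iter_flux n x) has_real_derivative (- l) ^ n * - (base_sol x ^ 2 * iter_term n x)) (at x)" for n x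
      by (rule DERIV_cmult[OF iter_flux_deriv])
    show "summable M" unfolding M_def by (rule exp_sum_bound)
    fix n y assume y: "\<bar>y - u\<bar> \<le> 1"
    have "base_sol y \<le> Sup (base_sol ` {u-1..u+1})" by (rule cSup_upper[OF _ bd]) (use y in \<open>auto simp: abs_le_iff\<close>)
    then have "base_sol y ^ 2 \<le> Sup (base_sol ` {u-1..u+1}) ^ 2" using base_sol_pos[of y] by (intro power_mono) auto
    then have "base_sol y ^ 2 * \<bar>(- l) ^ n * iter_term n y\<bar> \<le> Sup (base_sol ` {u-1..u+1}) ^ 2 * (1 * ((\<bar>l\<bar> * base_weight (u-1)) ^ n / fact n))"
      using y by (intro mult_mono iter_term_term) auto
    then show "\<bar>(- l) ^ n * - (base_sol y ^ 2 * iter_term n y)\<bar> \<le> M n" unfolding M_def by (simp add: abs_mult mult_ac)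
  qed
  also have "(\<Sum>n. (- l) ^ n * - (base_sol u ^ 2 * iter_term n u)) = (\<Sum>n. - (base_sol u ^ 2) * ((- l) ^ n * iter_term n u))"
    by (simp add: mult_ac)
  also have "\<dots> = - (base_sol u ^ 2) * pert_series l u" unfolding pert_series_def
    by (rule suminf_mult[OF pert_series_summable])
  finally show ?thesis by simp
qed

text \<open>
  Termwise differentiation: the derivative of each term is the previous flux divided by \<open>w\<^sup>2\<close>, and on a
  compact interval these derivatives are dominated by an exponential series.
\<close>

lemma pert_series_deriv: "(pert_series l has_real_derivative l * pert_flux l u / base_sol u ^ 2) (at u)"
proof -
  define f where "f = (\<lambda>n x. (- l) ^ Suc n * iter_term (Suc n) x)"
  have pert_series: "pert_series l x = 1 + (\<Sum>n. f n x)" for x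
    unfolding pert_series_def f_def by (subst suminf_split_head[OF pert_series_summable]) simp
  have sf: "summable (\<lambda>n. f n x)" for x 
    unfolding f_def using pert_series_summable[of l x] by (subst summable_Suc_iff)
  define M where "M n = (\<bar>l\<bar> * Sup (base_tail_ratio ` {u-1..u+1})) * ((\<bar>l\<bar> * base_weight (u-1)) ^ n / fact n)" for n
  have bd: "bdd_above (base_tail_ratio ` {u-1..u+1})"
    by (intro bounded_imp_bdd_above compact_imp_bounded compact_continuous_image 
        exp_decaying_cont base_tail_ratio_exp_decaying) simp
  have "((\<lambda>x. \<Sum>n. f n x) has_real_derivative (\<Sum>n. (- l) ^ Suc n * - (iter_flux n u / base_sol u ^ 2))) (at u)"
  proof (rule suminf_deriv[where M=M])
    show "summable (\<lambda>n. f n u)" by (rule sf)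
    show "(f n has_real_derivative (- l) ^ Suc n * - (iter_flux n x / base_sol x ^ 2)) (at x)" for n x
      unfolding f_def by (rule DERIV_cmult[OF iter_term_deriv])
    show "summable M" unfolding M_def by (rule exp_sum_bound)
    fix n y assume y: "\<bar>y - u\<bar> \<le> 1"
    have k: "base_tail_ratio y \<le> Sup (base_tail_ratio ` {u-1..u+1})" by (rule cSup_upper[OF _ bd]) (use y in \<open>auto simp: abs_le_iff\<close>)
    have "\<bar>(- l) ^ n * iter_flux n y\<bar> \<le> base_tail y * ((\<bar>l\<bar> * base_weight (u-1)) ^ n / fact n)"
      using y by (intro iter_flux_term) auto
    then have "\<bar>(- l) ^ n * iter_flux n y\<bar> / base_sol y ^ 2 \<le> base_tail y * ((\<bar>l\<bar> * base_weight (u-1)) ^ n / fact n) / base_sol y ^ 2"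
      by (rule divide_right_mono) simp
    also have "\<dots> = base_tail_ratio y * ((\<bar>l\<bar> * base_weight (u-1)) ^ n / fact n)" by (simp add: base_tail_ratio_def mult.commute)
    also have "\<dots> \<le> Sup (base_tail_ratio ` {u-1..u+1}) * ((\<bar>l\<bar> * base_weight (u-1)) ^ n / fact n)"
      using base_weight_nonneg by (intro mult_right_mono k) auto
    finally have "\<bar>l\<bar> * (\<bar>(- l) ^ n * iter_flux n y\<bar> / base_sol y ^ 2) \<le> \<bar>l\<bar> * (Sup (base_tail_ratio ` {u-1..u+1}) * ((\<bar>l\<bar> * base_weight (u-1)) ^ n / fact n))"
      by (rule mult_left_mono) simp
    then show "\<bar>(- l) ^ Suc n * - (iter_flux n y / base_sol y ^ 2)\<bar> \<le> M n" unfolding M_def by (simp add: abs_mult mult_ac)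
  qed
  also have "(\<Sum>n. (- l) ^ Suc n * - (iter_flux n u / base_sol u ^ 2)) = (\<Sum>n. (l / base_sol u ^ 2) * ((- l) ^ n * iter_flux n u))"
    by (simp add: mult_ac)
  also have "\<dots> = l / base_sol u ^ 2 * pert_flux l u" unfolding pert_flux_def
    by (rule suminf_mult[OF pert_flux_summable])
  finally have "((\<lambda>x. 1 + (\<Sum>n. f n x)) has_real_derivative 0 + l / base_sol u ^ 2 * pert_flux l u) (at u)"
    by (intro DERIV_add DERIV_const)
  then show ?thesis unfolding pert_series[symmetric] by (simp add: mult.commute)
qed

lemma pert_series_cont: "continuous_on UNIV (\<lambda>p. pert_series (snd p) (fst p))"
  unfolding pert_series_def
proof (rule continuous_on_suminf)
  show "continuous_on UNIV (\<lambda>p::real\<times>real. (- snd p) ^ n * iter_term n (fst p))" for n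
    by (intro continuous_intros continuous_on_compose2[OF conjunct1[OF iter_term_bounds[of n]]]) auto
  fix p :: "real \<times> real"
  show "\<exists>U M. open U \<and> p \<in> U \<and> summable M \<and> (\<forall>n. \<forall>q\<in>U. \<bar>(- snd q) ^ n * iter_term n (fst q)\<bar> \<le> M n)"
  proof (intro exI conjI allI ballI)
    show "open ({fst p - 1<..} \<times> {- \<bar>snd p\<bar> - 1<..<\<bar>snd p\<bar> + 1})" by (intro open_Times) auto
    show "p \<in> {fst p - 1<..} \<times> {- \<bar>snd p\<bar> - 1<..<\<bar>snd p\<bar> + 1}" by (cases p) auto
    show "summable (\<lambda>n. 1 * (((\<bar>snd p\<bar> + 1) * base_weight (fst p - 1)) ^ n / fact n))" by (rule exp_sum_bound)
    fix n q assume "q \<in> {fst p - 1<..} \<times> {- \<bar>snd p\<bar> - 1<..<\<bar>snd p\<bar> + 1}"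
    then show "\<bar>(- snd q) ^ n * iter_term n (fst q)\<bar> \<le> 1 * (((\<bar>snd p\<bar> + 1) * base_weight (fst p - 1)) ^ n / fact n)"
      by (intro iter_term_term) auto
  qed
qed

lemma pert_flux_cont: "continuous_on UNIV (\<lambda>p. pert_flux (snd p) (fst p))"
  unfolding pert_flux_def
proof (rule continuous_on_suminf)
  show "continuous_on UNIV (\<lambda>p::real\<times>real. (- snd p) ^ n * iter_flux n (fst p))" for n
    by (intro continuous_intros continuous_on_compose2[OF iter_flux_cont[of n]]) auto
  fix p :: "real \<times> real"
  show "\<exists>U M. open U \<and> p \<in> U \<and> summable M \<and> (\<forall>n. \<forall>q\<in>U. \<bar>(- snd q) ^ n * iter_flux n (fst q)\<bar> \<le> M n)"
  proof (intro exI conjI allI ballI)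
    show "open ({fst p - 1<..} \<times> {- \<bar>snd p\<bar> - 1<..<\<bar>snd p\<bar> + 1})" by (intro open_Times) auto
    show "p \<in> {fst p - 1<..} \<times> {- \<bar>snd p\<bar> - 1<..<\<bar>snd p\<bar> + 1}" by (cases p) auto
    show "summable (\<lambda>n. base_tail (fst p - 1) * (((\<bar>snd p\<bar> + 1) * base_weight (fst p - 1)) ^ n / fact n))" by (rule exp_sum_bound)
    fix n q assume q: "q \<in> {fst p - 1<..} \<times> {- \<bar>snd p\<bar> - 1<..<\<bar>snd p\<bar> + 1}"
    then have "\<bar>(- snd q) ^ n * iter_flux n (fst q)\<bar> \<le> base_tail (fst q) * (((\<bar>snd p\<bar> + 1) * base_weight (fst p - 1)) ^ n / fact n)"
      by (intro iter_flux_term) auto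
    also have "\<dots> \<le> base_tail (fst p - 1) * (((\<bar>snd p\<bar> + 1) * base_weight (fst p - 1)) ^ n / fact n)"
      using q base_weight_nonneg by (intro mult_right_mono base_tail_antimono) auto
    finally show "\<bar>(- snd q) ^ n * iter_flux n (fst q)\<bar> \<le> base_tail (fst p - 1) * (((\<bar>snd p\<bar> + 1) * base_weight (fst p - 1)) ^ n / fact n)" .
  qed
qed

text \<open>
  The series starts with \<open>1\<close> and the remaining terms are dominated by those of the exponential series.
\<close>

lemma pert_series_bound: assumes "\<bar>l\<bar> \<le> L" shows "\<bar>pert_series l u - 1\<bar> \<le> exp (L * base_weight u) - 1"
proof -
  have sf: "summable (\<lambda>n. \<bar>(- l) ^ n * iter_term n u\<bar>)"
    by (rule summable_comparison_test'[OF exp_sum_bound(1)[of 1 "L * base_weight u"], of 0]) (use iter_term_term[of l L u u] assms in simp)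
  have s1: "summable (\<lambda>n. \<bar>(- l) ^ Suc n * iter_term (Suc n) u\<bar>)" using sf by (subst summable_Suc_iff)
  have s2: "summable (\<lambda>n. 1 * ((L * base_weight u) ^ Suc n / fact (Suc n)))"
    using exp_sum_bound(1)[of 1 "L * base_weight u"] by (subst summable_Suc_iff)
  have "pert_series l u - 1 = (\<Sum>n. (- l) ^ Suc n * iter_term (Suc n) u)"
    unfolding pert_series_def by (subst suminf_split_head[OF pert_series_summable]) simp
  also have "\<bar>\<dots>\<bar> \<le> (\<Sum>n. \<bar>(- l) ^ Suc n * iter_term (Suc n) u\<bar>)"
    by (rule summable_rabs[OF s1])
  also have "\<dots> \<le> (\<Sum>n. 1 * ((L * base_weight u) ^ Suc n / fact (Suc n)))"
    by (rule suminf_le[OF _ s1 s2]) (use iter_term_term[of l L u u] assms in blast)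
  also have "\<dots> = exp (L * base_weight u) - 1"
    using suminf_split_head[OF exp_sum_bound(1)[of 1 "L * base_weight u"]] exp_sum_bound(2)[of 1 "L * base_weight u"] by simp
  finally show ?thesis .
qed

lemma pert_flux_bound: "\<bar>pert_flux l u\<bar> \<le> base_tail u * exp (\<bar>l\<bar> * base_weight u)"
proof -
  have s1: "summable (\<lambda>n. \<bar>(- l) ^ n * iter_flux n u\<bar>)"
    by (rule summable_comparison_test'[OF exp_sum_bound(1)[of "base_tail u" "\<bar>l\<bar> * base_weight u"], of 0]) (use iter_flux_term[of l "\<bar>l\<bar>" u u] in simp_all)
  have "\<bar>pert_flux l u\<bar> \<le> (\<Sum>n. \<bar>(- l) ^ n * iter_flux n u\<bar>)" unfolding pert_flux_def by (rule summable_rabs[OF s1])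
  also have "\<dots> \<le> (\<Sum>n. base_tail u * ((\<bar>l\<bar> * base_weight u) ^ n / fact n))"
    by (rule suminf_le[OF _ s1 exp_sum_bound(1)]) (rule iter_flux_term, auto)
  finally show ?thesis unfolding exp_sum_bound .
qed

definition psi :: "real \<Rightarrow> real \<Rightarrow> real" where
  "psi E u = base_sol u * pert_series (E + (k + 1/2)^2) u"

definition psi' :: "real \<Rightarrow> real \<Rightarrow> real" where
  "psi' E u = base_logderiv u * base_sol u * pert_series (E + (k + 1/2)^2) u + (E + (k + 1/2)^2) * pert_flux (E + (k + 1/2)^2) u / base_sol u"

lemma psi_deriv: "(psi E has_real_derivative psi' E u) (at u)"
proof -
  have "(psi E has_real_derivative base_logderiv u * base_sol u * pert_series (E + (k + 1/2)^2) u 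
     + (E + (k + 1/2)^2) * pert_flux (E + (k + 1/2)^2) u / base_sol u ^ 2 * base_sol u) (at u)"
    unfolding psi_def by (rule DERIV_mult'[OF base_sol_deriv pert_series_deriv, THEN DERIV_cong]) (simp add: mult_ac)
  then show ?thesis unfolding psi'_def using base_sol_pos[of u] by (simp add: power2_eq_square)
qed

lemma psi'_deriv: "(psi' E has_real_derivative (morse_potential k u - E) * psi E u) (at u)"
proof -
  define l where "l = E + (k + 1/2)^2"
  have wne: "base_sol u \<noteq> 0" using base_sol_pos[of u] by simp
  have V: "morse_potential k u - E = - exp u / 2 + base_logderiv u ^ 2 - l"
    unfolding base_logderiv_riccati l_def by simp
  have "((\<lambda>u. base_logderiv u * base_sol u * pert_series l u + l * pert_flux l u / base_sol u) has_real_derivative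
     ((- exp u / 2) * base_sol u + base_logderiv u * (base_logderiv u * base_sol u)) * pert_series l u + base_logderiv u * base_sol u * (l * pert_flux l u / base_sol u ^ 2)
     + (l * (- (base_sol u ^ 2 * pert_series l u)) * base_sol u - l * pert_flux l u * (base_logderiv u * base_sol u)) / (base_sol u * base_sol u)) (at u)"
    by (auto intro!: derivative_eq_intros base_logderiv_deriv base_sol_deriv pert_series_deriv pert_flux_deriv wne simp: algebra_simps)
  also have "((- exp u / 2) * base_sol u + base_logderiv u * (base_logderiv u * base_sol u)) * pert_series l u + base_logderiv u * base_sol u * (l * pert_flux l u / base_sol u ^ 2)
     + (l * (- (base_sol u ^ 2 * pert_series l u)) * base_sol u - l * pert_flux l u * (base_logderiv u * base_sol u)) / (base_sol u * base_sol u)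
     = (morse_potential k u - E) * psi E u" unfolding V psi_def l_def[symmetric] using wne
    by (simp add: field_simps power2_eq_square)
  finally show ?thesis unfolding psi'_def[abs_def] l_def .
qed

lemma psi_cont: "continuous_on UNIV (\<lambda>p. psi (snd p) (fst p))"
proof -
  have "continuous_on UNIV (\<lambda>p::real\<times>real. pert_series (snd p + (k + 1/2)^2) (fst p))"
    by (rule continuous_on_compose2[OF pert_series_cont, of UNIV "\<lambda>p. (fst p, snd p + (k + 1/2)^2)", simplified])
      (intro continuous_intros)
  then show ?thesis unfolding psi_def
    by (intro continuous_on_mult continuous_on_compose2[OF base_sol_cont[of UNIV]] continuous_intros) auto
qed

lemma psi'_cont: "continuous_on UNIV (\<lambda>p. psi' (snd p) (fst p))"
proof -
  have 1: "continuous_on UNIV (\<lambda>p::real\<times>real. pert_series (snd p + (k + 1/2)^2) (fst p))"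
    by (rule continuous_on_compose2[OF pert_series_cont, of UNIV "\<lambda>p. (fst p, snd p + (k + 1/2)^2)", simplified])
      (intro continuous_intros)
  have 2: "continuous_on UNIV (\<lambda>p::real\<times>real. pert_flux (snd p + (k + 1/2)^2) (fst p))"
    by (rule continuous_on_compose2[OF pert_flux_cont, of UNIV "\<lambda>p. (fst p, snd p + (k + 1/2)^2)", simplified])
      (intro continuous_intros)
  have wne: "base_sol u \<noteq> 0" for u using base_sol_pos[of u] by simp
  show ?thesis unfolding psi'_def
    by (intro continuous_on_add continuous_on_mult continuous_on_divide 1 2
      continuous_on_compose2[OF base_sol_cont[of UNIV]] continuous_on_compose2[OF base_logderiv_cont[of UNIV]] continuous_intros) 
      (auto simp: wne)
qed

lemma psi_exp_decaying: "exp_decaying (psi E)"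
proof -
  define L where "L = \<bar>E + (k + 1/2)^2\<bar>"
  have c: "continuous_on UNIV (psi E)"
    by (rule DERIV_continuous_on[OF has_field_derivative_at_within[OF psi_deriv]])
  have "((\<lambda>u. exp (L * base_weight u) - 1) \<longlongrightarrow> exp (L * 0) - 1) at_top" by (intro tendsto_intros base_weight_tendsto)
  then have "\<forall>\<^sub>F u in at_top. exp (L * base_weight u) - 1 < 1" by (rule order_tendstoD) simp
  then have "\<forall>\<^sub>F u in at_top. \<bar>psi E u\<bar> \<le> 2 * \<bar>base_sol u\<bar>"
  proof eventually_elim
    case (elim u)
    have "\<bar>pert_series (E + (k + 1/2)^2) u\<bar> \<le> 2" using pert_series_bound[of "E + (k + 1/2)^2" L u] elim unfolding L_def by linarith
    then have "\<bar>pert_series (E + (k + 1/2)^2) u\<bar> * \<bar>base_sol u\<bar> \<le> 2 * \<bar>base_sol u\<bar>" by (rule mult_right_mono) simp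
    then show ?case by (simp add: psi_def abs_mult mult.commute)
  qed
  then show ?thesis by (rule exp_decaying_mono[OF base_sol_exp_decaying c]) simp
qed

lemma psi'_exp_decaying: "exp_decaying (psi' E)"
proof -
  define l where "l = E + (k + 1/2)^2"
  have c: "continuous_on UNIV (psi' E)"
    by (rule DERIV_continuous_on[OF has_field_derivative_at_within[OF psi'_deriv]])
  obtain C where C: "\<forall>\<^sub>F u in at_top. \<bar>base_logderiv u * base_sol u\<bar> \<le> C * exp (- u)"
    using base_sol_deriv_exp_decaying unfolding exp_decaying_def by blast
  obtain D where D: "\<forall>\<^sub>F u in at_top. \<bar>base_sol u\<bar> \<le> D * exp (- u)"
    using base_sol_exp_decaying unfolding exp_decaying_def by blast
  have "((\<lambda>u. exp (\<bar>l\<bar> * base_weight u) - 1) \<longlongrightarrow> exp (\<bar>l\<bar> * 0) - 1) at_top" by (intro tendsto_intros base_weight_tendsto)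
  then have ev1: "\<forall>\<^sub>F u in at_top. exp (\<bar>l\<bar> * base_weight u) - 1 < 1" by (rule order_tendstoD) simp
  have ev2: "\<forall>\<^sub>F u in at_top. base_tail_ratio u < 1"
    using exp_decaying_tendsto[OF base_tail_ratio_exp_decaying] by (rule order_tendstoD) simp
  have "\<forall>\<^sub>F u in at_top. \<bar>psi' E u\<bar> \<le> (2 * C + 2 * \<bar>l\<bar> * D) * exp (- u)"
    using ev1 ev2 C D
  proof eventually_elim
    case (elim u)
    have "\<bar>pert_series l u\<bar> \<le> 2" using pert_series_bound[of l "\<bar>l\<bar>" u] elim by linarith
    then have 1: "\<bar>base_logderiv u * base_sol u\<bar> * \<bar>pert_series l u\<bar> \<le> (C * exp (- u)) * 2" using elim by (intro mult_mono) auto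
    have "\<bar>pert_flux l u\<bar> / base_sol u \<le> base_tail u * exp (\<bar>l\<bar> * base_weight u) / base_sol u"
      using base_sol_pos[of u] by (intro divide_right_mono pert_flux_bound) auto
    also have "\<dots> = base_tail_ratio u * exp (\<bar>l\<bar> * base_weight u) * base_sol u" using base_sol_pos[of u] by (simp add: base_tail_ratio_def power2_eq_square)
    also have "\<dots> \<le> 1 * 2 * (D * exp (- u))" using elim base_sol_pos[of u] base_tail_ratio_nonneg[of u] by (intro mult_mono) auto
    finally have "\<bar>l\<bar> * (\<bar>pert_flux l u\<bar> / base_sol u) \<le> \<bar>l\<bar> * (1 * 2 * (D * exp (- u)))" by (rule mult_left_mono) simp
    moreover have "\<bar>l * pert_flux l u / base_sol u\<bar> = \<bar>l\<bar> * (\<bar>pert_flux l u\<bar> / base_sol u)" using base_sol_pos[of u] by (simp add: abs_mult)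
    moreover have "\<bar>psi' E u\<bar> \<le> \<bar>base_logderiv u * base_sol u\<bar> * \<bar>pert_series l u\<bar> + \<bar>l * pert_flux l u / base_sol u\<bar>"
      unfolding psi'_def l_def[symmetric] by (metis abs_mult abs_triangle_ineq)
    ultimately show ?case using 1 by (simp add: algebra_simps)
  qed
  then show ?thesis by (rule exp_decayingI[OF c])
qed

text \<open>
  The bound \<open>b\<close> does not depend on \<open>E\<close> in a bounded range of energies. This lets the
  normalisation of the angle at infinity be transported from one energy to another.
\<close>

lemma psi_eventually_pos: "\<exists>b. \<forall>u\<ge>b. \<forall>E. \<bar>E + (k + 1/2)^2\<bar> \<le> L \<longrightarrow> psi E u > 0"
proof -
  have "((\<lambda>u. exp (L * base_weight u) - 1) \<longlongrightarrow> exp (L * 0) - 1) at_top" by (intro tendsto_intros base_weight_tendsto)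
  then have "\<forall>\<^sub>F u in at_top. exp (L * base_weight u) - 1 < 1" by (rule order_tendstoD) simp
  then obtain b where b: "\<And>u. u \<ge> b \<Longrightarrow> exp (L * base_weight u) - 1 < 1" unfolding eventually_at_top_linorder by blast
  have "psi E u > 0" if "u \<ge> b" "\<bar>E + (k + 1/2)^2\<bar> \<le> L" for u E
  proof -
    have "pert_series (E + (k + 1/2)^2) u > 0" using pert_series_bound[OF that(2), of u] b[OF that(1)] by linarith
    then show ?thesis unfolding psi_def using base_sol_pos by simp
  qed
  then show ?thesis by blast
qed

end

section \<open>Absolutely continuous functions and density points\<close>

text \<open>
  A Cousin-type argument: choose a gauge that is fine enough for the difference quotient
  to be at most \<open>e\<close> at points where the derivative vanishes, and that forces the
  intervals tagged in the null set \<open>N\<close> into an open set of small measure. The first kind of interval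
  contributes at most \<open>e * (b - a)\<close> to the increment of \<open>h\<close>, the second at most \<open>e\<close> by absolute continuity.
\<close>

lemma absolutely_continuous_zero_deriv_const:
  fixes h :: "real \<Rightarrow> 'a::real_normed_vector"
  assumes ac: "absolutely_continuous_on {a..b} h" and ab: "a \<le> b" and N: "negligible N"
    and d0: "\<And>x. x \<in> {a..b} - N \<Longrightarrow> (h has_vector_derivative 0) (at x within {a..b})"
  shows "h b = h a"
proof -
  have small: "norm (h b - h a) \<le> e * (1 + (b - a))" if e: "e > 0" for e :: real
  proof -
    obtain \<delta> where \<delta>: "\<delta> > 0" and ac': "\<And>p. p division_of \<Union>p \<Longrightarrow> \<Union>p \<subseteq> {a..b} \<Longrightarrow>
        (\<Sum>K\<in>p. measure lborel K) < \<delta> \<Longrightarrow> (\<Sum>K\<in>p. norm (h (Sup K) - h (Inf K))) < e"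
      using ac e unfolding absolutely_continuous_on_def by meson
    have Nn: "N \<in> null_sets lebesgue" using N negligible_iff_null_sets by blast
    then obtain U where U: "open U" "N \<subseteq> U" "(U - N) \<in> lmeasurable" "emeasure lebesgue (U - N) < ennreal \<delta>"
      using sets_lebesgue_outer_open[of N \<delta>] \<delta> by (metis null_setsD2)
    have UN: "U = (U - N) \<union> N" using U(2) by blast
    have Um: "U \<in> lmeasurable" using fmeasurable.Un[OF U(3) negligible_imp_measurable[OF N]] UN by simp
    have eU: "emeasure lebesgue U = emeasure lebesgue (U - N)"
      using emeasure_Un_null_set[OF fmeasurableD[OF U(3)] Nn] UN by simp
    have "ennreal (measure lebesgue U) < ennreal \<delta>"
      using U(4) unfolding eU[symmetric] emeasure_eq_measure2[OF Um] .
    then have mU: "measure lebesgue U < \<delta>" by (simp add: ennreal_less_iff)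
    have "\<exists>r>0. \<forall>y\<in>{a..b}. \<bar>y - x\<bar> < r \<longrightarrow> norm (h y - h x) \<le> e * \<bar>y - x\<bar>" if "x \<in> {a..b} - N" for x
    proof -
      have "(h has_derivative (\<lambda>t. t *\<^sub>R 0)) (at x within {a..b})"
        using d0[OF that] unfolding has_vector_derivative_def .
      then have "\<exists>r>0. \<forall>y\<in>{a..b}. norm (y - x) < r \<longrightarrow> norm (h y - h x - (y - x) *\<^sub>R 0) \<le> e * norm (y - x)"
        using e unfolding has_derivative_within_alt by meson
      then show ?thesis by simp
    qed
    then obtain r where r: "\<And>x. x \<in> {a..b} - N \<Longrightarrow> r x > 0"
      "\<And>x y. x \<in> {a..b} - N \<Longrightarrow> y \<in> {a..b} \<Longrightarrow> \<bar>y - x\<bar> < r x \<Longrightarrow> norm (h y - h x) \<le> e * \<bar>y - x\<bar>"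
      by metis
    \<comment> \<open>Tags in \<open>N\<close> force their interval into \<open>U\<close>; at other tags the derivative controls the increment.\<close>
    define \<gamma> where "\<gamma> = (\<lambda>x. if x \<in> N then U else if x \<in> {a..b} then ball x (r x) else ball x 1)"
    have "gauge \<gamma>" unfolding gauge_def \<gamma>_def using U r(1) by auto
    then obtain p where p: "p tagged_division_of {a..b}" "\<gamma> fine p"
      using fine_division_exists_real by blast
    have fp: "finite p" by (rule tagged_division_of_finite[OF p(1)])
    define p1 where "p1 = {xK\<in>p. fst xK \<in> N}"
    define p2 where "p2 = {xK\<in>p. fst xK \<notin> N}"
    have p12: "p = p1 \<union> p2" "p1 \<inter> p2 = {}" "finite p1" "finite p2" using fp by (auto simp: p1_def p2_def)
    let ?f = "\<lambda>(x,K::real set). norm (h (Sup K) - h (Inf K))"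
    have intv: "\<exists>c d. K = {c..d} \<and> c \<le> x \<and> x \<le> d \<and> a \<le> c \<and> d \<le> b \<and> measure lborel K = d - c"
      if "(x,K) \<in> p" for x K
    proof -
      obtain c d where K: "K = cbox c d" using tagged_division_ofD(4)[OF p(1)] \<open>(x,K) \<in> p\<close> by blast
      have "x \<in> K" "K \<subseteq> {a..b}" using tagged_division_ofD(2,3)[OF p(1)] \<open>(x,K) \<in> p\<close> by auto
      then show ?thesis using K by (intro exI[of _ c] exI[of _ d]) auto
    qed
    have s2: "sum ?f p2 \<le> e * (b - a)"
    proof -
      have "sum ?f p2 \<le> (\<Sum>(x,K)\<in>p2. e * measure lborel K)"
      proof (rule sum_mono, clarify)
        fix x K assume xK: "(x,K) \<in> p2"
        then have xp: "(x,K) \<in> p" and xN: "x \<notin> N" by (auto simp: p2_def)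
        obtain c d where K: "K = {c..d}" "c \<le> x" "x \<le> d" "a \<le> c" "d \<le> b" "measure lborel K = d - c"
          using intv[OF xp] by blast
        have xab: "x \<in> {a..b} - N" using K xN by auto
        have "K \<subseteq> ball x (r x)" using p(2) xp xab unfolding fine_def \<gamma>_def by fastforce
        moreover have "c \<in> K" "d \<in> K" using K by auto
        ultimately have "\<bar>c - x\<bar> < r x" "\<bar>d - x\<bar> < r x" by (auto simp: dist_real_def)
        then have "norm (h d - h x) \<le> e * \<bar>d - x\<bar>" "norm (h c - h x) \<le> e * \<bar>c - x\<bar>"
          by (intro r(2)[OF xab]; use K in simp)+
        moreover have "norm (h d - h c) \<le> norm (h d - h x) + norm (h c - h x)"
          using norm_triangle_ineq4[of "h d - h x" "h c - h x"] by simp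
        ultimately have "norm (h d - h c) \<le> e * (d - x) + e * (x - c)" using K by simp
        also have "\<dots> = e * (d - c)" by (simp add: algebra_simps)
        finally show "norm (h (Sup K) - h (Inf K)) \<le> e * measure lborel K" using K by simp
      qed
      also have "\<dots> = e * (\<Sum>(x,K)\<in>p2. measure lborel K)" by (simp add: sum_distrib_left split_def)
      also have "\<dots> \<le> e * (\<Sum>(x,K)\<in>p. measure lborel K)"
        using e fp p12 by (intro mult_left_mono sum_mono2) auto
      also have "(\<Sum>(x,K)\<in>p. measure lborel K) = b - a"
        using additive_content_tagged_division[of p a b] p(1) ab by simp
      finally show ?thesis .
    qed
    have tp1: "p1 tagged_division_of \<Union>(snd ` p1)"
      by (rule tagged_partial_division_of_Union_self, rule tagged_partial_division_subset[of p "{a..b}"])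
        (use p(1) in \<open>auto simp: tagged_division_of_def p1_def\<close>)
    have D: "(snd ` p1) division_of \<Union>(snd ` p1)" by (rule division_of_tagged_division[OF tp1])
    have s1: "sum ?f p1 \<le> e"
    proof -
      let ?g = "\<lambda>K. if K = {} then 0 else norm (h (Sup K) - h (Inf K))"
      have ne: "K \<noteq> {}" if "(x,K) \<in> p1" for x K using tagged_division_ofD(2)[OF p(1)] that by (auto simp: p1_def)
      have "sum ?f p1 = (\<Sum>(x,K)\<in>p1. ?g K)" by (rule sum.cong) (auto dest: ne)
      also have "\<dots> = (\<Sum>K\<in>snd ` p1. ?g K)"
      proof (rule sum.over_tagged_division_lemma[OF tp1])
        fix u v :: real assume "box u v = {}"
        then have "v \<le> u" by simp
        then show "?g (cbox u v) = 0" by (cases "u = v") auto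
      qed
      also have "\<dots> = (\<Sum>K\<in>snd ` p1. norm (h (Sup K) - h (Inf K)))"
        by (rule sum.cong) (auto dest: ne)
      also have "\<dots> < e"
      proof (rule ac'[OF D])
        show "\<Union>(snd ` p1) \<subseteq> {a..b}" using tagged_division_ofD(3)[OF p(1)] by (force simp: p1_def)
        have sub: "\<Union>(snd ` p1) \<subseteq> U" using p(2) by (force simp: p1_def fine_def \<gamma>_def)
        have "(\<Sum>K\<in>snd ` p1. measure lborel K) = (\<Sum>K\<in>snd ` p1. measure lebesgue K)"
        proof (rule sum.cong[OF refl])
          fix K assume "K \<in> snd ` p1"
          then obtain x where "(x,K) \<in> p" by (auto simp: p1_def)
          then obtain c d where "K = {c..d}" using intv by blast
          then show "measure lborel K = measure lebesgue K" by (simp add: measure_completion)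
        qed
        also have "\<dots> = measure lebesgue (\<Union>(snd ` p1))" by (rule content_division[OF D])
        also have "\<dots> \<le> measure lebesgue U"
          using sub Um D by (intro measure_mono_fmeasurable lmeasurable_division[THEN fmeasurableD]) auto
        finally show "(\<Sum>K\<in>snd ` p1. measure lborel K) < \<delta>" using mU by simp
      qed
      finally show ?thesis by simp
    qed
    have "norm (h b - h a) = norm (\<Sum>(x,K)\<in>p. h (Sup K) - h (Inf K))"
      using additive_tagged_division_1[OF ab p(1), of h] by simp
    also have "\<dots> \<le> sum ?f p" by (rule order_trans[OF norm_sum]) (simp add: split_def)
    also have "\<dots> = sum ?f p1 + sum ?f p2" unfolding p12(1) by (rule sum.union_disjoint) (use p12 in auto)
    finally show ?thesis using s1 s2 by (simp add: algebra_simps)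
  qed
  have "norm (h b - h a) \<le> 0"
  proof (rule field_le_epsilon)
    fix e :: real assume "e > 0"
    then show "norm (h b - h a) \<le> 0 + e" using small[of "e / (1 + (b - a))"] ab by simp
  qed
  then show ?thesis by simp
qed

text \<open>
  Each isolated point is the only point of \<open>A\<close> in some member of a countable base.
\<close>

lemma countable_isolated_points:
  fixes A :: "'a::second_countable_topology set"
  shows "countable {x\<in>A. \<not> x islimpt A}"
proof -
  obtain B :: "'a set set" where B: "countable B" "\<And>U. U \<in> B \<Longrightarrow> open U"
    "\<And>S. open S \<Longrightarrow> \<exists>U. U \<subseteq> B \<and> S = \<Union>U" by (rule univ_second_countable) blast
  have "{x\<in>A. \<not> x islimpt A} \<subseteq> (\<Union>U\<in>B. {x. A \<inter> U = {x}})"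
  proof clarify
    fix x assume x: "x \<in> A" "\<not> x islimpt A"
    then obtain T where T: "x \<in> T" "open T" "\<And>y. y \<in> A \<Longrightarrow> y \<in> T \<Longrightarrow> y = x"
      unfolding islimpt_def by blast
    obtain U where "U \<subseteq> B" "T = \<Union>U" using B(3)[OF T(2)] by blast
    then obtain W where "W \<in> B" "x \<in> W" "W \<subseteq> T" using T(1) by blast
    then show "x \<in> (\<Union>U\<in>B. {x. A \<inter> U = {x}})" using x T by blast
  qed
  moreover have "countable {x. A \<inter> U = {x}}" for U
  proof -
    have "{x. A \<inter> U = {x}} \<subseteq> {THE x. A \<inter> U = {x}}" by auto
    then show ?thesis by (rule countable_subset) simp
  qed
  ultimately show ?thesis by (rule countable_subset[OF _ countable_UN[OF B(1)]])
qed

text \<open>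
  Lebesgue's differentiation theorem for the indicator function of \<open>L\<close>. At a density point \<open>x\<close> the last point \<open>p\<close> of
  \<open>L\<close> before \<open>y\<close> is close to \<open>y\<close> relative to \<open>y - x\<close>, since the gap between \<open>p\<close> and \<open>y\<close> misses \<open>L\<close>.
\<close>

lemma right_density_points:
  fixes L :: "real set"
  assumes L: "closed L"
  obtains N where "negligible N"
    "\<And>x e. x \<in> L - N \<Longrightarrow> e > 0 \<Longrightarrow> \<exists>d>0. \<forall>y. x < y \<and> y < x + d \<longrightarrow>
       (\<exists>p\<in>L. x \<le> p \<and> p \<le> y \<and> y - p \<le> e * (y - x) \<and> {p<..y} \<inter> L = {})"
proof -
  have "indicat_real L integrable_on cbox a b" for a b
    unfolding integrable_on_indicator by (rule lmeasurable_compact[OF closed_Int_compact[OF L compact_cbox]])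
  from integrable_ccontinuous_explicit[OF this] obtain N where N: "negligible N"
    "\<And>x e. \<lbrakk>x \<notin> N; 0 < e\<rbrakk> \<Longrightarrow> \<exists>d>0. \<forall>h. 0 < h \<and> h < d \<longrightarrow>
       norm (integral (cbox x (x + h *\<^sub>R One)) (indicat_real L) /\<^sub>R h ^ DIM(real) - indicat_real L x) < e"
    by blast
  show ?thesis
  proof (rule that[OF N(1)])
    fix x e :: real assume x: "x \<in> L - N" and e: "e > 0"
    then obtain d where d: "d > 0" "\<And>h. 0 < h \<Longrightarrow> h < d \<Longrightarrow>
       norm (integral (cbox x (x + h *\<^sub>R One)) (indicat_real L) /\<^sub>R h ^ DIM(real) - indicat_real L x) < e"
      using N(2)[of x e] by blast
    have "\<exists>p\<in>L. x \<le> p \<and> p \<le> y \<and> y - p \<le> e * (y - x) \<and> {p<..y} \<inter> L = {}" if y: "x < y" "y < x + d" for y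
    proof -
      define p where "p = Sup (L \<inter> {x..y})"
      have ne: "L \<inter> {x..y} \<noteq> {}" "bdd_above (L \<inter> {x..y})" using x y by auto
      have pin: "p \<in> L \<inter> {x..y}" unfolding p_def
        by (rule closed_contains_Sup[OF ne]) (use L in auto)
      have up: "z \<le> p" if "z \<in> L" "x \<le> z" "z \<le> y" for z
        unfolding p_def by (rule cSup_upper[OF _ ne(2)]) (use that in auto)
      have "integral {x..y} (indicat_real L) \<le> integral {x..y} (indicat_real {x..p})"
      proof (rule integral_le)
        show "indicat_real L integrable_on {x..y}" unfolding integrable_on_indicator
          by (rule lmeasurable_compact[OF closed_Int_compact[OF L compact_Icc]])
        show "indicat_real {x..p} integrable_on {x..y}" unfolding integrable_on_indicator by simp
      qed (use up in \<open>auto simp: indicator_def\<close>)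
      also have "\<dots> = p - x" 
      proof -
        have "integral {x..y} (indicat_real {x..p}) = measure lebesgue ({x..p} \<inter> {x..y})"
          by (rule integral_indicator) simp
        also have "{x..p} \<inter> {x..y} = {x..p}" using pin by auto
        finally show ?thesis using pin by simp
      qed
      finally have le: "integral {x..y} (indicat_real L) \<le> p - x" .
      have "\<bar>integral {x..y} (indicat_real L) / (y - x) - 1\<bar> < e"
        using d(2)[of "y - x"] y x by (simp add: divide_inverse mult.commute)
      then have "1 - e < integral {x..y} (indicat_real L) / (y - x)" by linarith
      also have "\<dots> \<le> (p - x) / (y - x)" using le y by (intro divide_right_mono) auto
      finally have "(1 - e) * (y - x) < p - x" using y by (simp add: pos_less_divide_eq)
      then have "y - p \<le> e * (y - x)" by (simp add: algebra_simps)
      moreover have "{p<..y} \<inter> L = {}" using up pin by force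
      ultimately show ?thesis using pin by auto
    qed
    then show "\<exists>d>0. \<forall>y. x < y \<and> y < x + d \<longrightarrow>
       (\<exists>p\<in>L. x \<le> p \<and> p \<le> y \<and> y - p \<le> e * (y - x) \<and> {p<..y} \<inter> L = {})" using d(1) by blast
  qed
qed

text \<open>
  The two-sided version follows by reflection: close to a density point every \<open>y\<close> can be
  replaced by a point of \<open>L\<close> with an error of lower order, without leaving a gap of \<open>L\<close>.
\<close>

lemma density_points:
  fixes L :: "real set"
  assumes L: "closed L"
  obtains N where "negligible N"
    "\<And>x e. x \<in> L - N \<Longrightarrow> e > 0 \<Longrightarrow> \<exists>d>0. \<forall>y. \<bar>y - x\<bar> < d \<longrightarrow>
       (\<exists>p\<in>L. \<bar>p - x\<bar> \<le> \<bar>y - x\<bar> \<and> \<bar>y - p\<bar> \<le> e * \<bar>y - x\<bar> \<and> {min p y<..<max p y} \<inter> L = {})"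
proof -
  obtain N1 where N1: "negligible N1"
    "\<And>x e. x \<in> L - N1 \<Longrightarrow> e > 0 \<Longrightarrow> \<exists>d>0. \<forall>y. x < y \<and> y < x + d \<longrightarrow>
       (\<exists>p\<in>L. x \<le> p \<and> p \<le> y \<and> y - p \<le> e * (y - x) \<and> {p<..y} \<inter> L = {})"
    using right_density_points[OF L] by blast
  obtain N2 where N2: "negligible N2"
    "\<And>x e. x \<in> uminus ` L - N2 \<Longrightarrow> e > 0 \<Longrightarrow> \<exists>d>0. \<forall>y. x < y \<and> y < x + d \<longrightarrow>
       (\<exists>p\<in>uminus ` L. x \<le> p \<and> p \<le> y \<and> y - p \<le> e * (y - x) \<and> {p<..y} \<inter> uminus ` L = {})"
    using right_density_points[OF closed_negations[OF L]] by blast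
  have "negligible (uminus ` N2)" 
    by (rule negligible_differentiable_image_negligible[OF _ N2(1)])
      (auto intro!: derivative_intros simp: differentiable_on_def)
  then have N: "negligible (N1 \<union> uminus ` N2)" using N1(1) by simp
  show ?thesis
  proof (rule that[OF N])
    fix x e :: real assume x: "x \<in> L - (N1 \<union> uminus ` N2)" and e: "e > 0"
    obtain d1 where d1: "d1 > 0" "\<And>y. x < y \<Longrightarrow> y < x + d1 \<Longrightarrow>
       (\<exists>p\<in>L. x \<le> p \<and> p \<le> y \<and> y - p \<le> e * (y - x) \<and> {p<..y} \<inter> L = {})"
      using N1(2)[of x e] x e by blast
    have "- x \<in> uminus ` L - N2" using x by (auto simp: image_iff)
    then obtain d2 where d2: "d2 > 0" "\<And>y. -x < y \<Longrightarrow> y < -x + d2 \<Longrightarrow>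
       (\<exists>p\<in>uminus ` L. -x \<le> p \<and> p \<le> y \<and> y - p \<le> e * (y + x) \<and> {p<..y} \<inter> uminus ` L = {})"
      using N2(2)[of "-x" e] e by auto
    have "\<exists>p\<in>L. \<bar>p - x\<bar> \<le> \<bar>y - x\<bar> \<and> \<bar>y - p\<bar> \<le> e * \<bar>y - x\<bar> \<and> {min p y<..<max p y} \<inter> L = {}"
      if y: "\<bar>y - x\<bar> < min d1 d2" for y
    proof -
      consider "y = x" | "y > x" | "y < x" by linarith
      then show ?thesis
      proof cases
        case 1 then show ?thesis using x by (intro bexI[of _ x]) auto
      next
        case 2
        then obtain p where p: "p \<in> L" "x \<le> p" "p \<le> y" "y - p \<le> e * (y - x)" "{p<..y} \<inter> L = {}"
          using d1(2)[of y] y by auto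
        have "{min p y<..<max p y} \<subseteq> {p<..y}" using p by auto
        then show ?thesis using p 2 by (intro bexI[of _ p]) auto
      next
        case 3
        have "\<exists>q\<in>uminus ` L. -x \<le> q \<and> q \<le> -y \<and> -y - q \<le> e * (-y + x) \<and> {q<..-y} \<inter> uminus ` L = {}"
          by (rule d2(2)) (use 3 y in auto)
        then obtain q where q: "q \<in> uminus ` L" "-x \<le> q" "q \<le> -y" "-y - q \<le> e * (-y + x)" "{q<..-y} \<inter> uminus ` L = {}"
          by blast
        have "-q \<in> L" using q(1) by auto
        moreover have "z \<notin> L" if "min (-q) y < z" "z < max (-q) y" for z
        proof
          assume "z \<in> L"
          then have "-z \<in> uminus ` L" by auto
          moreover have "-z \<in> {q<..-y}" using that q by auto
          ultimately show False using q(5) by blast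
        qed
        ultimately show ?thesis using q 3 by (intro bexI[of _ "-q"]) auto
      qed
    qed
    then show "\<exists>d>0. \<forall>y. \<bar>y - x\<bar> < d \<longrightarrow>
       (\<exists>p\<in>L. \<bar>p - x\<bar> \<le> \<bar>y - x\<bar> \<and> \<bar>y - p\<bar> \<le> e * \<bar>y - x\<bar> \<and> {min p y<..<max p y} \<inter> L = {})"
      using d1(1) d2(1) by (intro exI[of _ "min d1 d2"]) auto
  qed
qed

section \<open>Eigenfunctions are classical solutions\<close>

lemma absolutely_continuous_on_lipschitz:
  fixes f :: "real \<Rightarrow> 'a::real_normed_vector"
  assumes L: "\<And>x y. x \<in> S \<Longrightarrow> y \<in> S \<Longrightarrow> norm (f x - f y) \<le> M * \<bar>x - y\<bar>" and M: "M > 0"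
  shows "absolutely_continuous_on S f"
  unfolding absolutely_continuous_on_def
proof (intro allI impI)
  fix e :: real assume e: "e > 0"
  show "\<exists>\<delta>>0. \<forall>p. p division_of \<Union>p \<longrightarrow> \<Union>p \<subseteq> S \<longrightarrow> (\<Sum>K\<in>p. measure lborel K) < \<delta> \<longrightarrow>
     (\<Sum>K\<in>p. norm (f (Sup K) - f (Inf K))) < e"
  proof (intro exI[of _ "e / M"] conjI allI impI)
    show "e / M > 0" using e M by simp
    fix p assume p: "p division_of \<Union>p" "\<Union>p \<subseteq> S" "(\<Sum>K\<in>p. measure lborel K) < e / M"
    have "(\<Sum>K\<in>p. norm (f (Sup K) - f (Inf K))) \<le> (\<Sum>K\<in>p. M * measure lborel K)"
    proof (rule sum_mono)
      fix K assume K: "K \<in> p"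
      then obtain a b where ab: "K = cbox a b" using division_ofD(4)[OF p(1)] by blast
      have "K \<noteq> {}" "K \<subseteq> S" using division_ofD(3)[OF p(1) K] p(2) K by auto
      then have "a \<le> b" "a \<in> S" "b \<in> S" using ab by auto
      then show "norm (f (Sup K) - f (Inf K)) \<le> M * measure lborel K" using L[of b a] ab by simp
    qed
    also have "\<dots> = M * (\<Sum>K\<in>p. measure lborel K)" by (simp add: sum_distrib_left)
    also have "\<dots> < e" using p(3) M by (simp add: field_simps)
    finally show "(\<Sum>K\<in>p. norm (f (Sup K) - f (Inf K))) < e" .
  qed
qed

lemma absolutely_continuous_on_diff:
  fixes f g :: "real \<Rightarrow> 'a::real_normed_vector"
  assumes "absolutely_continuous_on S f" "absolutely_continuous_on S g"
  shows "absolutely_continuous_on S (\<lambda>x. f x - g x)"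
  unfolding absolutely_continuous_on_def
proof (intro allI impI)
  fix e :: real assume "e > 0"
  then have e: "e / 2 > 0" by simp
  obtain d1 where d1: "d1 > 0" "\<And>p. p division_of \<Union>p \<Longrightarrow> \<Union>p \<subseteq> S \<Longrightarrow>
        (\<Sum>K\<in>p. measure lborel K) < d1 \<Longrightarrow> (\<Sum>K\<in>p. norm (f (Sup K) - f (Inf K))) < e / 2"
    using assms(1) e unfolding absolutely_continuous_on_def by meson
  obtain d2 where d2: "d2 > 0" "\<And>p. p division_of \<Union>p \<Longrightarrow> \<Union>p \<subseteq> S \<Longrightarrow>
        (\<Sum>K\<in>p. measure lborel K) < d2 \<Longrightarrow> (\<Sum>K\<in>p. norm (g (Sup K) - g (Inf K))) < e / 2"
    using assms(2) e unfolding absolutely_continuous_on_def by meson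
  show "\<exists>\<delta>>0. \<forall>p. p division_of \<Union>p \<longrightarrow> \<Union>p \<subseteq> S \<longrightarrow> (\<Sum>K\<in>p. measure lborel K) < \<delta> \<longrightarrow>
     (\<Sum>K\<in>p. norm (f (Sup K) - g (Sup K) - (f (Inf K) - g (Inf K)))) < e"
  proof (intro exI[of _ "min d1 d2"] conjI allI impI)
    fix p assume p: "p division_of \<Union>p" "\<Union>p \<subseteq> S" "(\<Sum>K\<in>p. measure lborel K) < min d1 d2"
    have "(\<Sum>K\<in>p. norm (f (Sup K) - g (Sup K) - (f (Inf K) - g (Inf K))))
      \<le> (\<Sum>K\<in>p. norm (f (Sup K) - f (Inf K)) + norm (g (Sup K) - g (Inf K)))"
    proof (rule sum_mono)
      fix K
      show "norm (f (Sup K) - g (Sup K) - (f (Inf K) - g (Inf K))) \<le> norm (f (Sup K) - f (Inf K)) + norm (g (Sup K) - g (Inf K))"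
        using norm_triangle_ineq4[of "f (Sup K) - f (Inf K)" "g (Sup K) - g (Inf K)"] by (simp add: algebra_simps)
    qed
    also have "\<dots> = (\<Sum>K\<in>p. norm (f (Sup K) - f (Inf K))) + (\<Sum>K\<in>p. norm (g (Sup K) - g (Inf K)))"
      by (rule sum.distrib)
    also have "\<dots> < e / 2 + e / 2" using d1(2)[OF p(1,2)] d2(2)[OF p(1,2)] p(3) by (intro add_strict_mono) auto
    finally show "(\<Sum>K\<in>p. norm (f (Sup K) - g (Sup K) - (f (Inf K) - g (Inf K)))) < e" by simp
  qed (use d1 d2 in auto)
qed

lemma absolutely_continuous_on_C1:
  fixes f :: "real \<Rightarrow> 'a::real_normed_vector"
  assumes d: "\<And>x. x \<in> {a..b} \<Longrightarrow> (f has_vector_derivative f' x) (at x within {a..b})"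
    and c: "continuous_on {a..b} f'"
  shows "absolutely_continuous_on {a..b} f"
proof -
  have "bounded (f' ` {a..b})" by (rule compact_imp_bounded[OF compact_continuous_image[OF c compact_Icc]])
  then obtain B where B: "B > 0" "\<And>x. x \<in> {a..b} \<Longrightarrow> norm (f' x) \<le> B"
    unfolding bounded_pos by auto
  show ?thesis
  proof (rule absolutely_continuous_on_lipschitz[OF _ B(1)])
    fix x y assume xy: "x \<in> {a..b}" "y \<in> {a..b}"
    have "norm (f x - f y) \<le> B * norm (x - y)"
    proof (rule differentiable_bound[OF convex_real_interval(5)])
      fix z assume z: "z \<in> {a..b}"
      show "(f has_derivative (\<lambda>t. t *\<^sub>R f' z)) (at z within {a..b})"
        using d[OF z] unfolding has_vector_derivative_def .
      show "onorm (\<lambda>t. t *\<^sub>R f' z) \<le> B"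
      proof (rule onorm_le)
        fix t :: real show "norm (t *\<^sub>R f' z) \<le> B * norm t"
          using mult_left_mono[OF B(2)[OF z], of "\<bar>t\<bar>"] by (simp add: mult.commute)
      qed
    qed (use xy in auto)
    then show "norm (f x - f y) \<le> B * \<bar>x - y\<bar>" by simp
  qed
qed

text \<open>
  Let \<open>g\<close> be the derivative of \<open>f\<close> and \<open>F\<close> the indefinite integral of \<open>(V - E) f\<close>; the claim is that
  \<open>h = g - F\<close> is constant. Wherever \<open>g\<close> is differentiable the equation gives \<open>h' = 0\<close>
  almost everywhere, so it has to be shown that \<open>g\<close> is differentiable almost everywhere. At an exceptional point
  \<^const>\<open>vector_derivative\<close> takes an unspecified but fixed value \<open>d\<close>, and the equation then says \<open>(V - E) f = d\<close>.
  So the exceptional points lie in a level set, on which \<open>f\<close> coincides with the smooth function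
  \<open>\<rho> = d / (V - E)\<close>. At limit points of the level set therefore \<open>g = \<rho>'\<close>, and \<open>h\<close> is constant
  across the gaps between them. Consequently \<open>h\<close> agrees up to lower order with the differentiable function \<open>\<rho>' - F\<close> near
  every density point of the set of limit points. Almost all exceptional points would be such density points, where \<open>g\<close> would be
  differentiable after all.
\<close>

lemma eigenfunction_classical:
  fixes V :: "real \<Rightarrow> real" and E :: real and f :: "real \<Rightarrow> complex"
  assumes V': "\<And>x. (V has_real_derivative V' x) (at x)" and V'': "\<And>x. (V' has_real_derivative V'' x) (at x)"
    and Z: "finite {x. V x = E}"
    and C1: "C1_half_line u0 f" and lac: "locally_absolutely_continuous_on {u0..} (half_line_deriv u0 f)"
    and ae: "AE x in lebesgue. x \<in> {u0<..} \<longrightarrow> schroedinger V u0 f x = of_real E * f x"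
  shows "\<And>x. x \<ge> u0 \<Longrightarrow> (f has_vector_derivative half_line_deriv u0 f x) (at x within {u0..})"
    and "\<And>x. x \<ge> u0 \<Longrightarrow> (half_line_deriv u0 f has_vector_derivative of_real (V x - E) * f x) (at x within {u0..})"
proof -
  define g where "g = half_line_deriv u0 f"
  have fd: "(f has_vector_derivative g x) (at x within {u0..})" if "x \<ge> u0" for x
  proof -
    have "f differentiable (at x within {u0..})" using C1 that unfolding C1_half_line_def differentiable_on_def by auto
    then show ?thesis unfolding g_def half_line_deriv_def by (simp add: vector_derivative_works)
  qed
  then show "\<And>x. x \<ge> u0 \<Longrightarrow> (f has_vector_derivative half_line_deriv u0 f x) (at x within {u0..})"
    unfolding g_def .
  have fat: "(f has_vector_derivative g x) (at x)" if "x > u0" for x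
    using fd[of x] that at_within_interior[of x "{u0..}"] by (simp add: interior_real_atLeast)
  have fc: "continuous_on {u0..} f" 
    unfolding continuous_on_eq_continuous_within by (intro ballI has_vector_derivative_continuous[OF fd]) simp
  have Vc: "continuous_on A V" for A by (rule DERIV_continuous_on[OF has_field_derivative_at_within[OF V']])
  define G where "G = (\<lambda>x. complex_of_real (V x - E) * f x)"
  have Gc: "continuous_on {u0..} G" unfolding G_def by (intro continuous_intros fc Vc)
  define F where "F = (\<lambda>x. integral {u0..x} G)"
  have Fw: "(F has_vector_derivative G x) (at x within {u0..b})" if "x \<in> {u0..b}" for x b
    unfolding F_def by (rule integral_has_vector_derivative[OF continuous_on_subset[OF Gc] that]) auto
  have Fat: "(F has_vector_derivative G x) (at x)" if "x > u0" for x
    using Fw[of x "x+1"] that at_within_interior[of x "{u0..x+1}"] by simp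
  define h where "h = (\<lambda>x. g x - F x)"
  have hac: "absolutely_continuous_on {p..q} h" if "u0 \<le> p" for p q unfolding h_def
  proof (rule absolutely_continuous_on_diff)
    show "absolutely_continuous_on {p..q} g" 
      using lac that unfolding locally_absolutely_continuous_on_def g_def by auto
    show "absolutely_continuous_on {p..q} F"
    proof (rule absolutely_continuous_on_C1)
      fix x assume "x \<in> {p..q}"
      then show "(F has_vector_derivative G x) (at x within {p..q})"
        by (intro has_vector_derivative_within_subset[OF Fw[of x q]]) (use that in auto)
    qed (rule continuous_on_subset[OF Gc], use that in auto)
  qed
  obtain N0 where N0: "negligible N0" "\<And>x. x > u0 \<Longrightarrow> x \<notin> N0 \<Longrightarrow> schroedinger V u0 f x = of_real E * f x"
    using ae unfolding eventually_ae_filter negligible_iff_null_sets by auto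
  \<comment> \<open>The value of \<^const>\<open>vector_derivative\<close> wherever no derivative exists.\<close>
  define d :: complex where "d = (SOME y. False)"
  define Dg where "Dg = (\<lambda>x. \<exists>D. (g has_vector_derivative D) (at x))"
  have dich: "(g has_vector_derivative G x) (at x)" if "x > u0" "x \<notin> N0" "Dg x \<or> G x \<noteq> d" for x
  proof -
    have eq: "vector_derivative g (at x) = G x" 
      using N0(2)[OF that(1,2)] unfolding schroedinger_def g_def[symmetric] G_def by (simp add: algebra_simps)
    have "Dg x"
    proof (rule ccontr)
      assume "\<not> Dg x"
      then have "vector_derivative g (at x) = d" unfolding vector_derivative_def d_def Dg_def by simp
      then show False using that(3) eq \<open>\<not> Dg x\<close> by simp
    qed
    then obtain D where D: "(g has_vector_derivative D) (at x)" unfolding Dg_def by blast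
    then show ?thesis using vector_derivative_at[OF D] eq by simp
  qed
  define C0 where "C0 = {x. x > u0 \<and> G x = d \<and> V x \<noteq> E}"
  define L where "L = {x. x islimpt C0}"
  have L: "closed L" unfolding L_def by (rule closed_limpts)
  define N where "N = N0 \<union> {x. V x = E} \<union> {x\<in>C0. \<not> x islimpt C0}"
  have N: "negligible N" unfolding N_def 
  proof (intro negligible_Un N0(1))
    show "negligible {x\<in>C0. \<not> x islimpt C0}" unfolding negligible_iff_null_sets
      by (intro null_sets_completionI countable_imp_null_set_lborel countable_isolated_points)
    show "negligible {x. V x = E}" by (rule negligible_finite[OF Z])
  qed
  \<comment> \<open>Off the exceptional set the derivative of \<open>h\<close> vanishes, by the equation.\<close>
  have offL: "(h has_vector_derivative 0) (at x)" if "x > u0" "x \<notin> N" "Dg x \<or> x \<notin> L" for x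
  proof -
    have "Dg x \<or> G x \<noteq> d" using that unfolding N_def C0_def L_def by auto
    then have "(g has_vector_derivative G x) (at x)" using dich that(1,2) unfolding N_def by blast
    from has_vector_derivative_diff[OF this Fat[OF that(1)]] show ?thesis unfolding h_def by simp
  qed
  have gap: "h q = h p" if "u0 \<le> p" "p \<le> q" "{p<..<q} \<inter> L = {}" for p q
  proof (rule absolutely_continuous_zero_deriv_const[OF hac[OF that(1)] that(2)])
    show "negligible (N \<union> {p,q})" using N by simp
    fix x assume "x \<in> {p..q} - (N \<union> {p, q})"
    then have "x > u0" "x \<notin> N" "x \<in> {p<..<q}" using that(1) by auto
    moreover have "x \<notin> L" using calculation(3) that(3) by blast
    ultimately show "(h has_vector_derivative 0) (at x within {p..q})"
      by (intro has_vector_derivative_at_within[OF offL]) auto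
  qed
  define \<rho> where "\<rho> = (\<lambda>x. d / complex_of_real (V x - E))"
  define \<rho>' where "\<rho>' = (\<lambda>x. - d * complex_of_real (V' x) / complex_of_real (V x - E)^2)"
  have V'v: "((\<lambda>x. complex_of_real (V x)) has_vector_derivative complex_of_real (V' x)) (at x)" for x
    by (rule has_vector_derivative_of_real[OF V'])
  have V''v: "((\<lambda>x. complex_of_real (V' x)) has_vector_derivative complex_of_real (V'' x)) (at x)" for x
    by (rule has_vector_derivative_of_real[OF V''])
  have \<rho>d: "(\<rho> has_vector_derivative \<rho>' x) (at x)" if "V x \<noteq> E" for x
  proof -
    have "((\<lambda>y. inverse (V y - E)) has_real_derivative - (V' x / (V x - E)^2)) (at x)"
      using that by (auto intro!: derivative_eq_intros V' simp: power2_eq_square divide_inverse)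
    then have "((\<lambda>y. complex_of_real (inverse (V y - E))) has_vector_derivative complex_of_real (- (V' x / (V x - E)^2))) (at x)"
      by (rule has_vector_derivative_of_real)
    from has_vector_derivative_mult_right[OF this, of d]
    show ?thesis unfolding \<rho>_def \<rho>'_def by (simp add: divide_inverse mult_ac)
  qed
  have \<rho>'d: "\<exists>D. (\<rho>' has_vector_derivative D) (at x)" if "V x \<noteq> E" for x
  proof -
    have "\<exists>D. ((\<lambda>y. V' y / (V y - E)^2) has_real_derivative D) (at x)"
      using that by (intro exI) (auto intro!: derivative_eq_intros V' V'')
    then obtain D where "((\<lambda>y. V' y / (V y - E)^2) has_real_derivative D) (at x)" by blast
    then have "((\<lambda>y. complex_of_real (V' y / (V y - E)^2)) has_vector_derivative complex_of_real D) (at x)"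
      by (rule has_vector_derivative_of_real)
    from has_vector_derivative_mult_right[OF this, of "-d"]
    show ?thesis unfolding \<rho>'_def by (intro exI) (simp add: divide_inverse mult_ac)
  qed
  have gL: "g x = \<rho>' x" if x: "x \<in> L" "x > u0" "V x \<noteq> E" for x
  proof -
    have lim: "at x within C0 \<noteq> bot" using x(1) unfolding L_def by (simp add: trivial_limit_within)
    have C0eq: "f y = \<rho> y" if "y \<in> C0" for y
    proof -
      have "complex_of_real (V y - E) \<noteq> 0" "complex_of_real (V y - E) * f y = d"
        using that unfolding C0_def G_def by (simp_all del: of_real_diff)
      then show ?thesis unfolding \<rho>_def by (simp add: nonzero_eq_divide_eq mult.commute)
    qed
    have "(f \<longlongrightarrow> f x) (at x within C0)" "(\<rho> \<longlongrightarrow> \<rho> x) (at x within C0)"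
      using has_vector_derivative_continuous[OF has_vector_derivative_at_within[OF fat[OF x(2)]]]
        has_vector_derivative_continuous[OF has_vector_derivative_at_within[OF \<rho>d[OF x(3)]]]
      by (auto simp: continuous_within)
    moreover have "(\<rho> \<longlongrightarrow> f x) (at x within C0)"
      by (rule Lim_transform_eventually[OF calculation(1)])
         (simp add: eventually_at_filter C0eq)
    ultimately have fx: "f x = \<rho> x" using tendsto_unique[OF lim] by blast
    have "(\<rho> has_vector_derivative g x) (at x within insert x C0)"
      by (rule has_vector_derivative_transform[OF _ _ has_vector_derivative_at_within[OF fat[OF x(2)]]])
        (use fx C0eq in auto)
    then have "(\<rho> has_vector_derivative g x) (at x within C0)"
      by (rule has_vector_derivative_within_subset) auto
    then show ?thesis
      by (rule vector_derivative_unique_within[OF lim _ has_vector_derivative_at_within[OF \<rho>d[OF x(3)]]])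
  qed
  obtain Nd where Nd: "negligible Nd" 
    "\<And>x e. x \<in> L - Nd \<Longrightarrow> e > 0 \<Longrightarrow> \<exists>d>0. \<forall>y. \<bar>y - x\<bar> < d \<longrightarrow>
       (\<exists>p\<in>L. \<bar>p - x\<bar> \<le> \<bar>y - x\<bar> \<and> \<bar>y - p\<bar> \<le> e * \<bar>y - x\<bar> \<and> {min p y<..<max p y} \<inter> L = {})"
    using density_points[OF L] by blast
  \<comment> \<open>Near a density point \<open>h\<close> is \<open>s\<close> composed with the passage to a nearby point of \<open>L\<close>.\<close>
  have onL: "Dg x" if x: "x \<in> L - Nd" "x > u0" "V x \<noteq> E" for x
  proof -
    define s where "s = (\<lambda>x. \<rho>' x - F x)"
    obtain D0 where "(\<rho>' has_vector_derivative D0) (at x)" using \<rho>'d[OF x(3)] by blast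
    from has_vector_derivative_diff[OF this Fat[OF x(2)]]
    obtain D where D: "(s has_vector_derivative D) (at x)" unfolding s_def by blast
    have hs: "h y = s y" if "y \<in> L" "y > u0" "V y \<noteq> E" for y using gL[OF that] unfolding h_def s_def by simp
    have "\<forall>\<^sub>F y in at x. V y \<noteq> E"
      using Vc[of UNIV] x(3) by (intro tendsto_imp_eventually_ne[of _ "V x"]) 
        (auto simp: continuous_on_eq_continuous_at isCont_def)
    then obtain r1 where r1: "r1 > 0" and r1': "\<And>y. y \<noteq> x \<Longrightarrow> dist y x < r1 \<Longrightarrow> V y \<noteq> E"
      unfolding eventually_at by blast
    have r1V: "V y \<noteq> E" if "\<bar>y - x\<bar> < r1" for y
      using r1'[of y] x(3) that by (cases "y = x") (simp_all add: dist_real_def)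
    have "(h has_derivative (\<lambda>t. t *\<^sub>R D)) (at x)"
      unfolding has_derivative_at_alt
    proof (intro conjI allI impI)
      show "bounded_linear (\<lambda>t. t *\<^sub>R D)" by (rule bounded_linear_scaleR_left)
      fix e :: real assume e: "e > 0"
      define e1 where "e1 = e / 2"
      define e2 where "e2 = e / (2 * (norm D + 1))"
      have nD: "norm D + 1 > 0" using norm_ge_zero[of D] by linarith
      have e12: "e1 > 0" "e2 > 0" using e nD unfolding e1_def e2_def by simp_all
      have e2D: "e2 * norm D \<le> e / 2"
      proof -
        have "e2 * norm D \<le> e2 * (norm D + 1)" using e12 by (intro mult_left_mono) auto
        also have "\<dots> = e / 2" unfolding e2_def using nD by (simp add: field_simps)
        finally show ?thesis .
      qed
      obtain r2 where r2: "r2 > 0" "\<And>y. norm (y - x) < r2 \<Longrightarrow> norm (s y - s x - (y - x) *\<^sub>R D) \<le> e1 * norm (y - x)"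
        using D e12 unfolding has_vector_derivative_def has_derivative_at_alt by blast
      obtain r3 where r3: "r3 > 0" "\<And>y. \<bar>y - x\<bar> < r3 \<Longrightarrow>
         (\<exists>p\<in>L. \<bar>p - x\<bar> \<le> \<bar>y - x\<bar> \<and> \<bar>y - p\<bar> \<le> e2 * \<bar>y - x\<bar> \<and> {min p y<..<max p y} \<inter> L = {})"
        using Nd(2)[OF x(1) e12(2)] by blast
      show "\<exists>d>0. \<forall>y. norm (y - x) < d \<longrightarrow> norm (h y - h x - (y - x) *\<^sub>R D) \<le> e * norm (y - x)"
      proof (intro exI[of _ "min (min r1 r2) (min r3 (x - u0))"] conjI allI impI)
        show "min (min r1 r2) (min r3 (x - u0)) > 0" using r1 r2 r3 x by auto
        fix y assume y: "norm (y - x) < min (min r1 r2) (min r3 (x - u0))"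
        then obtain p where p: "p \<in> L" "\<bar>p - x\<bar> \<le> \<bar>y - x\<bar>" "\<bar>y - p\<bar> \<le> e2 * \<bar>y - x\<bar>" "{min p y<..<max p y} \<inter> L = {}"
          using r3(2)[of y] by auto
        have gt: "p > u0" "y > u0" using p(2) y unfolding real_norm_def by linarith+
        have "h (max p y) = h (min p y)" by (rule gap[OF _ _ p(4)]) (use gt in auto)
        then have hyp: "h y = h p" by (cases "p \<le> y") auto
        have "V p \<noteq> E" by (rule r1V) (use p(2) y in auto)
        then have hp: "h p = s p" by (rule hs[OF p(1) gt(1)])
        have hx: "h x = s x" by (rule hs) (use x in auto)
        have "norm (s p - s x - (p - x) *\<^sub>R D) \<le> e1 * \<bar>p - x\<bar>" using r2(2)[of p] p(2) y by auto
        also have "\<dots> \<le> e1 * \<bar>y - x\<bar>" using p(2) e12 by (intro mult_left_mono) auto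
        finally have 1: "norm (s p - s x - (p - x) *\<^sub>R D) \<le> e1 * \<bar>y - x\<bar>" .
        have "norm ((y - p) *\<^sub>R D) \<le> (e2 * \<bar>y - x\<bar>) * norm D" unfolding norm_scaleR 
          using p(3) by (intro mult_right_mono) auto
        also have "\<dots> = (e2 * norm D) * \<bar>y - x\<bar>" by simp
        also have "\<dots> \<le> e / 2 * \<bar>y - x\<bar>" by (rule mult_right_mono[OF e2D]) simp
        finally have 2: "norm ((y - p) *\<^sub>R D) \<le> e / 2 * \<bar>y - x\<bar>" .
        have "h y - h x - (y - x) *\<^sub>R D = (s p - s x - (p - x) *\<^sub>R D) - (y - p) *\<^sub>R D"
          unfolding hyp hp hx by (simp add: algebra_simps)
        also have "norm \<dots> \<le> e1 * \<bar>y - x\<bar> + e / 2 * \<bar>y - x\<bar>"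
          by (rule order_trans[OF norm_triangle_ineq4 add_mono[OF 1 2]])
        also have "\<dots> = e * norm (y - x)" unfolding e1_def by (simp add: field_simps)
        finally show "norm (h y - h x - (y - x) *\<^sub>R D) \<le> e * norm (y - x)" .
      qed
    qed
    then have "(h has_vector_derivative D) (at x)" unfolding has_vector_derivative_def .
    from has_vector_derivative_add[OF this Fat[OF x(2)]]
    show ?thesis unfolding h_def Dg_def by auto
  qed
  have const: "h b = h u0" if "u0 \<le> b" for b
  proof (rule absolutely_continuous_zero_deriv_const[OF hac[OF order_refl] that])
    show "negligible (N \<union> Nd \<union> {u0})" using N Nd(1) by simp
    fix x assume "x \<in> {u0..b} - (N \<union> Nd \<union> {u0})"
    then have x: "x > u0" "x \<notin> N" "x \<notin> Nd" "V x \<noteq> E" by (auto simp: N_def)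
    then have "Dg x \<or> x \<notin> L" using onL by blast
    then show "(h has_vector_derivative 0) (at x within {u0..b})"
      by (intro has_vector_derivative_at_within[OF offL] x)
  qed
  have g_eq: "g x = g u0 + F x" if "x \<ge> u0" for x
    using const[OF that] unfolding h_def F_def by (simp add: algebra_simps)
  fix x assume x: "x \<ge> u0"
  have "(F has_vector_derivative G x) (at x within {u0..})"
  proof (cases "x = u0")
    case False
    then have "x > u0" using x by simp
    then show ?thesis by (rule has_vector_derivative_at_within[OF Fat])
  next
    case True
    have "at x within {u0..x+1} = at x within {u0..}"
      by (rule at_within_nhd[of _ "{..<x+1}"]) (use True in auto)
    then show ?thesis using Fw[of x "x+1"] True by simp
  qed
  then have gF: "((\<lambda>x. g u0 + F x) has_vector_derivative 0 + G x) (at x within {u0..})"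
    by (rule has_vector_derivative_add[OF has_vector_derivative_const])
  have "(g has_vector_derivative 0 + G x) (at x within {u0..})"
    by (rule has_vector_derivative_transform[OF _ g_eq gF]) (simp_all add: x)
  then have "(g has_vector_derivative G x) (at x within {u0..})" by simp
  then show "(half_line_deriv u0 f has_vector_derivative of_real (V x - E) * f x) (at x within {u0..})"
    unfolding g_def G_def .
qed

section \<open>Eigenvalues and the boundary condition\<close>

text \<open>
  At the end point \<open>u0\<close> only continuity is asked for. This suffices for the mean value theorem on \<open>[u0, x]\<close> and
  avoids one-sided derivatives.
\<close>

definition schroedinger_solution :: "(real \<Rightarrow> real) \<Rightarrow> real \<Rightarrow> real \<Rightarrow> (real \<Rightarrow> real) \<Rightarrow> (real \<Rightarrow> real) \<Rightarrow> bool" where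
  "schroedinger_solution V E u0 y z \<longleftrightarrow> continuous_on {u0..} y \<and> continuous_on {u0..} z \<and>
     (\<forall>x>u0. (y has_real_derivative z x) (at x) \<and> (z has_real_derivative (V x - E) * y x) (at x))"

text \<open>
  The energy \<open>y\<^sup>2 + z\<^sup>2\<close> grows and decays at most exponentially on compact intervals, in both directions.
\<close>

lemma solution_unique:
  assumes s: "schroedinger_solution V E u0 y z" and V: "continuous_on {u0..} V"
    and b: "b \<ge> u0" "y b = 0" "z b = 0" and x: "x \<ge> u0"
  shows "y x = 0 \<and> z x = 0"
proof -
  have cy: "continuous_on {u0..} y" and cz: "continuous_on {u0..} z"
    and dy: "\<And>x. x > u0 \<Longrightarrow> (y has_real_derivative z x) (at x)"
    and dz: "\<And>x. x > u0 \<Longrightarrow> (z has_real_derivative (V x - E) * y x) (at x)"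
    using s unfolding schroedinger_solution_def by auto
  define B where "B = max b x"
  have "compact ((\<lambda>t. V t - E) ` {u0..B})"
    by (intro compact_continuous_image continuous_intros continuous_on_subset[OF V]) auto
  from compact_imp_bounded[OF this] obtain M where M: "\<And>t. t \<in> {u0..B} \<Longrightarrow> \<bar>V t - E\<bar> \<le> M"
    unfolding bounded_iff by (auto simp only: ball_simps real_norm_def)
  define e where "e = (\<lambda>t. y t ^ 2 + z t ^ 2)"
  define K where "K = 1 + M"
  have ce: "continuous_on {u0..} e" unfolding e_def by (intro continuous_intros cy cz)
  have de: "(e has_real_derivative 2 * (y t * z t) * (1 + (V t - E))) (at t)" if "t > u0" for t
    unfolding e_def using that by (auto intro!: derivative_eq_intros dy dz simp: algebra_simps)
  have bound: "\<bar>2 * (y t * z t) * (1 + (V t - E))\<bar> \<le> K * e t" if "t \<in> {u0..B}" for t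
  proof -
    have "\<bar>2 * (y t * z t)\<bar> \<le> e t" unfolding e_def
      using sum_squares_bound[of "\<bar>y t\<bar>" "\<bar>z t\<bar>"] by (simp add: abs_mult)
    moreover have "\<bar>1 + (V t - E)\<bar> \<le> K" unfolding K_def using M[OF that] by linarith
    ultimately have "\<bar>2 * (y t * z t)\<bar> * \<bar>1 + (V t - E)\<bar> \<le> e t * K"
      by (intro mult_mono) (auto simp: e_def)
    then show ?thesis by (simp add: abs_mult mult.commute)
  qed
  have up: "exp (K * p) * e p \<le> exp (K * q) * e q" if "u0 \<le> p" "p \<le> q" "q \<le> B" for p q
  proof (rule DERIV_nonneg_imp_increasing_open[OF that(2)])
    fix t assume t: "p < t" "t < q"
    let ?D = "exp (K * t) * (K * e t + 2 * (y t * z t) * (1 + (V t - E)))"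
    have "((\<lambda>t. exp (K * t) * e t) has_real_derivative ?D) (at t)"
      by (rule DERIV_cong, rule DERIV_mult', rule DERIV_chain'[OF _ DERIV_exp], rule DERIV_cmult_Id, rule de)
        (use t that in \<open>auto simp: algebra_simps\<close>)
    moreover have "?D \<ge> 0" using bound[of t] t that by (intro mult_nonneg_nonneg) auto
    ultimately show "\<exists>D. ((\<lambda>t. exp (K * t) * e t) has_real_derivative D) (at t) \<and> D \<ge> 0" by blast
  next
    show "continuous_on {p..q} (\<lambda>t. exp (K * t) * e t)"
      by (intro continuous_intros continuous_on_subset[OF ce]) (use that in auto)
  qed
  have down: "- (exp (- K * p) * e p) \<le> - (exp (- K * q) * e q)" if "u0 \<le> p" "p \<le> q" "q \<le> B" for p q
  proof (rule DERIV_nonneg_imp_increasing_open[OF that(2)])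
    fix t assume t: "p < t" "t < q"
    let ?D = "exp (- K * t) * (K * e t - 2 * (y t * z t) * (1 + (V t - E)))"
    have "((\<lambda>t. - (exp (- K * t) * e t)) has_real_derivative ?D) (at t)"
      by (rule DERIV_cong, rule DERIV_minus, rule DERIV_mult', rule DERIV_chain'[OF _ DERIV_exp], rule DERIV_cmult_Id, rule de)
        (use t that in \<open>auto simp: algebra_simps\<close>)
    moreover have "?D \<ge> 0" using bound[of t] t that by (intro mult_nonneg_nonneg) auto
    ultimately show "\<exists>D. ((\<lambda>t. - (exp (- K * t) * e t)) has_real_derivative D) (at t) \<and> D \<ge> 0" by blast
  next
    show "continuous_on {p..q} (\<lambda>t. - (exp (- K * t) * e t))"
      by (intro continuous_intros continuous_on_subset[OF ce]) (use that in auto)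
  qed
  have eb: "e b = 0" using b by (simp add: e_def)
  have "e x \<le> 0"
  proof (cases "x \<le> b")
    case True
    then have "exp (K * x) * e x \<le> 0" using up[of x b] x eb by (simp add: B_def)
    then show ?thesis by (simp add: mult_le_0_iff)
  next
    case False
    then have "exp (- K * x) * e x \<le> 0" using down[of b x] b eb by (simp add: B_def)
    then show ?thesis by (simp add: mult_le_0_iff)
  qed
  moreover have "y x ^ 2 \<ge> 0" "z x ^ 2 \<ge> 0" by simp_all
  ultimately have "y x ^ 2 = 0" "z x ^ 2 = 0" unfolding e_def by linarith+
  then show ?thesis by simp
qed

lemma morse_deriv: "(morse_potential k has_real_derivative (1/2 * exp (2 * u) + k * exp u)) (at u)"
  unfolding morse_potential_def by (auto intro!: derivative_eq_intros)

lemma morse_deriv2: "((\<lambda>u. 1/2 * exp (2 * u) + k * exp u) has_real_derivative (exp (2 * u) + k * exp u)) (at u)"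
  by (auto intro!: derivative_eq_intros)

lemma morse_cont: "continuous_on A (morse_potential k)"
  unfolding morse_potential_def by (intro continuous_intros)

lemma morse_level_finite: "finite {u. morse_potential k u = E}"
proof -
  define p where "p = [:- E, k, 1/4::real:]"
  have "exp ` {u. morse_potential k u = E} \<subseteq> {x. poly p x = 0}"
  proof clarify
    fix u assume "E = morse_potential k u"
    moreover have "exp (2 * u) = exp u ^ 2" by (simp add: exp_double)
    ultimately show "poly p (exp u) = 0"
      by (simp add: p_def morse_potential_def power2_eq_square algebra_simps)
  qed
  moreover have "finite {x. poly p x = 0}" by (rule poly_roots_finite) (simp add: p_def)
  ultimately have "finite (exp ` {u. morse_potential k u = E})" by (rule finite_subset)
  then show ?thesis by (rule finite_imageD) (simp add: inj_on_def)
qed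

lemma psi_solution: "schroedinger_solution (morse_potential k) E u0 (psi k E) (psi' k E)"
  unfolding schroedinger_solution_def
  by (intro conjI allI impI psi_deriv psi'_deriv 
      DERIV_continuous_on[OF has_field_derivative_at_within[OF psi_deriv]]
      DERIV_continuous_on[OF has_field_derivative_at_within[OF psi'_deriv]])

lemma psi_pos_at_infinity: "\<exists>b. \<forall>u\<ge>b. psi k E u > 0"
  using psi_eventually_pos[of k "\<bar>E + (k + 1/2)^2\<bar>"] by blast

lemma psi_nonvanishing: "psi k E u \<noteq> 0 \<or> psi' k E u \<noteq> 0"
proof (rule ccontr)
  assume "\<not> ?thesis"
  then have z: "psi k E u = 0" "psi' k E u = 0" by auto
  obtain b where b: "\<And>x. x \<ge> b \<Longrightarrow> psi k E x > 0" using psi_pos_at_infinity by blast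
  have "psi k E (max b u) = 0"
    using solution_unique[OF psi_solution morse_cont order_refl z, of "max b u"] by simp
  then show False using b[of "max b u"] by simp
qed

text \<open>
  If the Wronskian is a constant \<open>c \<noteq> 0\<close>, then \<open>G = - y / c\<close> satisfies \<open>(G / \<psi>)' = 1 / \<psi>\<^sup>2\<close>, so \<open>G\<close> becomes
  positive and, where \<open>V \<ge> E\<close>, convex. Either \<open>G\<close> increases from some point on, or \<open>G' < 0\<close> and the
  Wronskian identity \<open>G' \<psi> - G \<psi>' = 1\<close> gives \<open>G \<ge> 1 / \<bar>\<psi>'\<bar> \<ge> 1\<close>. In both cases \<open>y\<close> stays away from \<open>0\<close>.
\<close>

lemma wronskian_zero:
  assumes s: "schroedinger_solution (morse_potential k) E u0 y z"
    and small: "\<And>\<delta> b. \<delta> > 0 \<Longrightarrow> \<exists>x\<ge>b. \<bar>y x\<bar> < \<delta>"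
    and x: "x \<ge> u0"
  shows "y x * psi' k E x - z x * psi k E x = 0"
proof -
  let ?p = "psi k E" and ?q = "psi' k E" and ?V = "morse_potential k"
  have cy: "continuous_on {u0..} y" and cz: "continuous_on {u0..} z"
    and dy: "\<And>x. x > u0 \<Longrightarrow> (y has_real_derivative z x) (at x)"
    and dz: "\<And>x. x > u0 \<Longrightarrow> (z has_real_derivative (?V x - E) * y x) (at x)"
    using s unfolding schroedinger_solution_def by auto
  have cp: "continuous_on A ?p" for A by (rule DERIV_continuous_on[OF has_field_derivative_at_within[OF psi_deriv]])
  have cq: "continuous_on A ?q" for A by (rule DERIV_continuous_on[OF has_field_derivative_at_within[OF psi'_deriv]])
  define W where "W = (\<lambda>x. y x * ?q x - z x * ?p x)"
  have Wc: "W x = W u0" if "x \<ge> u0" for x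
  proof (cases "x = u0")
    case False
    then have lt: "u0 < x" using that by simp
    show ?thesis
    proof (rule DERIV_isconst_end[OF lt])
      show "continuous_on {u0..x} W" unfolding W_def
        by (intro continuous_intros cp cq continuous_on_subset[OF cy] continuous_on_subset[OF cz]) auto
      fix t assume "u0 < t"
      then have "(W has_real_derivative (z t * ?q t + (?V t - E) * ?p t * y t) - ((?V t - E) * y t * ?p t + ?q t * z t)) (at t)"
        unfolding W_def by (intro DERIV_diff DERIV_mult dy dz psi_deriv psi'_deriv)
      then show "(W has_real_derivative 0) (at t)" by (rule DERIV_cong) (simp add: algebra_simps)
    qed
  qed simp
  define c where "c = W u0"
  have "c = 0"
  proof (rule ccontr)
    assume c: "c \<noteq> 0"
    define G where "G = (\<lambda>x. - y x / c)"
    define H where "H = (\<lambda>x. - z x / c)"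
    have dG: "(G has_real_derivative H x) (at x)" if "x > u0" for x
      unfolding G_def H_def by (intro DERIV_cdivide DERIV_minus dy that)
    have dH: "(H has_real_derivative (?V x - E) * G x) (at x)" if "x > u0" for x
      unfolding G_def H_def using DERIV_cdivide[OF DERIV_minus[OF dz[OF that]], of c] by simp
    have W1: "H x * ?p x - G x * ?q x = 1" if "x \<ge> u0" for x
    proof -
      have "c * (H x * ?p x - G x * ?q x) = c * 1" 
      proof -
        have "y x * ?q x - z x * ?p x = c" using Wc[OF that] unfolding c_def by (simp add: W_def)
        then show ?thesis unfolding G_def H_def using c by (simp add: field_simps)
      qed
      then show ?thesis using c by simp
    qed
    have "\<forall>\<^sub>F x in at_top. \<bar>?p x\<bar> < 1 \<and> \<bar>?q x\<bar> < 1 \<and> ?V x \<ge> E \<and> ?p x > 0"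
    proof (intro eventually_conj)
      show "\<forall>\<^sub>F x in at_top. \<bar>?p x\<bar> < 1"
        using tendsto_rabs_zero[OF exp_decaying_tendsto[OF psi_exp_decaying]] by (rule order_tendstoD) simp
      show "\<forall>\<^sub>F x in at_top. \<bar>?q x\<bar> < 1"
        using tendsto_rabs_zero[OF exp_decaying_tendsto[OF psi'_exp_decaying]] by (rule order_tendstoD) simp
      show "\<forall>\<^sub>F x in at_top. ?V x \<ge> E" unfolding morse_potential_def by real_asymp
      show "\<forall>\<^sub>F x in at_top. ?p x > 0" using psi_pos_at_infinity eventually_at_top_linorder by metis
    qed
    then obtain b0 where b0: "\<And>x. x \<ge> b0 \<Longrightarrow> \<bar>?p x\<bar> < 1 \<and> \<bar>?q x\<bar> < 1 \<and> ?V x \<ge> E \<and> ?p x > 0"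
      unfolding eventually_at_top_linorder by blast
    define b where "b = max b0 (u0 + 1)"
    have b: "\<And>x. x \<ge> b \<Longrightarrow> \<bar>?p x\<bar> < 1 \<and> \<bar>?q x\<bar> < 1 \<and> ?V x \<ge> E \<and> ?p x > 0" "b > u0"
      unfolding b_def using b0 by auto
    \<comment> \<open>Beyond \<open>b\<close> the derivative of \<open>G / \<psi>\<close> is \<open>1 / \<psi>\<^sup>2 \<ge> 1\<close>.\<close>
    have grow: "G x / ?p x \<ge> G b / ?p b + (x - b)" if "x \<ge> b" for x
    proof -
      have "G b / ?p b - b \<le> G x / ?p x - x"
      proof (rule DERIV_nonneg_imp_nondecreasing[OF that])
        fix t assume t: "b \<le> t" "t \<le> x"
        have tb: "t > u0" "?p t > 0" "\<bar>?p t\<bar> < 1" using b(1)[OF t(1)] b(2) t(1) by auto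
        have "((\<lambda>t. G t / ?p t - t) has_real_derivative (H t * ?p t - G t * ?q t) / (?p t * ?p t) - 1) (at t)"
          using tb by (intro DERIV_diff DERIV_divide dG psi_deriv DERIV_ident) auto
        moreover have "(H t * ?p t - G t * ?q t) / (?p t * ?p t) - 1 \<ge> 0"
        proof -
          have "?p t * ?p t \<le> 1 * 1" using tb by (intro mult_mono) auto
          then show ?thesis using W1[of t] tb by (simp add: le_divide_eq)
        qed
        ultimately show "\<exists>D. ((\<lambda>t. G t / ?p t - t) has_real_derivative D) (at t) \<and> 0 \<le> D" by blast
      qed
      then show ?thesis by simp
    qed
    define b1 where "b1 = max b (b - G b / ?p b + 1)"
    have Gpos: "G x > 0" if "x \<ge> b1" for x
    proof -
      have "x \<ge> b" "G x / ?p x > 0" using that grow[of x] unfolding b1_def by auto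
      then show ?thesis using b(1)[of x] by (simp add: zero_less_divide_iff)
    qed
    have Hmono: "H p \<le> H q" if "b1 \<le> p" "p \<le> q" for p q
    proof (rule DERIV_nonneg_imp_nondecreasing[OF that(2)])
      fix t assume t: "p \<le> t" "t \<le> q"
      have "t \<ge> b1" "t \<ge> b" "t > u0" using t that b(2) by (auto simp: b1_def)
      then have "(?V t - E) * G t \<ge> 0" using Gpos[of t] b(1)[of t] by (intro mult_nonneg_nonneg) auto
      then show "\<exists>D. (H has_real_derivative D) (at t) \<and> 0 \<le> D" using dH[OF \<open>t > u0\<close>] by blast
    qed
    have "\<exists>\<delta>>0. \<exists>b2. \<forall>x\<ge>b2. G x \<ge> \<delta>"
    proof (cases "\<exists>x1\<ge>b1. H x1 \<ge> 0")
      case True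
      then obtain x1 where x1: "x1 \<ge> b1" "H x1 \<ge> 0" by blast
      have "G x \<ge> G x1" if "x \<ge> x1" for x
      proof (rule DERIV_nonneg_imp_nondecreasing[OF that])
        fix t assume t: "x1 \<le> t" "t \<le> x"
        have "t > u0" using t x1 b(2) by (auto simp: b1_def)
        moreover have "H t \<ge> 0" using Hmono[of x1 t] x1 t by simp
        ultimately show "\<exists>D. (G has_real_derivative D) (at t) \<and> 0 \<le> D" using dG by blast
      qed
      then show ?thesis using Gpos[OF x1(1)] by blast
    next
      case False
      have "G x \<ge> 1" if "x \<ge> b1" for x
      proof -
        have bx: "x \<ge> b" "x \<ge> u0" using that b(2) by (auto simp: b1_def)
        have "H x < 0" using False that by auto
        then have "H x * ?p x \<le> 0" using b(1)[OF bx(1)] by (simp add: mult_le_0_iff)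
        then have "1 \<le> - (G x * ?q x)" using W1[OF bx(2)] by simp
        also have "\<dots> \<le> \<bar>G x * ?q x\<bar>" by linarith
        also have "\<dots> = G x * \<bar>?q x\<bar>" using Gpos[OF that] by (simp add: abs_mult)
        also have "\<dots> \<le> G x * 1" using b(1)[OF bx(1)] Gpos[OF that] by (intro mult_left_mono) auto
        finally show ?thesis by simp
      qed
      then show ?thesis by (intro exI[of _ 1]) auto
    qed
    then obtain \<delta> b2 where d: "\<delta> > 0" "\<And>x. x \<ge> b2 \<Longrightarrow> G x \<ge> \<delta>" by blast
    have "\<delta> * \<bar>c\<bar> > 0" using d c by simp
    then obtain x where x: "x \<ge> b2" "\<bar>y x\<bar> < \<delta> * \<bar>c\<bar>" using small by blast
    have "\<bar>y x\<bar> = \<bar>G x\<bar> * \<bar>c\<bar>" using c by (simp add: G_def)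
    then have "\<bar>G x\<bar> < \<delta>" using x c by simp
    then show False using d(2)[OF x(1)] by simp
  qed
  then show ?thesis using Wc[OF x] unfolding c_def W_def by simp
qed

text \<open>
  At a point where \<open>\<psi> > 0\<close> a multiple of \<open>\<psi>\<close> takes the value of \<open>y\<close>; as the Wronskian vanishes, it also has the
  same derivative there.
\<close>

lemma solution_multiple_of_psi:
  assumes s: "schroedinger_solution (morse_potential k) E u0 y z"
    and small: "\<And>\<delta> b. \<delta> > 0 \<Longrightarrow> \<exists>x\<ge>b. \<bar>y x\<bar> < \<delta>"
  obtains a where "\<And>x. x \<ge> u0 \<Longrightarrow> y x = a * psi k E x" "\<And>x. x \<ge> u0 \<Longrightarrow> z x = a * psi' k E x"
proof -
  let ?p = "psi k E" and ?q = "psi' k E" and ?V = "morse_potential k"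
  obtain b where b: "\<And>u. u \<ge> b \<Longrightarrow> ?p u > 0" using psi_pos_at_infinity by blast
  define m where "m = max b u0"
  have m: "?p m > 0" "m \<ge> u0" using b by (auto simp: m_def)
  define a where "a = y m / ?p m"
  have sol: "schroedinger_solution ?V E u0 (\<lambda>x. y x - a * ?p x) (\<lambda>x. z x - a * ?q x)"
    using s psi_solution[of k E u0] unfolding schroedinger_solution_def
    by (auto intro!: continuous_intros derivative_eq_intros simp: algebra_simps)
  have "y m - a * ?p m = 0" using m by (simp add: a_def)
  moreover have "z m - a * ?q m = 0" using wronskian_zero[OF s small m(2)] m by (simp add: a_def field_simps)
  ultimately have "y x - a * ?p x = 0 \<and> z x - a * ?q x = 0" if "x \<ge> u0" for x
    using solution_unique[OF sol morse_cont m(2)] that by blast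
  then show ?thesis by (intro that[of a]) auto
qed

lemma square_integrable_small:
  assumes f: "square_integrable_on f {u0<..}" and d: "\<delta> > 0"
  shows "\<exists>x\<ge>b. cmod (f x) < \<delta>"
proof (rule ccontr)
  assume "\<not> ?thesis"
  then have ge: "\<And>x. x \<ge> b \<Longrightarrow> cmod (f x) \<ge> \<delta>" by force
  define m where "m = max b (u0 + 1)"
  have "set_integrable lebesgue {u0<..} (\<lambda>x. (cmod (f x))\<^sup>2)" using f unfolding square_integrable_on_def by blast
  then have si: "set_integrable lebesgue S (\<lambda>x. (cmod (f x))\<^sup>2)" if "S \<subseteq> {u0<..}" "S \<in> sets lebesgue" for S
    using set_integrable_subset that by blast
  have i1: "(\<lambda>x. (cmod (f x))\<^sup>2) integrable_on {m..}"
    by (rule set_lebesgue_integral_eq_integral(1)[OF si]) (auto simp: m_def)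
  define I where "I = integral {m..} (\<lambda>x. (cmod (f x))\<^sup>2)"
  have "real n * \<delta>^2 \<le> I" for n :: nat
  proof -
    have i2: "(\<lambda>x. (cmod (f x))\<^sup>2) integrable_on {m..m + real n}"
      by (rule set_lebesgue_integral_eq_integral(1)[OF si]) (auto simp: m_def)
    have "integral {m..m + real n} (\<lambda>x. \<delta>^2) \<le> integral {m..m + real n} (\<lambda>x. (cmod (f x))\<^sup>2)"
    proof (rule integral_le[OF integrable_const_ivl i2])
      fix x assume "x \<in> {m..m + real n}"
      then show "\<delta>\<^sup>2 \<le> (cmod (f x))\<^sup>2" using ge[of x] d by (intro power_mono) (auto simp: m_def)
    qed
    also have "\<dots> \<le> I" unfolding I_def by (rule integral_subset_le[OF _ i2 i1]) auto
    finally show ?thesis by simp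
  qed
  note le = this
  obtain n :: nat where "real n > I / \<delta>^2" using reals_Archimedean2[of "I / \<delta>^2"] by blast
  moreover have "\<delta>^2 > 0" using d by simp
  ultimately have "real n * \<delta>^2 > I" by (simp add: pos_divide_less_eq)
  then show False using le[of n] by simp
qed

lemma eigenvalue_imp_boundary:
  assumes "schroedinger_eigenvalue (morse_potential k) u0 \<alpha> (complex_of_real E)"
  shows "cos \<alpha> * psi k E u0 + sin \<alpha> * psi' k E u0 = 0"
proof -
  let ?V = "morse_potential k"
  obtain f where f: "f \<in> schroedinger_domain ?V u0 \<alpha>" and nz: "\<exists>x\<in>{u0<..}. f x \<noteq> 0"
    and ae: "AE x in lebesgue. x \<in> {u0<..} \<longrightarrow> schroedinger ?V u0 f x = complex_of_real E * f x"
    using assms unfolding schroedinger_eigenvalue_def by blast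
  define g where "g = half_line_deriv u0 f"
  have dom: "square_integrable_on f {u0<..}" "C1_half_line u0 f" "locally_absolutely_continuous_on {u0..} (half_line_deriv u0 f)"
     "complex_of_real (cos \<alpha>) * f u0 + complex_of_real (sin \<alpha>) * g u0 = 0"
    using f unfolding schroedinger_domain_def g_def by auto
  note cl = eigenfunction_classical[OF morse_deriv morse_deriv2 morse_level_finite dom(2,3) ae, folded g_def]
  have cf: "continuous_on {u0..} f" "continuous_on {u0..} g"
    unfolding continuous_on_eq_continuous_within
    by (intro ballI has_vector_derivative_continuous[OF cl(1)], simp)
       (intro ballI has_vector_derivative_continuous[OF cl(2)], simp)
  have at: "at x within {u0..} = at x" if "x > u0" for x
    using at_within_interior[of x "{u0..}"] that by (simp add: interior_real_atLeast)
  have gd: "(f has_vector_derivative g x) (at x)" "(g has_vector_derivative complex_of_real (?V x - E) * f x) (at x)"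
    if "x > u0" for x using cl[of x] that at[OF that] by auto
  have part: "schroedinger_solution ?V E u0 (\<lambda>x. F (f x)) (\<lambda>x. F (g x))"
    if F: "bounded_linear F" for F :: "complex \<Rightarrow> real"
    unfolding schroedinger_solution_def
  proof (intro conjI allI impI)
    interpret bounded_linear F by (rule F)
    show "continuous_on {u0..} (\<lambda>x. F (f x))" "continuous_on {u0..} (\<lambda>x. F (g x))"
      by (intro continuous_on cf)+
    fix x assume x: "x > u0"
    show "((\<lambda>x. F (f x)) has_real_derivative F (g x)) (at x)"
      using has_vector_derivative[OF gd(1)[OF x]]
      by (simp add: has_real_derivative_iff_has_vector_derivative)
    have "F (complex_of_real (?V x - E) * f x) = (?V x - E) * F (f x)"
      using scaleR[of "?V x - E" "f x"] by (simp add: scaleR_conv_of_real)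
    then show "((\<lambda>x. F (g x)) has_real_derivative (?V x - E) * F (f x)) (at x)"
      using has_vector_derivative[OF gd(2)[OF x]]
      by (simp add: has_real_derivative_iff_has_vector_derivative)
  qed
  have sr: "\<exists>x\<ge>b. \<bar>Re (f x)\<bar> < \<delta>" if "\<delta> > 0" for \<delta> b
    using square_integrable_small[OF dom(1) that, of b] abs_Re_le_cmod le_less_trans by blast
  have si: "\<exists>x\<ge>b. \<bar>Im (f x)\<bar> < \<delta>" if "\<delta> > 0" for \<delta> b
    using square_integrable_small[OF dom(1) that, of b] abs_Im_le_cmod le_less_trans by blast
  obtain a where a: "\<And>x. x \<ge> u0 \<Longrightarrow> Re (f x) = a * psi k E x" "\<And>x. x \<ge> u0 \<Longrightarrow> Re (g x) = a * psi' k E x"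
    using solution_multiple_of_psi[OF part[OF bounded_linear_Re] sr] by blast
  obtain c where c: "\<And>x. x \<ge> u0 \<Longrightarrow> Im (f x) = c * psi k E x" "\<And>x. x \<ge> u0 \<Longrightarrow> Im (g x) = c * psi' k E x"
    using solution_multiple_of_psi[OF part[OF bounded_linear_Im] si] by blast
  have "a \<noteq> 0 \<or> c \<noteq> 0"
  proof (rule ccontr)
    assume "\<not> ?thesis"
    then have "f x = 0" if "x > u0" for x using a(1)[of x] c(1)[of x] that by (simp add: complex_eq_iff)
    then show False using nz by auto
  qed
  moreover have "a * (cos \<alpha> * psi k E u0 + sin \<alpha> * psi' k E u0) = 0"
    using arg_cong[OF dom(4), of Re] a[of u0] by (simp add: algebra_simps)
  moreover have "c * (cos \<alpha> * psi k E u0 + sin \<alpha> * psi' k E u0) = 0"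
    using arg_cong[OF dom(4), of Im] c[of u0] by (simp add: algebra_simps)
  ultimately show ?thesis by auto
qed

lemma boundary_imp_eigenvalue:
  assumes bc: "cos \<alpha> * psi k E u0 + sin \<alpha> * psi' k E u0 = 0"
  shows "schroedinger_eigenvalue (morse_potential k) u0 \<alpha> (complex_of_real E)"
proof -
  let ?V = "morse_potential k"
  define f where "f = (\<lambda>x. complex_of_real (psi k E x))"
  define g where "g = (\<lambda>x. complex_of_real (psi' k E x))"
  define h where "h = half_line_deriv u0 f"
  have fd: "(f has_vector_derivative g x) (at x within S)" for x S unfolding f_def g_def
    by (rule has_vector_derivative_at_within[OF has_vector_derivative_of_real[OF psi_deriv]])
  have gd: "(g has_vector_derivative complex_of_real ((?V x - E) * psi k E x)) (at x within S)" for x S unfolding g_def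
    by (rule has_vector_derivative_at_within[OF has_vector_derivative_of_real[OF psi'_deriv]])
  have fc: "continuous_on S f" for S
    unfolding continuous_on_eq_continuous_within by (intro ballI has_vector_derivative_continuous[OF fd])
  have gc: "continuous_on S g" for S
    unfolding continuous_on_eq_continuous_within by (intro ballI has_vector_derivative_continuous[OF gd])
  have hg: "h x = g x" if "x \<ge> u0" for x
  proof -
    have "at x within {u0..} \<noteq> bot"
    proof -
      have "x islimpt {x..x+1}" by simp
      then have "x islimpt {u0..}" by (rule islimpt_subset) (use that in auto)
      then show ?thesis by (simp add: trivial_limit_within)
    qed
    then show ?thesis unfolding h_def half_line_deriv_def by (rule vector_derivative_within[OF _ fd])
  qed
  have hd: "(h has_vector_derivative complex_of_real ((?V x - E) * psi k E x)) (at x)" if "x > u0" for x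
    by (rule has_vector_derivative_transform_within_open[OF gd[of x UNIV], of "{u0<..}"]) (use that hg in auto)
  have sch: "schroedinger ?V u0 f x = complex_of_real E * f x" if "x > u0" for x
    unfolding schroedinger_def h_def[symmetric] vector_derivative_at[OF hd[OF that]] 
    by (simp add: f_def algebra_simps)
  have cmeas: "set_borel_measurable lebesgue {u0<..} (\<lambda>x. c * f x)" for c
    unfolding set_borel_measurable_def
  proof (rule borel_measurable_scaleR)
    have "continuous_on UNIV (\<lambda>x. c * f x)" by (intro continuous_intros fc)
    then show "(\<lambda>x. c * f x) \<in> borel_measurable lebesgue"
      by (intro measurable_completion) (simp add: borel_measurable_continuous_onI)
    show "indicat_real {u0<..} \<in> borel_measurable lebesgue"
      by (intro borel_measurable_indicator) simp
  qed
  have pint: "set_integrable lebesgue {u0<..} (\<lambda>x. (psi k E x)^2)"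
  proof -
    have c: "continuous_on UNIV (psi k E)" using psi_exp_decaying unfolding exp_decaying_def by blast
    have "\<forall>\<^sub>F x in at_top. \<bar>psi k E x\<bar> < 1"
      using tendsto_rabs_zero[OF exp_decaying_tendsto[OF psi_exp_decaying]] by (rule order_tendstoD) simp
    then have dom: "\<forall>\<^sub>F x in at_top. \<bar>(psi k E x)^2\<bar> \<le> 1 * \<bar>psi k E x\<bar>"
    proof eventually_elim
      case (elim x)
      then have "\<bar>psi k E x\<bar> * \<bar>psi k E x\<bar> \<le> 1 * \<bar>psi k E x\<bar>" by (intro mult_right_mono) auto
      then show ?case by (simp add: power2_eq_square abs_mult)
    qed
    have "exp_decaying (\<lambda>x. (psi k E x)^2)"
      by (rule exp_decaying_mono[OF psi_exp_decaying _ dom]) (intro continuous_intros c, simp)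
    from exp_decaying_integrable[OF this]
    have "(\<lambda>x. (psi k E x)^2) absolutely_integrable_on {u0..}" by (rule nonnegative_absolutely_integrable_1) auto
    then show ?thesis by (rule set_integrable_subset) auto
  qed
  have sq: "square_integrable_on (\<lambda>x. c * f x) {u0<..}" for c
  proof -
    have "set_integrable lebesgue {u0<..} (\<lambda>x. (cmod c)^2 * (psi k E x)^2)"
      by (rule set_integrable_mult_right) (rule pint)
    then show ?thesis unfolding square_integrable_on_def using cmeas[of c] 
      by (simp add: f_def norm_mult power_mult_distrib)
  qed
  have sq1: "square_integrable_on f {u0<..}" using sq[of 1] by simp
  have "square_integrable_on (schroedinger ?V u0 f) {u0<..}"
  proof -
    have 1: "(\<lambda>x. indicator {u0<..} x *\<^sub>R schroedinger ?V u0 f x) = (\<lambda>x. indicator {u0<..} x *\<^sub>R (complex_of_real E * f x))"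
      by (intro ext) (simp split: split_indicator add: sch)
    have 2: "(\<lambda>x. indicator {u0<..} x *\<^sub>R (cmod (schroedinger ?V u0 f x))\<^sup>2) = (\<lambda>x. indicator {u0<..} x *\<^sub>R (cmod (complex_of_real E * f x))\<^sup>2)"
      by (intro ext) (simp split: split_indicator add: sch)
    show ?thesis using sq[of "complex_of_real E"] 
      unfolding square_integrable_on_def set_borel_measurable_def set_integrable_def 1 2 .
  qed
  moreover have "C1_half_line u0 f" unfolding C1_half_line_def
  proof
    show "f differentiable_on {u0..}" unfolding differentiable_on_def
      by (intro ballI differentiableI_vector[OF fd])
    have "continuous_on {u0..} h" by (rule continuous_on_eq[OF gc]) (use hg in auto)
    then show "continuous_on {u0..} (half_line_deriv u0 f)" unfolding h_def .
  qed
  moreover have "locally_absolutely_continuous_on {u0..} (half_line_deriv u0 f)"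
    unfolding locally_absolutely_continuous_on_def h_def[symmetric]
  proof (intro allI impI)
    fix a b assume ab: "{a..b} \<subseteq> {u0..}"
    have c: "continuous_on UNIV (psi k E)" using psi_exp_decaying unfolding exp_decaying_def by blast
    show "absolutely_continuous_on {a..b} h"
    proof (rule absolutely_continuous_on_C1)
      fix x assume x: "x \<in> {a..b}"
      show "(h has_vector_derivative complex_of_real ((?V x - E) * psi k E x)) (at x within {a..b})"
        by (rule has_vector_derivative_transform[OF x _ gd]) (use hg ab in auto)
    qed (intro continuous_intros morse_cont continuous_on_subset[OF c], simp)
  qed
  moreover have "complex_of_real (cos \<alpha>) * f u0 + complex_of_real (sin \<alpha>) * half_line_deriv u0 f u0 = 0"
  proof -
    have "half_line_deriv u0 f u0 = g u0" using hg[of u0] by (simp add: h_def)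
    moreover have "complex_of_real (cos \<alpha>) * f u0 + complex_of_real (sin \<alpha>) * g u0 
       = complex_of_real (cos \<alpha> * psi k E u0 + sin \<alpha> * psi' k E u0)" unfolding f_def g_def by simp
    ultimately show ?thesis unfolding bc by simp
  qed
  ultimately have dom: "f \<in> schroedinger_domain ?V u0 \<alpha>" using sq1 unfolding schroedinger_domain_def by blast
  obtain b where b: "\<And>u. u \<ge> b \<Longrightarrow> psi k E u > 0" using psi_pos_at_infinity by blast
  have "f (max b (u0 + 1)) \<noteq> 0" using b[of "max b (u0+1)"] by (simp add: f_def)
  then have "\<exists>x\<in>{u0<..}. f x \<noteq> 0" by (intro bexI[of _ "max b (u0+1)"]) auto
  moreover have "AE x in lebesgue. x \<in> {u0<..} \<longrightarrow> schroedinger ?V u0 f x = complex_of_real E * f x"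
    using sch by (intro AE_I2) auto
  ultimately show ?thesis unfolding schroedinger_eigenvalue_def using dom by blast
qed

lemma eigenvalue_iff:
  "schroedinger_eigenvalue (morse_potential k) u0 \<alpha> (complex_of_real E) \<longleftrightarrow>
     cos \<alpha> * psi k E u0 + sin \<alpha> * psi' k E u0 = 0"
  using eigenvalue_imp_boundary boundary_imp_eigenvalue by blast

section \<open>Pruefer angles\<close>

text \<open>
  A continuous choice of the angle of the curve \<open>(b, a)\<close>, so that the zeros of \<open>a\<close> are the points where \<open>\<theta>\<close> is
  a multiple of \<open>\<pi>\<close>.
\<close>

definition polar_lift :: "('a::metric_space \<Rightarrow> real) \<Rightarrow> ('a \<Rightarrow> real) \<Rightarrow> ('a \<Rightarrow> real) \<Rightarrow> 'a set \<Rightarrow> bool" where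
  "polar_lift \<theta> a b S \<longleftrightarrow> continuous_on S \<theta> \<and> (\<forall>x\<in>S. \<exists>r>0. a x = r * sin (\<theta> x) \<and> b x = r * cos (\<theta> x))"

lemma polar_liftD:
  assumes "polar_lift \<theta> a b S"
  shows "continuous_on S \<theta>" "\<And>x. x \<in> S \<Longrightarrow> \<exists>r>0. a x = r * sin (\<theta> x) \<and> b x = r * cos (\<theta> x)"
  using assms unfolding polar_lift_def by auto

text \<open>
  A continuous logarithm of \<open>b + \<i> a\<close> exists because a convex set is contractible.
\<close>

lemma polar_lift_exists:
  fixes a b :: "'a::real_normed_vector \<Rightarrow> real"
  assumes "convex S" "continuous_on S a" "continuous_on S b" "\<And>x. x \<in> S \<Longrightarrow> a x \<noteq> 0 \<or> b x \<noteq> 0"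
  obtains \<theta> where "polar_lift \<theta> a b S"
proof -
  have c: "continuous_on S (\<lambda>x. Complex (b x) (a x))"
    unfolding Complex_eq by (intro continuous_intros assms)
  have nz: "Complex (b x) (a x) \<noteq> 0" if "x \<in> S" for x using assms(4)[OF that] by (auto simp: complex_eq_iff)
  obtain L where L: "continuous_on S L" "\<And>x. x \<in> S \<Longrightarrow> Complex (b x) (a x) = exp (L x)"
    using continuous_logarithm_on_contractible[OF c convex_imp_contractible[OF assms(1)] nz] by blast
  have "polar_lift (\<lambda>x. Im (L x)) a b S" unfolding polar_lift_def
  proof (intro conjI ballI)
    show "continuous_on S (\<lambda>x. Im (L x))" by (intro continuous_intros L)
    fix x assume "x \<in> S"
    from L(2)[OF this] have "b x = Re (exp (L x))" "a x = Im (exp (L x))" by (metis complex.sel)+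
    then show "\<exists>r>0. a x = r * sin (Im (L x)) \<and> b x = r * cos (Im (L x))"
      by (intro exI[of _ "exp (Re (L x))"]) (simp add: Re_exp Im_exp)
  qed
  then show ?thesis using that by blast
qed

lemma polar_lift_shift:
  assumes "polar_lift \<theta> a b S"
  shows "polar_lift (\<lambda>x. \<theta> x - 2 * pi * of_int n) a b S"
proof -
  have "sin (t - 2 * pi * of_int n) = sin t" "cos (t - 2 * pi * of_int n) = cos t" for t :: real
    by (simp_all add: sin_diff cos_diff)
  then show ?thesis using assms unfolding polar_lift_def by (auto intro: continuous_intros)
qed

text \<open>
  Near \<open>x\<close> the angle is \<open>\<theta> x\<close> plus the arctangent of the quotient of the coordinates in the frame
  rotated by \<open>\<theta> x\<close>, which is differentiable.
\<close>

lemma polar_lift_deriv: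
  fixes \<theta> a b :: "real \<Rightarrow> real"
  assumes l: "polar_lift \<theta> a b S" and S: "open S" "x \<in> S"
    and da: "(a has_real_derivative a') (at x)" and db: "(b has_real_derivative b') (at x)"
  shows "(\<theta> has_real_derivative (a' * b x - a x * b') / (a x ^ 2 + b x ^ 2)) (at x)"
proof -
  obtain r where r: "r > 0" "a x = r * sin (\<theta> x)" "b x = r * cos (\<theta> x)"
    using polar_liftD(2)[OF l S(2)] by blast
  define s where "s = (\<lambda>y. a y * cos (\<theta> x) - b y * sin (\<theta> x))"
  define c where "c = (\<lambda>y. a y * sin (\<theta> x) + b y * cos (\<theta> x))"
  have sc: "sin t * sin t + cos t * cos t = 1" for t :: real using sin_cos_squared_add[of t] by (simp add: power2_eq_square)
  have sx: "s x = 0" "c x = r" using r sc[of "\<theta> x"] by (auto simp: s_def c_def algebra_simps simp flip: distrib_left)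
  have ds: "(s has_real_derivative (a' * cos (\<theta> x) - b' * sin (\<theta> x))) (at x)"
    unfolding s_def by (intro DERIV_diff DERIV_cmult_right da db)
  have dc: "(c has_real_derivative (a' * sin (\<theta> x) + b' * cos (\<theta> x))) (at x)"
    unfolding c_def by (intro DERIV_add DERIV_cmult_right da db)
  have dsc: "((\<lambda>y. s y / c y) has_real_derivative (a' * cos (\<theta> x) - b' * sin (\<theta> x)) / r) (at x)"
    using DERIV_divide[OF ds dc] sx r by simp
  have "((\<lambda>y. arctan (s y / c y)) has_real_derivative inverse (1 + (s x / c x)\<^sup>2) * ((a' * cos (\<theta> x) - b' * sin (\<theta> x)) / r)) (at x)"
    by (rule DERIV_chain2[OF DERIV_arctan dsc])
  then have "((\<lambda>y. \<theta> x + arctan (s y / c y)) has_real_derivative 0 + (a' * cos (\<theta> x) - b' * sin (\<theta> x)) / r) (at x)"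
    using sx by (intro DERIV_add DERIV_const) simp
  moreover have "0 + (a' * cos (\<theta> x) - b' * sin (\<theta> x)) / r = (a' * b x - a x * b') / (a x ^ 2 + b x ^ 2)"
  proof -
    have "a x ^ 2 + b x ^ 2 = r * r" using r sc[of "\<theta> x"]
      by (simp add: power2_eq_square algebra_simps flip: distrib_left)
    then show ?thesis using r by (simp add: field_simps)
  qed
  moreover have ev: "\<forall>\<^sub>F y in nhds x. \<theta> y = \<theta> x + arctan (s y / c y)"
  proof -
    have "isCont \<theta> x" using polar_liftD(1)[OF l] S by (simp add: continuous_on_eq_continuous_at)
    then have "\<forall>\<^sub>F y in nhds x. dist (\<theta> y) (\<theta> x) < pi / 2"
      unfolding isCont_def tendsto_at_iff_tendsto_nhds by (rule tendstoD) simp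
    moreover have "\<forall>\<^sub>F y in nhds x. y \<in> S" using S by (simp add: eventually_nhds_in_open)
    ultimately show ?thesis
    proof eventually_elim
      case (elim y)
      obtain q where q: "q > 0" "a y = q * sin (\<theta> y)" "b y = q * cos (\<theta> y)"
        using polar_liftD(2)[OF l elim(2)] by blast
      have "s y = q * sin (\<theta> y - \<theta> x)" "c y = q * cos (\<theta> y - \<theta> x)"
        unfolding s_def c_def q sin_diff cos_diff by (simp_all add: algebra_simps)
      then have "s y / c y = tan (\<theta> y - \<theta> x)" using q by (simp add: tan_def)
      moreover have "- (pi / 2) < \<theta> y - \<theta> x" "\<theta> y - \<theta> x < pi / 2"
        using elim(1) unfolding dist_real_def by linarith+
      ultimately show ?case by (simp add: arctan_tan)
    qed
  qed
  ultimately show ?thesis using DERIV_cong_ev[OF refl ev refl] by simp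
qed

text \<open>
  Two points in the same open half-plane, or on the same ray of the axis between the half-planes, never have angles that differ by an
  odd multiple of \<open>\<pi>\<close>. So the difference of the two lifts is confined to an interval of
  length \<open>2\<pi>\<close>.
\<close>

lemma polar_lift_compare:
  assumes t: "polar_lift \<theta> a b S" and p: "polar_lift \<phi> c d S" and S: "connected S"
    and sg: "\<And>x. x \<in> S \<Longrightarrow> sgn (a x) = sgn (c x)" "\<And>x. x \<in> S \<Longrightarrow> a x = 0 \<Longrightarrow> sgn (b x) = sgn (d x)"
    and xy: "x \<in> S" "y \<in> S"
  shows "\<bar>(\<theta> x - \<theta> y) - (\<phi> x - \<phi> y)\<bar> < 2 * pi"
proof -
  have no: "\<theta> z - \<phi> z \<noteq> pi * of_int n" if z: "z \<in> S" and n: "odd n" for z n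
  proof
    assume eq: "\<theta> z - \<phi> z = pi * of_int n"
    obtain r where r: "r > 0" "a z = r * sin (\<theta> z)" "b z = r * cos (\<theta> z)" using polar_liftD(2)[OF t z] by blast
    obtain q where q: "q > 0" "c z = q * sin (\<phi> z)" "d z = q * cos (\<phi> z)" using polar_liftD(2)[OF p z] by blast
    have th: "\<theta> z = \<phi> z + pi * of_int n" using eq by simp
    have sc: "sin (pi * of_int n) = 0" "cos (pi * of_int n) = -1" using n by (simp_all add: mult.commute)
    have s: "sin (\<theta> z) = - sin (\<phi> z)" "cos (\<theta> z) = - cos (\<phi> z)"
      unfolding th sin_add cos_add sc by simp_all
    have "sgn (sin (\<theta> z)) = sgn (sin (\<phi> z))" using sg(1)[OF z] r q by (simp add: sgn_mult)
    then have z0: "sin (\<phi> z) = 0" unfolding s by (simp add: sgn_minus) (metis neg_equal_zero sgn_zero_iff)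
    then have "a z = 0" using r s by simp
    from sg(2)[OF z this] have "sgn (cos (\<theta> z)) = sgn (cos (\<phi> z))" using r q by (simp add: sgn_mult)
    then have "cos (\<phi> z) = 0" unfolding s by (simp add: sgn_minus) (metis neg_equal_zero sgn_zero_iff)
    then show False using z0 sin_cos_squared_add[of "\<phi> z"] by simp
  qed
  \<comment> \<open>The odd multiples of \<open>\<pi>\<close> that enclose \<open>\<theta> x - \<phi> x\<close> are numbered \<open>2 m - 1\<close> and \<open>2 m + 1\<close>.\<close>
  define m where "m = \<lfloor>(\<theta> x - \<phi> x + pi) / (2 * pi)\<rfloor>"
  define g where "g = (\<lambda>z. \<theta> z - \<phi> z)"
  have cg: "connected (g ` S)" unfolding g_def
    by (intro connected_continuous_image S continuous_intros polar_liftD(1)[OF t] polar_liftD(1)[OF p])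
  have iv: "is_interval (g ` S)" using cg by (simp add: is_interval_connected_1)
  have 1: "of_int m \<le> (g x + pi) / (2 * pi)" "(g x + pi) / (2 * pi) < of_int m + 1"
    unfolding m_def g_def by linarith+
  have lo: "pi * of_int (2 * m - 1) \<le> g x" using 1(1) by (simp add: field_simps)
  have hi: "g x < pi * of_int (2 * m + 1)" using 1(2) by (simp add: field_simps)
  have "pi * of_int (2 * m - 1) < g z \<and> g z < pi * of_int (2 * m + 1)" if z: "z \<in> S" for z
  proof (rule ccontr)
    assume "\<not> ?thesis"
    then consider "g z \<le> pi * of_int (2 * m - 1)" | "g z \<ge> pi * of_int (2 * m + 1)" by linarith
    then show False
    proof cases
      case 1
      then have "pi * of_int (2 * m - 1) \<in> g ` S"
        using mem_is_interval_1_I[OF iv, of "g z" "g x"] z xy lo by auto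
      then obtain z' where "z' \<in> S" "\<theta> z' - \<phi> z' = pi * of_int (2 * m - 1)" unfolding g_def by auto
      then show False using no[of z' "2 * m - 1"] by simp
    next
      case 2
      then have "pi * of_int (2 * m + 1) \<in> g ` S"
        using mem_is_interval_1_I[OF iv, of "g x" "g z"] z xy hi by auto
      then obtain z' where "z' \<in> S" "\<theta> z' - \<phi> z' = pi * of_int (2 * m + 1)" unfolding g_def by auto
      then show False using no[of z' "2 * m + 1"] by simp
    qed
  qed
  from this[OF xy(1)] this[OF xy(2)] have "\<bar>g x - g y\<bar> < 2 * pi" by (auto simp: algebra_simps abs_less_iff)
  then show ?thesis unfolding g_def by (simp add: algebra_simps)
qed

lemma lift_stays_in_upper_half:
  assumes c: "continuous_on S \<theta>" and S: "connected S" and pos: "\<And>x. x \<in> S \<Longrightarrow> sin (\<theta> x) > 0"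
    and x0: "x0 \<in> S" "0 < \<theta> x0" "\<theta> x0 < pi" and x: "x \<in> S"
  shows "0 < \<theta> x \<and> \<theta> x < (pi::real)"
proof (rule ccontr)
  assume "\<not> ?thesis"
  then consider "\<theta> x \<le> 0" | "\<theta> x \<ge> pi" by linarith
  moreover have iv: "is_interval (\<theta> ` S)"
    using connected_continuous_image[OF c S] by (simp add: is_interval_connected_1)
  ultimately have "0 \<in> \<theta> ` S \<or> pi \<in> \<theta> ` S"
  proof cases
    case 1 then show ?thesis using mem_is_interval_1_I[OF iv, of "\<theta> x" "\<theta> x0" 0] x x0 by auto
  next
    case 2 then show ?thesis using mem_is_interval_1_I[OF iv, of "\<theta> x0" "\<theta> x" pi] x x0 by auto
  qed
  then show False using pos by force
qed

text \<open>
  All terms of the series are nonnegative when \<open>E + (k + 1/2)\<^sup>2 \<le> 0\<close>.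
\<close>

lemma psi_pos_below_base:
  assumes "E \<le> - ((k + 1/2)^2)" shows "psi k E u > 0"
proof -
  define l where "l = E + (k + 1/2)^2"
  have l: "- l \<ge> 0" using assms by (simp add: l_def)
  have "0 < pert_series k l u" unfolding pert_series_def
  proof (rule suminf_pos2[where i=0])
    show "summable (\<lambda>n. (- l) ^ n * iter_term k n u)" by (rule pert_series_summable)
    show "0 \<le> (- l) ^ n * iter_term k n u" for n
      using iter_term_bounds[of k n] by (intro mult_nonneg_nonneg zero_le_power[OF l]) blast
  qed simp
  then show ?thesis unfolding psi_def l_def[symmetric] using base_sol_pos[of k u] by simp
qed

text \<open>
  The lift is taken in both variables simultaneously, which makes it continuous in the energy. For \<open>E \<le> -(k + 1/2)\<^sup>2\<close> the solution has no zero, so the angle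
  can be normalised to \<open>(0, \<pi>)\<close> there; far out, where \<open>psi_eventually_pos\<close> excludes zeros for a whole
  range of energies, this normalisation is carried to any other energy.
\<close>

lemma pruefer_angle_exists:
  obtains \<Theta> :: "real \<Rightarrow> real \<Rightarrow> real" where
    "continuous_on UNIV (\<lambda>p. \<Theta> (snd p) (fst p))"
    "\<And>E S. polar_lift (\<Theta> E) (psi k E) (psi' k E) S"
    "\<And>E. \<exists>b. \<forall>u\<ge>b. 0 < psi k E u \<and> 0 < \<Theta> E u \<and> \<Theta> E u < pi"
    "\<And>E u. E \<le> - ((k + 1/2)^2) \<Longrightarrow> 0 < \<Theta> E u \<and> \<Theta> E u < pi"
proof -
  let ?E0 = "- ((k + 1/2)^2)"
  obtain t where t: "polar_lift t (\<lambda>p. psi k (snd p) (fst p)) (\<lambda>p. psi' k (snd p) (fst p)) UNIV"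
    by (rule polar_lift_exists[OF convex_UNIV psi_cont psi'_cont]) (use psi_nonvanishing in auto)
  define n where "n = \<lfloor>t (0, ?E0) / (2 * pi)\<rfloor>"
  define T where "T = (\<lambda>p. t p - 2 * pi * of_int n)"
  have T: "polar_lift T (\<lambda>p. psi k (snd p) (fst p)) (\<lambda>p. psi' k (snd p) (fst p)) UNIV"
    unfolding T_def by (rule polar_lift_shift[OF t])
  define \<Theta> where "\<Theta> = (\<lambda>E u. T (u, E))"
  have cT: "continuous_on A T" for A using polar_liftD(1)[OF T] continuous_on_subset by blast
  have sinT: "sin (T p) > 0" if "psi k (snd p) (fst p) > 0" for p
  proof -
    obtain r where "r > 0" "psi k (snd p) (fst p) = r * sin (T p)" using polar_liftD(2)[OF T, of p] by auto
    then show ?thesis using that by (simp add: zero_less_mult_iff)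
  qed
  have T0: "0 < T (0, ?E0) \<and> T (0, ?E0) < pi"
  proof -
    have "of_int n \<le> t (0, ?E0) / (2 * pi)" "t (0, ?E0) / (2 * pi) < of_int n + 1" unfolding n_def by linarith+
    then have r: "0 \<le> T (0, ?E0)" "T (0, ?E0) < 2 * pi" unfolding T_def by (simp_all add: field_simps)
    have s: "sin (T (0, ?E0)) > 0" using sinT psi_pos_below_base[OF order_refl] by simp
    have "T (0, ?E0) < pi"
    proof (rule ccontr)
      assume "\<not> ?thesis"
      then have "sin (T (0, ?E0)) \<le> 0" using r by (intro sin_le_zero) auto
      then show False using s by simp
    qed
    moreover have "T (0, ?E0) \<noteq> 0" using s by auto
    ultimately show ?thesis using r by simp
  qed
  show ?thesis
  proof (rule that[of \<Theta>])
    show "continuous_on UNIV (\<lambda>p. \<Theta> (snd p) (fst p))" unfolding \<Theta>_def using cT by simp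
    show "polar_lift (\<Theta> E) (psi k E) (psi' k E) S" for E S unfolding polar_lift_def
    proof (intro conjI ballI)
      show "continuous_on S (\<Theta> E)" unfolding \<Theta>_def
        by (rule continuous_on_compose2[OF cT[of UNIV]]) (auto intro!: continuous_intros)
    qed (use polar_liftD(2)[OF T, of "(x, E)" for x] in \<open>auto simp: \<Theta>_def\<close>)
    show below: "0 < \<Theta> E u \<and> \<Theta> E u < pi" if "E \<le> ?E0" for E u
      unfolding \<Theta>_def
    proof (rule lift_stays_in_upper_half[OF cT, of "UNIV \<times> {..?E0}" "(0, ?E0)" "(u, E)"])
      show "connected (UNIV \<times> {..?E0} :: (real \<times> real) set)"
        by (intro connected_Times convex_connected convex_UNIV) auto
    qed (use T0 that in \<open>auto intro!: sinT psi_pos_below_base\<close>)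
    show "\<exists>b. \<forall>u\<ge>b. 0 < psi k E u \<and> 0 < \<Theta> E u \<and> \<Theta> E u < pi" for E
    proof (cases "E \<le> ?E0")
      case True then show ?thesis using below psi_pos_below_base by blast
    next
      case False
      obtain b where b: "\<And>u E'. u \<ge> b \<Longrightarrow> \<bar>E' + (k + 1/2)^2\<bar> \<le> E + (k + 1/2)^2 \<Longrightarrow> psi k E' u > 0"
        using psi_eventually_pos[of k "E + (k + 1/2)^2"] by blast
      have "0 < \<Theta> E u \<and> \<Theta> E u < pi" if "u \<ge> b" for u
        unfolding \<Theta>_def
      proof (rule lift_stays_in_upper_half[OF cT, of "{b..} \<times> {?E0..E}" "(b, ?E0)" "(u, E)"])
        show "connected ({b..} \<times> {?E0..E})" by (intro connected_Times) auto
        show "0 < sin (T p)" if "p \<in> {b..} \<times> {?E0..E}" for p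
          by (rule sinT, rule b) (use that in auto)
      qed (use below[of ?E0 b] that False in \<open>auto simp: \<Theta>_def\<close>)
      moreover have "psi k E u > 0" if "u \<ge> b" for u by (rule b) (use that False in auto)
      ultimately show ?thesis by blast
    qed
  qed
qed

lemma pruefer_ode:
  assumes l: "polar_lift \<theta> (psi k E) (psi' k E) UNIV"
  shows "(\<theta> has_real_derivative (cos (\<theta> u))^2 + (E - morse_potential k u) * (sin (\<theta> u))^2) (at u)"
proof -
  obtain r where r: "r > 0" "psi k E u = r * sin (\<theta> u)" "psi' k E u = r * cos (\<theta> u)"
    using polar_liftD(2)[OF l, of u] by auto
  have "(\<theta> has_real_derivative (psi' k E u * psi' k E u - psi k E u * ((morse_potential k u - E) * psi k E u))
       / (psi k E u ^ 2 + psi' k E u ^ 2)) (at u)"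
    by (rule polar_lift_deriv[OF l open_UNIV UNIV_I psi_deriv psi'_deriv])
  moreover have "psi k E u ^ 2 + psi' k E u ^ 2 = r^2"
    unfolding r by (simp add: power_mult_distrib flip: distrib_left)
  moreover have "(psi' k E u * psi' k E u - psi k E u * ((morse_potential k u - E) * psi k E u)) / r^2
     = (cos (\<theta> u))^2 + (E - morse_potential k u) * (sin (\<theta> u))^2"
    unfolding r using r(1) by (simp add: field_simps power2_eq_square)
  ultimately show ?thesis by simp
qed

lemma abs_sin_squared_diff_le: "\<bar>(sin a)^2 - (sin b)^2\<bar> \<le> \<bar>a - b :: real\<bar>"
proof -
  have s: "(sin t)\<^sup>2 = 1 - (cos t)\<^sup>2" for t :: real by (rule sin_squared_eq)
  have "(sin a)^2 - (sin b)^2 = (sin a)^2 * (1 - (sin b)^2) - (1 - (sin a)^2) * (sin b)^2" by (simp add: algebra_simps)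
  also have "\<dots> = sin (a + b) * sin (a - b)" unfolding sin_add sin_diff cos_squared_eq[symmetric]
    by (simp add: algebra_simps power2_eq_square)
  finally have "\<bar>(sin a)^2 - (sin b)^2\<bar> = \<bar>sin (a + b)\<bar> * \<bar>sin (a - b)\<bar>" by (simp add: abs_mult)
  also have "\<dots> \<le> 1 * \<bar>a - b\<bar>" by (intro mult_mono abs_sin_x_le_abs_x) auto
  finally show ?thesis by simp
qed

text \<open>
  Near infinity the Wronskian of the two solutions is positive, which orders the angles. Going back from
  there, \<open>D = \<theta>2 - \<theta>1\<close> satisfies \<open>D' \<ge> M D\<close> while it is negative, so it cannot reach \<open>0\<close>.
\<close>

lemma pruefer_angle_decreasing:
  assumes l1: "polar_lift \<theta>1 (psi k E1) (psi' k E1) UNIV" and l2: "polar_lift \<theta>2 (psi k E2) (psi' k E2) UNIV"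
    and i1: "\<exists>b. \<forall>u\<ge>b. 0 < psi k E1 u \<and> 0 < \<theta>1 u \<and> \<theta>1 u < pi"
    and i2: "\<exists>b. \<forall>u\<ge>b. 0 < psi k E2 u \<and> 0 < \<theta>2 u \<and> \<theta>2 u < pi"
    and E: "E1 < E2"
  shows "\<theta>2 u0 < \<theta>1 u0"
proof -
  obtain b1 b2 where b1: "\<And>u. u \<ge> b1 \<Longrightarrow> 0 < psi k E1 u \<and> 0 < \<theta>1 u \<and> \<theta>1 u < pi"
    and b2: "\<And>u. u \<ge> b2 \<Longrightarrow> 0 < psi k E2 u \<and> 0 < \<theta>2 u \<and> \<theta>2 u < pi" using i1 i2 by blast
  define b where "b = max (max b1 b2) u0"
  have b: "u0 \<le> b" "\<And>u. u \<ge> b \<Longrightarrow> 0 < psi k E1 u \<and> 0 < \<theta>1 u \<and> \<theta>1 u < pi"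
    "\<And>u. u \<ge> b \<Longrightarrow> 0 < psi k E2 u \<and> 0 < \<theta>2 u \<and> \<theta>2 u < pi"
    using b1 b2 by (auto simp: b_def)
  define W where "W = (\<lambda>u. psi k E1 u * psi' k E2 u - psi' k E1 u * psi k E2 u)"
  have dW: "(W has_real_derivative (E1 - E2) * (psi k E1 u * psi k E2 u)) (at u)" for u
  proof -
    have "(W has_real_derivative (psi' k E1 u * psi' k E2 u + (morse_potential k u - E2) * psi k E2 u * psi k E1 u)
       - ((morse_potential k u - E1) * psi k E1 u * psi k E2 u + psi' k E2 u * psi' k E1 u)) (at u)"
      unfolding W_def by (intro DERIV_diff DERIV_mult psi_deriv psi'_deriv)
    then show ?thesis by (rule DERIV_cong) (simp add: algebra_simps)
  qed
  have neg: "(E1 - E2) * (psi k E1 u * psi k E2 u) < 0" if "u \<ge> b" for u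
    using b(2,3)[OF that] E by (intro mult_neg_pos mult_pos_pos) auto
  have Wdec: "W v < W u" if "b \<le> u" "u < v" for u v
    by (rule DERIV_neg_imp_decreasing[OF that(2)]) (use dW neg that in \<open>meson order_trans\<close>)
  have "(W \<longlongrightarrow> 0 * 0 - 0 * 0) at_top" unfolding W_def
    by (intro tendsto_intros exp_decaying_tendsto psi_exp_decaying psi'_exp_decaying)
  then have W0: "(W \<longlongrightarrow> 0) at_top" by simp
  have "0 \<le> W (b + 1)"
  proof (rule tendsto_upperbound[OF W0])
    show "\<forall>\<^sub>F v in at_top. W v \<le> W (b + 1)"
      using eventually_gt_at_top[of "b + 1"] by eventually_elim (rule less_imp_le, rule Wdec, auto)
  qed simp
  then have Wb: "W b > 0" using Wdec[of b "b + 1"] by simp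
  obtain r1 where r1: "r1 > 0" "psi k E1 b = r1 * sin (\<theta>1 b)" "psi' k E1 b = r1 * cos (\<theta>1 b)"
    using polar_liftD(2)[OF l1, of b] by auto
  obtain r2 where r2: "r2 > 0" "psi k E2 b = r2 * sin (\<theta>2 b)" "psi' k E2 b = r2 * cos (\<theta>2 b)"
    using polar_liftD(2)[OF l2, of b] by auto
  have "W b = (r1 * r2) * sin (\<theta>1 b - \<theta>2 b)" unfolding W_def r1 r2 sin_diff by (simp add: algebra_simps)
  then have "0 < (r1 * r2) * sin (\<theta>1 b - \<theta>2 b)" using Wb by simp
  moreover have "0 < r1 * r2" using r1(1) r2(1) by simp
  ultimately have sp: "sin (\<theta>1 b - \<theta>2 b) > 0" by (rule zero_less_mult_pos)
  define D where "D = (\<lambda>u. \<theta>2 u - \<theta>1 u)"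
  have Db: "D b < 0"
  proof (rule ccontr)
    assume "\<not> D b < 0"
    then have "sin (\<theta>2 b - \<theta>1 b) \<ge> 0"
      using b(2,3)[of b] by (intro sin_ge_zero) (auto simp: D_def)
    then show False using sp by (simp add: sin_diff algebra_simps)
  qed
  define D' where "D' = (\<lambda>u. (cos (\<theta>2 u))^2 + (E2 - morse_potential k u) * (sin (\<theta>2 u))^2
      - ((cos (\<theta>1 u))^2 + (E1 - morse_potential k u) * (sin (\<theta>1 u))^2))"
  have dD: "(D has_real_derivative D' u) (at u)" for u
    unfolding D_def D'_def by (intro DERIV_diff pruefer_ode l1 l2)
  have cD: "continuous_on A D" for A by (rule DERIV_continuous_on[OF has_field_derivative_at_within[OF dD]])
  have "compact ((\<lambda>u. E1 - morse_potential k u - 1) ` {u0..b})"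
    by (intro compact_continuous_image continuous_intros morse_cont) auto
  from compact_imp_bounded[OF this] obtain M where M: "\<And>u. u \<in> {u0..b} \<Longrightarrow> \<bar>E1 - morse_potential k u - 1\<bar> \<le> M"
    unfolding bounded_iff by (auto simp only: ball_simps real_norm_def)
  have D'lb: "D' u \<ge> M * D u" if "u \<in> {u0..b}" "D u < 0" for u
  proof -
    have "D' u = (E2 - E1) * (sin (\<theta>2 u))^2 + (E1 - morse_potential k u - 1) * ((sin (\<theta>2 u))^2 - (sin (\<theta>1 u))^2)"
      unfolding D'_def cos_squared_eq by (simp add: algebra_simps)
    moreover have "(E2 - E1) * (sin (\<theta>2 u))^2 \<ge> 0" using E by simp
    moreover have "\<bar>(E1 - morse_potential k u - 1) * ((sin (\<theta>2 u))^2 - (sin (\<theta>1 u))^2)\<bar> \<le> M * \<bar>D u\<bar>"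
      unfolding abs_mult D_def using M[OF that(1)] by (intro mult_mono abs_sin_squared_diff_le) auto
    ultimately show ?thesis using that(2) by (simp add: abs_if split: if_splits)
  qed
  have "D u0 < 0"
  proof (rule ccontr)
    assume "\<not> D u0 < 0"
    define A where "A = {u0..b} \<inter> {u. D u \<ge> 0}"
    have A: "closed A" "u0 \<in> A" "bdd_above A" unfolding A_def
      using closed_Collect_le[of "\<lambda>_. 0" D] cD[of UNIV] b(1) \<open>\<not> D u0 < 0\<close> by auto
    \<comment> \<open>The last point where \<open>D\<close> is nonnegative; the inequality \<open>D' \<ge> M D\<close> holds to the right of it.\<close>
    define c where "c = Sup A"
    have cA: "c \<in> A" unfolding c_def by (rule closed_contains_Sup) (use A in auto)
    have c: "u0 \<le> c" "c \<le> b" "D c \<ge> 0" using cA by (auto simp: A_def)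
    have after: "D u < 0" if "c < u" "u \<le> b" for u
    proof (rule ccontr)
      assume "\<not> D u < 0"
      then have "u \<in> A" using that c by (auto simp: A_def)
      then have "u \<le> c" unfolding c_def by (rule cSup_upper[OF _ A(3)])
      then show False using that by simp
    qed
    have "exp (- M * c) * D c \<le> exp (- M * b) * D b"
    proof (rule DERIV_nonneg_imp_increasing_open[OF c(2)])
      fix u assume u: "c < u" "u < b"
      have "((\<lambda>u. exp (- M * u) * D u) has_real_derivative exp (- M * u) * (D' u - M * D u)) (at u)"
        by (rule DERIV_cong, rule DERIV_mult', rule DERIV_chain'[OF _ DERIV_exp], rule DERIV_cmult_Id, rule dD)
          (simp add: algebra_simps)
      moreover have "exp (- M * u) * (D' u - M * D u) \<ge> 0" using D'lb[of u] after[of u] u c by simp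
      ultimately show "\<exists>y. ((\<lambda>u. exp (- M * u) * D u) has_real_derivative y) (at u) \<and> 0 \<le> y" by blast
    qed (intro continuous_intros cD)
    moreover have "exp (- M * b) * D b < 0" using Db by (simp add: mult_pos_neg)
    moreover have "exp (- M * c) * D c \<ge> 0" using c by simp
    ultimately show False by simp
  qed
  then show ?thesis by (simp add: D_def)
qed

section \<open>Rotation of the solution at high energy\<close>

text \<open>
  A mean value inequality for \<open>f - g\<close> in which the majorant of the derivative is itself given by its
  antiderivative \<open>h\<close>, so that no integrals occur.
\<close>

lemma increment_bound:
  fixes f g h :: "real \<Rightarrow> real"
  assumes ab: "a \<le> b"
    and f: "\<And>x. a \<le> x \<Longrightarrow> x \<le> b \<Longrightarrow> (f has_real_derivative f' x) (at x)"
    and g: "\<And>x. a \<le> x \<Longrightarrow> x \<le> b \<Longrightarrow> (g has_real_derivative g' x) (at x)"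
    and h: "\<And>x. a \<le> x \<Longrightarrow> x \<le> b \<Longrightarrow> (h has_real_derivative h' x) (at x)"
    and le: "\<And>x. a \<le> x \<Longrightarrow> x \<le> b \<Longrightarrow> \<bar>f' x - g' x\<bar> \<le> h' x"
  shows "\<bar>(f b - f a) - (g b - g a)\<bar> \<le> h b - h a"
proof -
  have "h a - (f a - g a) \<le> h b - (f b - g b)"
  proof (rule DERIV_nonneg_imp_nondecreasing[OF ab])
    fix x assume x: "a \<le> x" "x \<le> b"
    have "((\<lambda>x. h x - (f x - g x)) has_real_derivative h' x - (f' x - g' x)) (at x)"
      by (intro DERIV_diff f g h x)
    then show "\<exists>y. ((\<lambda>x. h x - (f x - g x)) has_real_derivative y) (at x) \<and> 0 \<le> y"
      using le[OF x] by (intro exI[of _ "h' x - (f' x - g' x)"]) auto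
  qed
  moreover have "h a + (f a - g a) \<le> h b + (f b - g b)"
  proof (rule DERIV_nonneg_imp_nondecreasing[OF ab])
    fix x assume x: "a \<le> x" "x \<le> b"
    have "((\<lambda>x. h x + (f x - g x)) has_real_derivative h' x + (f' x - g' x)) (at x)"
      by (intro DERIV_diff DERIV_add f g h x)
    then show "\<exists>y. ((\<lambda>x. h x + (f x - g x)) has_real_derivative y) (at x) \<and> 0 \<le> y"
      using le[OF x] by (intro exI[of _ "h' x + (f' x - g' x)"]) auto
  qed
  ultimately show ?thesis by (simp add: abs_le_iff algebra_simps)
qed

text \<open>
  The term \<open>k e\<^sup>u\<close> of the potential is left out, which makes the integral of the momentum elementary.
\<close>

definition wkb_momentum :: "real \<Rightarrow> real \<Rightarrow> real" where
  "wkb_momentum T u = sqrt (T - exp (2 * u) / 4)"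

text \<open>
  The antiderivative of \<open>wkb_momentum T\<close> that vanishes at the turning point \<open>e\<^sup>u = 2 sqrt T\<close>.
\<close>

definition wkb_phase :: "real \<Rightarrow> real \<Rightarrow> real" where
  "wkb_phase T u = wkb_momentum T u - sqrt T * (ln (2 * (sqrt T + wkb_momentum T u)) - u)"

text \<open>
  An antiderivative of a majorant of \<open>\<bar>S - k e\<^sup>u\<bar> / p\<close>, where \<open>p\<close> is the momentum and \<open>S = z/p\<^sup>2 + (5/4) z\<^sup>2/p\<^sup>4\<close> with \<open>z = e\<^sup>2\<^sup>u/4\<close>
  is the Schwarzian term of the Liouville-Green transformation; \<open>z\<^sup>2\<close> is
  estimated by \<open>T z\<close>. The arcsine is the integral of \<open>e\<^sup>u / p\<close>.
\<close>

definition wkb_error :: "real \<Rightarrow> real \<Rightarrow> real \<Rightarrow> real" where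
  "wkb_error k T u = 1 / wkb_momentum T u + 5 / 12 * T / wkb_momentum T u ^ 3
     + 2 * \<bar>k\<bar> * arcsin (exp u / (2 * sqrt T))"

lemma wkb_derivs:
  assumes T: "T > 0" and u: "exp (2 * u) / 4 < T"
  shows "wkb_momentum T u > 0" "wkb_momentum T u ^ 2 = T - exp (2 * u) / 4"
    "(wkb_momentum T has_real_derivative - (exp (2 * u) / 4) / wkb_momentum T u) (at u)"
    "(wkb_phase T has_real_derivative wkb_momentum T u) (at u)"
    "(wkb_error k T has_real_derivative (exp (2 * u) / 4) / wkb_momentum T u ^ 3
       + 5 / 4 * T * (exp (2 * u) / 4) / wkb_momentum T u ^ 5 + \<bar>k\<bar> * exp u / wkb_momentum T u) (at u)"
proof -
  define p where "p = wkb_momentum T u"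
  define z where "z = exp (2 * u) / 4"
  show p0: "wkb_momentum T u > 0" using u by (simp add: wkb_momentum_def)
  show p2: "wkb_momentum T u ^ 2 = T - exp (2 * u) / 4" using u by (simp add: wkb_momentum_def)
  have pp: "p > 0" "p * p = T - z" using p0 p2 by (simp_all add: p_def z_def power2_eq_square)
  have "((\<lambda>u. T - exp (2 * u) / 4) has_real_derivative - 2 * z) (at u)"
    unfolding z_def by (auto intro!: derivative_eq_intros)
  from DERIV_chain2[OF DERIV_real_sqrt this] u
  have d0: "((\<lambda>u. sqrt (T - exp (2 * u) / 4)) has_real_derivative inverse p / 2 * (- 2 * z)) (at u)"
    unfolding p_def wkb_momentum_def by simp
  have eqf: "wkb_momentum T = (\<lambda>u. sqrt (T - exp (2 * u) / 4))" by (rule ext) (simp add: wkb_momentum_def)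
  have dp: "(wkb_momentum T has_real_derivative - z / p) (at u)"
    unfolding eqf by (rule DERIV_cong[OF d0]) (use pp(1) in \<open>simp add: field_simps\<close>)
  then show "(wkb_momentum T has_real_derivative - (exp (2 * u) / 4) / wkb_momentum T u) (at u)"
    unfolding p_def z_def .
  have sT: "sqrt T > 0" "sqrt T * sqrt T = T" using T by simp_all
  have sp: "sqrt T + p > 0" using pp(1) sT(1) by linarith
  have z_eq: "z = (sqrt T + p) * (sqrt T - p)" using pp sT by (simp add: algebra_simps)
  have "((\<lambda>u. 2 * (sqrt T + wkb_momentum T u)) has_real_derivative 2 * (0 + - z / p)) (at u)"
    by (intro DERIV_cmult DERIV_add DERIV_const dp)
  from DERIV_chain2[OF DERIV_ln this] 
  have dl: "((\<lambda>u. ln (2 * (sqrt T + wkb_momentum T u))) has_real_derivative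
       inverse (2 * (sqrt T + p)) * (2 * (0 + - z / p))) (at u)" using sp by (simp add: p_def)
  have "(wkb_phase T has_real_derivative (- z / p - sqrt T * (inverse (2 * (sqrt T + p)) * (2 * (0 + - z / p)) - 1))) (at u)"
    unfolding wkb_phase_def by (intro DERIV_diff DERIV_cmult dp dl DERIV_ident)
  moreover have "- z / p - sqrt T * (inverse (2 * (sqrt T + p)) * (2 * (0 + - z / p)) - 1) = p"
  proof -
    have e: "inverse (2 * (sqrt T + p)) * (2 * (0 + - z / p)) = - (sqrt T - p) / p"
    proof -
      have "z / (sqrt T + p) = sqrt T - p" using z_eq sp by simp
      then have "- (sqrt T - p) / p = - (z / (sqrt T + p)) / p" by simp
      also have "\<dots> = inverse (2 * (sqrt T + p)) * (2 * (0 + - z / p))"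
      proof -
        have "- (z / D) / p = inverse (2 * D) * (2 * (0 + - z / p))" if "D > 0" for D
          using that pp(1) by (simp add: field_simps)
        then show ?thesis using sp by blast
      qed
      finally show ?thesis by simp
    qed
    have "- z / p - sqrt T * (- (sqrt T - p) / p - 1) = (- z + sqrt T * sqrt T) / p"
      using pp(1) by (simp add: field_simps)
    also have "\<dots> = p" using pp sT by (simp add: field_simps)
    finally show ?thesis unfolding e .
  qed
  ultimately show "(wkb_phase T has_real_derivative wkb_momentum T u) (at u)" by (simp add: p_def)
  have d1: "((\<lambda>u. 1 / wkb_momentum T u) has_real_derivative z / p ^ 3) (at u)"
  proof -
    have "((\<lambda>u. 1 / wkb_momentum T u) has_real_derivative (0 * p - 1 * (- z / p)) / (p * p)) (at u)"
      using pp unfolding p_def by (intro DERIV_divide DERIV_const dp[unfolded p_def]) simp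
    then show ?thesis by (rule DERIV_cong) (use pp in \<open>simp add: field_simps power3_eq_cube\<close>)
  qed
  have d3: "((\<lambda>u. 5 / 12 * T / wkb_momentum T u ^ 3) has_real_derivative 5 / 4 * T * z / p ^ 5) (at u)"
  proof -
    have "((\<lambda>u. 5 / 12 * T / wkb_momentum T u ^ 3) has_real_derivative
        (0 * p ^ 3 - 5 / 12 * T * (of_nat 3 * (- z / p * p ^ (3 - Suc 0)))) / (p ^ 3 * p ^ 3)) (at u)"
      using pp unfolding p_def by (intro DERIV_divide DERIV_const DERIV_power dp[unfolded p_def]) simp
    then show ?thesis by (rule DERIV_cong) (use pp in \<open>simp add: field_simps eval_nat_numeral\<close>)
  qed
  have "exp u * exp u = exp (2 * u)" by (simp flip: exp_add)
  then have x2: "(exp u / 2) ^ 2 = z" by (simp add: z_def power2_eq_square)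
  have lt: "exp u / (2 * sqrt T) < 1"
  proof -
    have "(exp u / 2) ^ 2 < (sqrt T) ^ 2" using x2 u T by (simp add: z_def)
    then have "exp u / 2 < sqrt T" using sT by (meson power_less_imp_less_base less_imp_le)
    then show ?thesis using sT by (simp add: field_simps)
  qed
  have d4: "((\<lambda>u. 2 * \<bar>k\<bar> * arcsin (exp u / (2 * sqrt T))) has_real_derivative \<bar>k\<bar> * exp u / p) (at u)"
  proof -
    have gt: "- 1 < exp u / (2 * sqrt T)"
    proof -
      have "0 \<le> exp u / (2 * sqrt T)" using sT by simp
      then show ?thesis by linarith
    qed
    have "((\<lambda>u. exp u / (2 * sqrt T)) has_real_derivative exp u / (2 * sqrt T)) (at u)"
      by (intro DERIV_cdivide DERIV_exp)
    from DERIV_chain2[OF DERIV_arcsin[OF gt lt] this]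
    have "((\<lambda>u. arcsin (exp u / (2 * sqrt T))) has_real_derivative
       inverse (sqrt (1 - (exp u / (2 * sqrt T))\<^sup>2)) * (exp u / (2 * sqrt T))) (at u)" .
    moreover have "sqrt (1 - (exp u / (2 * sqrt T))\<^sup>2) = p / sqrt T"
    proof -
      have "(exp u / (2 * sqrt T))\<^sup>2 = z / T" using x2 sT T by (simp add: power_divide power_mult_distrib)
      then have "1 - (exp u / (2 * sqrt T))\<^sup>2 = (T - z) / T" using T by (simp add: field_simps)
      then show ?thesis unfolding p_def wkb_momentum_def z_def by (simp add: real_sqrt_divide)
    qed
    ultimately have "((\<lambda>u. arcsin (exp u / (2 * sqrt T))) has_real_derivative
       inverse (p / sqrt T) * (exp u / (2 * sqrt T))) (at u)" by (simp only:)
    then have "((\<lambda>u. arcsin (exp u / (2 * sqrt T))) has_real_derivative exp u / 2 / p) (at u)"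
      by (rule DERIV_cong) (use sT(1) pp(1) in \<open>simp add: field_simps\<close>)
    from DERIV_cmult[OF this, of "2 * \<bar>k\<bar>"] show ?thesis by simp
  qed
  show "(wkb_error k T has_real_derivative (exp (2 * u) / 4) / wkb_momentum T u ^ 3
       + 5 / 4 * T * (exp (2 * u) / 4) / wkb_momentum T u ^ 5 + \<bar>k\<bar> * exp u / wkb_momentum T u) (at u)"
    using DERIV_add[OF DERIV_add[OF d1 d3] d4] unfolding wkb_error_def[abs_def] p_def z_def .
qed

text \<open>
  The curve \<open>(p \<psi>, \<psi>' + (p'/2p) \<psi>)\<close> is, up to a common positive factor, that of the transformed solution \<open>g = p\<^sup>1\<^sup>/\<^sup>2 \<psi>\<close>
  and its derivative with respect to \<open>\<tau>\<close>, where \<open>d\<tau> = p du\<close>. That solution satisfies \<open>g'' = -(1 + (S - k e\<^sup>u)/p\<^sup>2) g\<close>, so the angle of the curve moves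
  with speed \<open>p\<close> up to \<open>\<bar>S - k e\<^sup>u\<bar> / p\<close>. The zeros of the first coordinate are those of \<open>\<psi>\<close>.
\<close>

lemma wkb_region_estimate:
  assumes T: "T > 0" and u: "u0 \<le> u1" "exp (2 * u1) / 4 < T"
    and l: "polar_lift \<theta> (psi k T) (psi' k T) UNIV"
  shows "\<bar>(\<theta> u1 - \<theta> u0) - (wkb_phase T u1 - wkb_phase T u0)\<bar> \<le> wkb_error k T u1 - wkb_error k T u0 + 2 * pi"
proof -
  let ?p = "wkb_momentum T" and ?y = "psi k T" and ?y' = "psi' k T"
  define S where "S = {u. exp (2 * u) / 4 < T}"
  have Seq: "S = {..< ln (4 * T) / 2}"
  proof -
    have "exp (2 * v) / 4 < T \<longleftrightarrow> v < ln (4 * T) / 2" for v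
    proof -
      have "exp (2 * v) / 4 < T \<longleftrightarrow> exp (2 * v) < exp (ln (4 * T))" using T by auto
      also have "\<dots> \<longleftrightarrow> v < ln (4 * T) / 2" by (simp only: exp_less_cancel_iff) linarith
      finally show ?thesis .
    qed
    then show ?thesis unfolding S_def lessThan_def by simp
  qed
  have S: "open S" "convex S" "connected S" unfolding Seq by (auto intro: convex_connected)
  have S0: "v \<in> S" if "v \<le> u1" for v
  proof -
    have "exp (2 * v) \<le> exp (2 * u1)" using that by simp
    then have "exp (2 * v) / 4 < T" using u(2) by linarith
    then show ?thesis by (simp add: S_def)
  qed
  define z where "z = (\<lambda>u::real. exp (2 * u) / 4)"
  define q where "q = (\<lambda>u. T - z u)"
  \<comment> \<open>This is \<open>- p' / (2 p)\<close>.\<close>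
  define l' where "l' = (\<lambda>u. z u / (2 * q u))"
  define a where "a = (\<lambda>u. ?p u * ?y u)"
  define b where "b = (\<lambda>u. ?y' u - l' u * ?y u)"
  have dz: "(z has_real_derivative 2 * z v) (at v)" for v
    unfolding z_def by (auto intro!: derivative_eq_intros)
  have dq: "(q has_real_derivative - 2 * z v) (at v)" for v
    unfolding q_def using DERIV_diff[OF DERIV_const[of T] dz] by simp
  have qpos: "q v > 0" if "v \<in> S" for v using that by (simp add: S_def q_def z_def)
  have pS: "?p v > 0" "?p v ^ 2 = q v" "(?p has_real_derivative - z v / ?p v) (at v)"
    "(wkb_phase T has_real_derivative ?p v) (at v)"
    "(wkb_error k T has_real_derivative z v / ?p v ^ 3 + 5 / 4 * T * z v / ?p v ^ 5 + \<bar>k\<bar> * exp v / ?p v) (at v)"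
    if "v \<in> S" for v
    using wkb_derivs[OF T, of v] that unfolding S_def q_def z_def by auto
  have dl: "(l' has_real_derivative z v / q v + z v ^ 2 / q v ^ 2) (at v)" if "v \<in> S" for v
  proof -
    have "(l' has_real_derivative (2 * z v * (2 * q v) - z v * (2 * (- 2 * z v))) / (2 * q v * (2 * q v))) (at v)"
      unfolding l'_def using qpos[OF that] by (intro DERIV_divide dz DERIV_cmult dq) simp
    then show ?thesis by (rule DERIV_cong) (use qpos[OF that] in \<open>simp add: field_simps power2_eq_square\<close>)
  qed
  have da: "(a has_real_derivative - z v / ?p v * ?y v + ?y' v * ?p v) (at v)" if "v \<in> S" for v
    unfolding a_def by (intro DERIV_mult pS(3) psi_deriv that)
  have db: "(b has_real_derivative (morse_potential k v - T) * ?y v - ((z v / q v + z v ^ 2 / q v ^ 2) * ?y v + ?y' v * l' v)) (at v)"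
    if "v \<in> S" for v
    unfolding b_def by (intro DERIV_diff DERIV_mult dl psi_deriv psi'_deriv that)
  have nz: "a v \<noteq> 0 \<or> b v \<noteq> 0" if "v \<in> S" for v
    using psi_nonvanishing[of k T v] pS(1)[OF that] unfolding a_def b_def by auto
  obtain \<phi> where \<phi>: "polar_lift \<phi> a b S"
    by (rule polar_lift_exists[OF S(2), of a b])
      (use nz in \<open>auto intro!: DERIV_continuous_on[OF has_field_derivative_at_within] da db\<close>)
  define R where "R = (\<lambda>v. z v / q v + 5 / 4 * z v ^ 2 / q v ^ 2 - k * exp v)"
  have d\<phi>: "(\<phi> has_real_derivative ?p v + R v / ?p v * (a v ^ 2 / (a v ^ 2 + b v ^ 2))) (at v)" if v: "v \<in> S" for v
  proof -
    have pos: "a v ^ 2 + b v ^ 2 > 0" using nz[OF v] by (simp add: sum_power2_gt_zero_iff)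
    have p: "?p v > 0" "q v = ?p v ^ 2" using pS[OF v] by auto
    have V: "morse_potential k v = z v + k * exp v" by (simp add: morse_potential_def z_def)
    have Tq: "T = q v + z v" by (simp add: q_def)
    have quot: "(A * n + B * m) / n = A + B * (m / n)" if "n > 0" for A B m n :: real
      using that by (simp add: add_divide_distrib)
    have num: "(- z v / ?p v * ?y v + ?y' v * ?p v) * b v
       - a v * ((morse_potential k v - T) * ?y v - ((z v / q v + z v ^ 2 / q v ^ 2) * ?y v + ?y' v * l' v))
       = ?p v * (a v ^ 2 + b v ^ 2) + R v / ?p v * a v ^ 2"
    proof -
      have "- z v / ?p v = - 2 * l' v * ?p v" unfolding l'_def p(2) using p(1) by (simp add: field_simps power2_eq_square)
      moreover have "(- 2 * l' v * ?p v * ?y v + ?y' v * ?p v) * b v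
       - a v * ((morse_potential k v - T) * ?y v - ((z v / q v + z v ^ 2 / q v ^ 2) * ?y v + ?y' v * l' v))
       = ?p v * (b v ^ 2 + (q v - k * exp v + (z v / q v + z v ^ 2 / q v ^ 2) + l' v ^ 2) * ?y v ^ 2)"
        unfolding a_def b_def V Tq by (simp add: algebra_simps power2_eq_square)
      moreover have "l' v ^ 2 = 1 / 4 * z v ^ 2 / q v ^ 2" unfolding l'_def by (simp add: power_divide power_mult_distrib)
      moreover have "?p v * (b v ^ 2 + (q v - k * exp v + (z v / q v + z v ^ 2 / q v ^ 2) + 1 / 4 * z v ^ 2 / q v ^ 2) * ?y v ^ 2)
         = ?p v * (b v ^ 2 + (q v + R v) * ?y v ^ 2)"
        unfolding R_def by (simp add: algebra_simps)
      moreover have "\<dots> = ?p v * (a v ^ 2 + b v ^ 2) + R v / ?p v * a v ^ 2"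
        unfolding a_def p(2) using p(1) by (simp add: field_simps power2_eq_square)
      ultimately show ?thesis by simp
    qed
    have "((- z v / ?p v * ?y v + ?y' v * ?p v) * b v
       - a v * ((morse_potential k v - T) * ?y v - ((z v / q v + z v ^ 2 / q v ^ 2) * ?y v + ?y' v * l' v))) / (a v ^ 2 + b v ^ 2)
      = ?p v + R v / ?p v * (a v ^ 2 / (a v ^ 2 + b v ^ 2))"
      unfolding num by (rule quot[OF pos])
    then show ?thesis using polar_lift_deriv[OF \<phi> S(1) v da[OF v] db[OF v]] by simp
  qed
  have "\<bar>(\<phi> u1 - \<phi> u0) - (wkb_phase T u1 - wkb_phase T u0)\<bar> \<le> wkb_error k T u1 - wkb_error k T u0"
  proof (rule increment_bound[OF u(1)])
    fix v assume "u0 \<le> v" "v \<le> u1"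
    then have v: "v \<in> S" using S0 by blast
    show "(\<phi> has_real_derivative ?p v + R v / ?p v * (a v ^ 2 / (a v ^ 2 + b v ^ 2))) (at v)" by (rule d\<phi>[OF v])
    show "(wkb_phase T has_real_derivative ?p v) (at v)" by (rule pS(4)[OF v])
    show "(wkb_error k T has_real_derivative z v / ?p v ^ 3 + 5 / 4 * T * z v / ?p v ^ 5 + \<bar>k\<bar> * exp v / ?p v) (at v)"
      by (rule pS(5)[OF v])
    have p: "?p v > 0" "q v = ?p v ^ 2" using pS[OF v] by auto
    have z: "0 \<le> z v" "z v \<le> T" using qpos[OF v] by (auto simp: z_def q_def)
    have t: "0 \<le> a v ^ 2 / (a v ^ 2 + b v ^ 2)" "a v ^ 2 / (a v ^ 2 + b v ^ 2) \<le> 1"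
      using nz[OF v] by (auto simp: divide_le_eq sum_power2_gt_zero_iff sum_power2_ge_zero)
    have "\<bar>R v\<bar> \<le> z v / q v + 5 / 4 * T * z v / q v ^ 2 + \<bar>k\<bar> * exp v"
    proof -
      have "z v ^ 2 \<le> T * z v" unfolding power2_eq_square using z by (intro mult_right_mono) auto
      then have "5 / 4 * z v ^ 2 / q v ^ 2 \<le> 5 / 4 * T * z v / q v ^ 2"
        by (intro divide_right_mono) auto
      moreover have "z v / q v \<ge> 0" "5 / 4 * z v ^ 2 / q v ^ 2 \<ge> 0" using z qpos[OF v] by auto
      moreover have "\<bar>k * exp v\<bar> = \<bar>k\<bar> * exp v" by (simp add: abs_mult)
      ultimately show ?thesis unfolding R_def by linarith
    qed
    then have "\<bar>R v\<bar> / ?p v \<le> (z v / q v + 5 / 4 * T * z v / q v ^ 2 + \<bar>k\<bar> * exp v) / ?p v"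
      using p by (intro divide_right_mono) auto
    also have "\<dots> = z v / ?p v ^ 3 + 5 / 4 * T * z v / ?p v ^ 5 + \<bar>k\<bar> * exp v / ?p v"
      unfolding p(2) using p(1) by (simp add: field_simps eval_nat_numeral)
    finally have "\<bar>R v\<bar> / ?p v \<le> z v / ?p v ^ 3 + 5 / 4 * T * z v / ?p v ^ 5 + \<bar>k\<bar> * exp v / ?p v" .
    moreover have "\<bar>R v / ?p v * (a v ^ 2 / (a v ^ 2 + b v ^ 2))\<bar> \<le> \<bar>R v\<bar> / ?p v * 1"
      unfolding abs_mult using t p by (intro mult_mono) auto
    ultimately show "\<bar>?p v + R v / ?p v * (a v ^ 2 / (a v ^ 2 + b v ^ 2)) - ?p v\<bar>
       \<le> z v / ?p v ^ 3 + 5 / 4 * T * z v / ?p v ^ 5 + \<bar>k\<bar> * exp v / ?p v" by simp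
  qed
  moreover have "\<bar>(\<theta> u1 - \<theta> u0) - (\<phi> u1 - \<phi> u0)\<bar> < 2 * pi"
  proof (rule polar_lift_compare[OF _ \<phi> S(3)])
    show "polar_lift \<theta> ?y ?y' S" using l continuous_on_subset unfolding polar_lift_def by blast
    show "sgn (?y v) = sgn (a v)" if "v \<in> S" for v using pS(1)[OF that] by (simp add: a_def sgn_mult)
    show "sgn (?y' v) = sgn (b v)" if "?y v = 0" for v using that by (simp add: b_def)
  qed (use S0 u in auto)
  ultimately show ?thesis by linarith
qed

text \<open>
  The scaling factor \<open>\<kappa>\<close> balances the two terms of the angular speed of \<open>(\<kappa> \<psi>, \<psi>')\<close>.
\<close>

lemma bounded_rotation:
  assumes K: "\<kappa> > 0" and u: "u1 \<le> u2" and M: "\<And>u. u1 \<le> u \<Longrightarrow> u \<le> u2 \<Longrightarrow> \<bar>T - morse_potential k u\<bar> \<le> M"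
    and l: "polar_lift \<theta> (psi k T) (psi' k T) UNIV"
  shows "\<bar>\<theta> u2 - \<theta> u1\<bar> \<le> (\<kappa> + M / \<kappa>) * (u2 - u1) + 2 * pi"
proof -
  let ?y = "psi k T" and ?y' = "psi' k T"
  define a where "a = (\<lambda>u. \<kappa> * ?y u)"
  have da: "(a has_real_derivative \<kappa> * ?y' v) (at v)" for v unfolding a_def by (intro DERIV_cmult psi_deriv)
  have nz: "a v \<noteq> 0 \<or> ?y' v \<noteq> 0" for v using psi_nonvanishing[of k T v] K by (auto simp: a_def)
  obtain \<phi> where \<phi>: "polar_lift \<phi> a ?y' UNIV"
    by (rule polar_lift_exists[OF convex_UNIV, of a ?y'])
      (use nz in \<open>auto intro!: DERIV_continuous_on[OF has_field_derivative_at_within] da psi'_deriv\<close>)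
  define d where "d = (\<lambda>v. (\<kappa> * ?y' v * ?y' v - a v * ((morse_potential k v - T) * ?y v)) / (a v ^ 2 + ?y' v ^ 2))"
  have d\<phi>: "(\<phi> has_real_derivative d v) (at v)" for v
    unfolding d_def by (rule polar_lift_deriv[OF \<phi> open_UNIV UNIV_I da psi'_deriv])
  have "\<bar>(\<phi> u2 - \<phi> u1) - (0 - 0)\<bar> \<le> (\<kappa> + M / \<kappa>) * u2 - (\<kappa> + M / \<kappa>) * u1"
  proof (rule increment_bound[OF u])
    fix v assume v: "u1 \<le> v" "v \<le> u2"
    show "(\<phi> has_real_derivative d v) (at v)" by (rule d\<phi>)
    show "((\<lambda>v. 0) has_real_derivative 0) (at v)" by (rule DERIV_const)
    show "((\<lambda>v. (\<kappa> + M / \<kappa>) * v) has_real_derivative (\<kappa> + M / \<kappa>)) (at v)" by (rule DERIV_cmult_Id)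
    have pos: "a v ^ 2 + ?y' v ^ 2 > 0" using nz[of v] by (simp add: sum_power2_gt_zero_iff)
    have "\<kappa> * ?y' v * ?y' v - a v * ((morse_potential k v - T) * ?y v) = \<kappa> * ?y' v ^ 2 + (T - morse_potential k v) / \<kappa> * a v ^ 2"
      unfolding a_def using K by (simp add: field_simps power2_eq_square)
    also have "\<bar>\<dots>\<bar> \<le> \<bar>\<kappa> * ?y' v ^ 2\<bar> + \<bar>(T - morse_potential k v) / \<kappa> * a v ^ 2\<bar>" by (rule abs_triangle_ineq)
    also have "\<dots> = \<kappa> * ?y' v ^ 2 + \<bar>T - morse_potential k v\<bar> / \<kappa> * a v ^ 2" using K by (simp add: abs_mult)
    also have "\<dots> \<le> \<kappa> * ?y' v ^ 2 + M / \<kappa> * a v ^ 2"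
      using K M[OF v] by (intro add_left_mono mult_right_mono divide_right_mono) auto
    also have "\<dots> \<le> (\<kappa> + M / \<kappa>) * (a v ^ 2 + ?y' v ^ 2)"
    proof -
      have "M \<ge> 0" using M[OF v] by linarith
      then have "0 \<le> \<kappa> * a v ^ 2 + M / \<kappa> * ?y' v ^ 2" using K by simp
      then show ?thesis by (simp add: algebra_simps)
    qed
    finally have "\<bar>\<kappa> * ?y' v * ?y' v - a v * ((morse_potential k v - T) * ?y v)\<bar> / (a v ^ 2 + ?y' v ^ 2) \<le> \<kappa> + M / \<kappa>"
      using pos by (simp add: pos_divide_le_eq)
    then show "\<bar>d v - 0\<bar> \<le> \<kappa> + M / \<kappa>" unfolding d_def using pos by (simp add: abs_divide)
  qed
  moreover have "\<bar>(\<theta> u2 - \<theta> u1) - (\<phi> u2 - \<phi> u1)\<bar> < 2 * pi"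
    by (rule polar_lift_compare[OF l \<phi> connected_UNIV]) (use K in \<open>auto simp: a_def sgn_mult\<close>)
  moreover have "(\<kappa> + M / \<kappa>) * u2 - (\<kappa> + M / \<kappa>) * u1 = (\<kappa> + M / \<kappa>) * (u2 - u1)"
    by (simp only: right_diff_distrib)
  ultimately show ?thesis by linarith
qed

text \<open>
  Where \<open>V \<ge> T\<close> the product \<open>\<psi> \<psi>'\<close> increases to its limit \<open>0\<close>, so \<open>\<psi>\<^sup>2\<close> is decreasing there.
  A zero of \<open>\<psi>\<close> would persist to infinity.
\<close>

lemma no_rotation_beyond_turning_point:
  assumes V: "\<And>u. u \<ge> u2 \<Longrightarrow> morse_potential k u \<ge> T"
    and l: "polar_lift \<theta> (psi k T) (psi' k T) UNIV"
    and inf: "\<exists>b. \<forall>u\<ge>b. 0 < psi k T u \<and> 0 < \<theta> u \<and> \<theta> u < pi"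
  shows "0 < \<theta> u2 \<and> \<theta> u2 < pi"
proof -
  let ?y = "psi k T" and ?y' = "psi' k T"
  obtain b where b: "\<And>u. u \<ge> b \<Longrightarrow> 0 < ?y u \<and> 0 < \<theta> u \<and> \<theta> u < pi" using inf by blast
  define c where "c = max b u2"
  have yy': "?y u * ?y' u \<le> 0" if "u \<ge> u2" for u
  proof -
    have mono: "?y u * ?y' u \<le> ?y v * ?y' v" if "u \<le> v" for v
    proof (rule DERIV_nonneg_imp_nondecreasing[OF that])
      fix t assume t: "u \<le> t" "t \<le> v"
      have "((\<lambda>u. ?y u * ?y' u) has_real_derivative ?y' t * ?y' t + (morse_potential k t - T) * ?y t * ?y t) (at t)"
        by (intro DERIV_mult psi_deriv psi'_deriv)
      moreover have "0 \<le> ?y' t * ?y' t + (morse_potential k t - T) * ?y t * ?y t"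
        using V[of t] t \<open>u \<ge> u2\<close> by (simp add: mult.assoc)
      ultimately show "\<exists>d. ((\<lambda>u. ?y u * ?y' u) has_real_derivative d) (at t) \<and> 0 \<le> d" by blast
    qed
    have "((\<lambda>v. ?y v * ?y' v) \<longlongrightarrow> 0 * 0) at_top"
      by (intro tendsto_mult exp_decaying_tendsto psi_exp_decaying psi'_exp_decaying)
    then have "?y u * ?y' u \<le> 0 * 0"
      by (rule tendsto_lowerbound) (rule eventually_mono[OF eventually_ge_at_top[of u] mono], simp_all)
    then show ?thesis by simp
  qed
  have sq: "?y c ^ 2 \<le> ?y u ^ 2" if "u \<ge> u2" "u \<le> c" for u
  proof -
    have "- (?y u ^ 2) \<le> - (?y c ^ 2)"
    proof (rule DERIV_nonneg_imp_nondecreasing[OF that(2)])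
      fix t assume t: "u \<le> t" "t \<le> c"
      have "((\<lambda>u. - (?y u ^ 2)) has_real_derivative - (of_nat 2 * (?y' t * ?y t ^ (2 - Suc 0)))) (at t)"
        by (intro DERIV_minus DERIV_power psi_deriv)
      then have "((\<lambda>u. - (?y u ^ 2)) has_real_derivative - 2 * (?y t * ?y' t)) (at t)"
        by (rule DERIV_cong) simp
      moreover have "0 \<le> - 2 * (?y t * ?y' t)" using yy'[of t] t that by simp
      ultimately show "\<exists>d. ((\<lambda>u. - (?y u ^ 2)) has_real_derivative d) (at t) \<and> 0 \<le> d" by blast
    qed
    then show ?thesis by simp
  qed
  have yc: "?y c > 0" using b by (simp add: c_def)
  have nz: "?y u \<noteq> 0" if "u \<ge> u2" for u
  proof (cases "u \<le> c")
    case True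
    have "?y c ^ 2 > 0" using yc by simp
    then have "?y u ^ 2 > 0" using sq[OF that True] by linarith
    then show ?thesis by auto
  next
    case False
    then have "b \<le> u" unfolding c_def by linarith
    then show ?thesis using b[of u] by simp
  qed
  have cy: "continuous_on A ?y" for A by (rule DERIV_continuous_on[OF has_field_derivative_at_within[OF psi_deriv]])
  have pos: "?y u > 0" if "u \<ge> u2" for u
  proof (rule ccontr)
    assume "\<not> ?y u > 0"
    then have n: "?y u < 0" using nz[OF that] by simp
    then have "u < c" using b[of u] yc by (force simp: c_def)
    then obtain v where "u \<le> v" "v \<le> c" "?y v = 0"
      using IVT'[of ?y u 0 c] n yc cy by auto
    then show False using nz[of v] that by simp
  qed
  have "0 < \<theta> u2 \<and> \<theta> u2 < pi"
  proof (rule lift_stays_in_upper_half[of "{u2..}" \<theta> c])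
    show "continuous_on {u2..} \<theta>" using polar_liftD(1)[OF l] continuous_on_subset by blast
    show "connected {u2..}" by (rule connected_Ici)
    show "sin (\<theta> u) > 0" if u: "u \<in> {u2..}" for u
    proof -
      obtain r where "r > 0" "?y u = r * sin (\<theta> u)" using polar_liftD(2)[OF l, of u] by auto
      then show ?thesis using pos[of u] u by (simp add: zero_less_mult_iff)
    qed
  qed (use b[of c] in \<open>auto simp: c_def\<close>)
  then show ?thesis .
qed

section \<open>Counting eigenvalues\<close>

text \<open>
  The main term of the count, multiplied by \<open>\<pi>\<close>.
\<close>

definition weyl_main_term :: "real \<Rightarrow> real \<Rightarrow> real" where
  "weyl_main_term u0 T = sqrt T * ln (sqrt T) + (2 * ln 2 - 1 - u0) * sqrt T"

lemma wkb_phase_left_endpoint: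
  "((\<lambda>T. wkb_phase T u0 + weyl_main_term u0 T) \<longlongrightarrow> 0) at_top"
proof -
  define c where "c = exp (2 * u0) / 4"
  have c: "c > 0" by (simp add: c_def)
  have lim: "((\<lambda>T. sqrt (T - c) - sqrt T - sqrt T * ln ((sqrt T + sqrt (T - c)) / (2 * sqrt T))) \<longlongrightarrow> 0) at_top"
    using c by real_asymp
  have "\<forall>\<^sub>F T in at_top. sqrt (T - c) - sqrt T - sqrt T * ln ((sqrt T + sqrt (T - c)) / (2 * sqrt T))
      = wkb_phase T u0 + weyl_main_term u0 T"
    using eventually_gt_at_top[of c]
  proof eventually_elim
    case (elim T)
    have T: "T > 0" "T - c > 0" using elim c by auto
    have s: "sqrt T > 0" "sqrt T + sqrt (T - c) > 0" using T by (simp_all add: add_pos_pos)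
    have "ln (A / (2 * B)) = ln (2 * A) - (2 * ln 2 + ln B)" if "A > 0" "B > 0" for A B :: real
      using that by (simp add: ln_divide_pos ln_mult_pos)
    from this[OF s(2,1)]
    have l: "ln ((sqrt T + sqrt (T - c)) / (2 * sqrt T)) = ln (2 * (sqrt T + sqrt (T - c))) - (2 * ln 2 + ln (sqrt T))" .
    show ?case unfolding l wkb_phase_def wkb_momentum_def weyl_main_term_def c_def[symmetric]
      by (simp add: algebra_simps)
  qed
  from Lim_transform_eventually[OF lim this] show ?thesis .
qed

text \<open>
  The phase at the point where the momentum equals \<open>T\<^sup>1\<^sup>/\<^sup>3\<close>. It is bounded because
  the momentum stays below this value on the rest of the way to the turning point, whose length is \<open>O(T\<^sup>-\<^sup>1\<^sup>/\<^sup>3)\<close>.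
\<close>

lemma wkb_phase_right_endpoint:
  "((\<lambda>T::real. T powr (1/3) - sqrt T * (ln (2 * (sqrt T + T powr (1/3))) - ln (2 * sqrt (T - (T powr (1/3))^2)))) \<longlongrightarrow> - 1 / 3) at_top"
  by real_asymp

lemma turning_region_length:
  fixes c :: real
  shows "\<forall>\<^sub>F T in at_top. T powr (1/3) * (ln (2 * sqrt T + 4 * c) - ln (2 * sqrt (T - (T powr (1/3))^2))) \<le> 1"
proof -
  have "((\<lambda>T::real. T powr (1/3) * (ln (2 * sqrt T + 4 * c) - ln (2 * sqrt (T - (T powr (1/3))^2)))) \<longlongrightarrow> 1/2) at_top"
    by real_asymp
  from order_tendstoD(2)[OF this, of 1] show ?thesis by (auto elim: eventually_mono)
qed

text \<open>
  The half-line is cut at \<open>u1\<close>, where the momentum has dropped to \<open>T\<^sup>1\<^sup>/\<^sup>3\<close>, and at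
  \<open>u2 = ln (2 sqrt T + 4 \<bar>k\<bar>)\<close>, beyond which \<open>V \<ge> T\<close> for either sign of \<open>k\<close>. The exponent \<open>1/3\<close> is the one for which both
  \<open>wkb_error\<close> at \<open>u1\<close> (of order \<open>T / p\<^sup>3\<close>) and the rotation between \<open>u1\<close> and \<open>u2\<close> are bounded.
\<close>

lemma pruefer_angle_asymptotics:
  "\<exists>C. \<forall>\<^sub>F T in at_top. \<forall>\<theta>. polar_lift \<theta> (psi k T) (psi' k T) UNIV \<longrightarrow>
     (\<exists>b. \<forall>u\<ge>b. 0 < psi k T u \<and> 0 < \<theta> u \<and> \<theta> u < pi) \<longrightarrow>
     \<bar>\<theta> u0 + weyl_main_term u0 T\<bar> \<le> C"
proof -
  define A where "A = 2 + 6 * \<bar>k\<bar> + 8 * k^2"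
  define C where "C = pi + (A + 2 * pi) + (17 / 12 + pi * \<bar>k\<bar> + 2 * pi) + 1 + 1"
  have ev1: "\<forall>\<^sub>F T in at_top. \<bar>wkb_phase T u0 + weyl_main_term u0 T\<bar> < 1"
    using tendsto_rabs_zero[OF wkb_phase_left_endpoint] by (rule order_tendstoD) simp
  have ev2: "\<forall>\<^sub>F T::real in at_top. \<bar>T powr (1/3) - sqrt T * (ln (2 * (sqrt T + T powr (1/3))) - ln (2 * sqrt (T - (T powr (1/3))^2)))\<bar> < 1"
    using tendsto_rabs[OF wkb_phase_right_endpoint] by (rule order_tendstoD) simp
  have ev3: "\<forall>\<^sub>F T::real in at_top. exp u0 \<le> 2 * sqrt (T - (T powr (1/3))^2)" by real_asymp
  have ev4: "\<forall>\<^sub>F T::real in at_top. (T powr (1/3))^2 < T" by real_asymp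
  have "\<forall>\<^sub>F T in at_top. \<forall>\<theta>. polar_lift \<theta> (psi k T) (psi' k T) UNIV \<longrightarrow>
     (\<exists>b. \<forall>u\<ge>b. 0 < psi k T u \<and> 0 < \<theta> u \<and> \<theta> u < pi) \<longrightarrow>
     \<bar>\<theta> u0 + weyl_main_term u0 T\<bar> \<le> C"
    using ev1 ev2 ev3 ev4 turning_region_length[of "\<bar>k\<bar>"] eventually_ge_at_top[of 1]
  proof eventually_elim
    case (elim T)
    define q where "q = T powr (1/3)"
    have T: "T \<ge> 1" "T > 0" using elim by auto
    have q1: "q \<ge> 1" unfolding q_def using T by (simp add: ge_one_powr_ge_zero)
    have q3: "q ^ 3 = T" unfolding q_def using T by (simp add: powr_power)
    have q2: "q ^ 2 < T" using elim unfolding q_def by simp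
    have sT: "sqrt T \<le> q ^ 2"
    proof (rule real_le_lsqrt)
      have "q ^ 3 \<le> q ^ 4" using q1 by (intro power_increasing) auto
      then show "T \<le> (q ^ 2)^2" using q3 by simp
    qed (use T in auto)
    define u1 where "u1 = ln (2 * sqrt (T - q ^ 2))"
    define u2 where "u2 = ln (2 * sqrt T + 4 * \<bar>k\<bar>)"
    have r: "sqrt (T - q ^ 2) > 0" using q2 by simp
    have x1: "exp u1 = 2 * sqrt (T - q ^ 2)" unfolding u1_def using r by simp
    have sTp: "sqrt T > 0" using T by simp
    have x2: "exp u2 = 2 * sqrt T + 4 * \<bar>k\<bar>" unfolding u2_def using sTp by (intro exp_ln) (auto intro: add_pos_nonneg)
    have e2: "exp (2 * u) = exp u ^ 2" for u :: real by (simp add: exp_double)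
    have z1: "exp (2 * u1) / 4 = T - q ^ 2" unfolding e2 x1 using q2 by (simp add: power_mult_distrib)
    have p1: "wkb_momentum T u1 = q" unfolding wkb_momentum_def z1 using q1 by simp
    have "exp u0 \<le> exp u1" unfolding x1 using elim(3) unfolding q_def .
    then have u01: "u0 \<le> u1" by simp
    have u12: "u1 \<le> u2"
    proof -
      have "sqrt (T - q ^ 2) \<le> sqrt T" by simp
      then have "exp u1 \<le> exp u2" unfolding x1 x2 by linarith
      then show ?thesis by simp
    qed
    have len: "q * (u2 - u1) \<le> 1" using elim(5) unfolding u1_def u2_def q_def .
    have ph1: "\<bar>wkb_phase T u1\<bar> < 1" using elim(2) unfolding wkb_phase_def p1 unfolding u1_def q_def .
    have err1: "wkb_error k T u1 \<le> 17 / 12 + pi * \<bar>k\<bar>"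
    proof -
      have "1 / q \<le> 1" using q1 by simp
      moreover have "5 / 12 * T / q ^ 3 = 5 / 12" unfolding q3 using T by simp
      moreover have "2 * \<bar>k\<bar> * arcsin (exp u1 / (2 * sqrt T)) \<le> 2 * \<bar>k\<bar> * (pi / 2)"
      proof (rule mult_left_mono)
        have "sqrt (T - q ^ 2) \<le> sqrt T" by simp
        then have "exp u1 / (2 * sqrt T) \<le> 1" unfolding x1 using sTp by simp
        moreover have "0 \<le> exp u1 / (2 * sqrt T)" using sTp by simp
        ultimately show "arcsin (exp u1 / (2 * sqrt T)) \<le> pi / 2" by (intro arcsin_ubound) linarith+
      qed simp
      moreover have "2 * \<bar>k\<bar> * (pi / 2) = pi * \<bar>k\<bar>" by simp
      ultimately show ?thesis unfolding wkb_error_def p1 by linarith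
    qed
    have z0: "exp (2 * u0) / 4 < T"
    proof -
      have "exp (2 * u0) \<le> exp (2 * u1)" using u01 by simp
      moreover have "q ^ 2 > 0" using q1 by simp
      ultimately show ?thesis using z1 by linarith
    qed
    have err0: "wkb_error k T u0 \<ge> 0"
    proof -
      have p0: "wkb_momentum T u0 > 0" using z0 by (simp add: wkb_momentum_def)
      have "exp u0 \<le> exp u1" using u01 by simp
      moreover have "sqrt (T - q ^ 2) \<le> sqrt T" by simp
      ultimately have "exp u0 \<le> 2 * sqrt T" unfolding x1 by linarith
      then have "exp u0 / (2 * sqrt T) \<le> 1" using sTp by simp
      moreover have "0 \<le> exp u0 / (2 * sqrt T)" using sTp by simp
      ultimately have "0 \<le> arcsin (exp u0 / (2 * sqrt T))" by (intro arcsin_nonneg) auto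
      then show ?thesis unfolding wkb_error_def using p0 T by simp
    qed
    show ?case
    proof (intro allI impI)
      fix \<theta> assume l: "polar_lift \<theta> (psi k T) (psi' k T) UNIV"
        and inf: "\<exists>b. \<forall>u\<ge>b. 0 < psi k T u \<and> 0 < \<theta> u \<and> \<theta> u < pi"
      have s3: "0 < \<theta> u2 \<and> \<theta> u2 < pi"
      proof (rule no_rotation_beyond_turning_point[OF _ l inf])
        fix u assume "u \<ge> u2"
        then have x: "exp u \<ge> 2 * sqrt T + 4 * \<bar>k\<bar>" using x2 by (metis exp_le_cancel_iff)
        then have "sqrt T / 2 \<le> exp u / 4 + k" by linarith
        moreover have "2 * sqrt T \<le> exp u" using x by linarith
        moreover have nn: "0 \<le> exp u / 4 + k" using calculation(1) sTp by linarith
        ultimately have "(sqrt T / 2) * (2 * sqrt T) \<le> (exp u / 4 + k) * exp u"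
          using sTp nn by (intro mult_mono) linarith+
        then show "T \<le> morse_potential k u" using T unfolding morse_potential_def e2
          by (simp add: power2_eq_square algebra_simps)
      qed
      have s2: "\<bar>\<theta> u2 - \<theta> u1\<bar> \<le> A + 2 * pi"
      proof -
        define M where "M = q ^ 2 + 6 * \<bar>k\<bar> * sqrt T + 8 * k ^ 2"
        have M: "\<bar>T - morse_potential k u\<bar> \<le> M" if "u1 \<le> u" "u \<le> u2" for u
        proof -
          have x: "2 * sqrt (T - q ^ 2) \<le> exp u" "exp u \<le> 2 * sqrt T + 4 * \<bar>k\<bar>"
            using that by (metis x1 exp_le_cancel_iff, metis x2 exp_le_cancel_iff)
          have lo: "T - q ^ 2 \<le> exp u ^ 2 / 4"
            using power_mono[OF x(1), of 2] q2 r by (simp add: power_mult_distrib)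
          have "exp u ^ 2 \<le> (2 * sqrt T + 4 * \<bar>k\<bar>) ^ 2" using x(2) by (intro power_mono) auto
          also have "\<dots> = 4 * sqrt T ^ 2 + 16 * \<bar>k\<bar> * sqrt T + 16 * \<bar>k\<bar> ^ 2"
            by (simp only: power2_eq_square algebra_simps)
          also have "\<dots> = 4 * T + 16 * \<bar>k\<bar> * sqrt T + 16 * k ^ 2" using T by simp
          finally have hi: "exp u ^ 2 / 4 \<le> T + 4 * \<bar>k\<bar> * sqrt T + 4 * k ^ 2" by simp
          have "\<bar>k\<bar> * exp u \<le> \<bar>k\<bar> * (2 * sqrt T + 4 * \<bar>k\<bar>)" using x(2) by (intro mult_left_mono) auto
          also have "\<dots> = 2 * \<bar>k\<bar> * sqrt T + 4 * k ^ 2" by (simp add: power2_eq_square algebra_simps)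
          finally have kx: "\<bar>k * exp u\<bar> \<le> 2 * \<bar>k\<bar> * sqrt T + 4 * k ^ 2" by (simp add: abs_mult)
          have nn: "0 \<le> \<bar>k\<bar> * sqrt T" "0 \<le> k ^ 2" "0 \<le> q ^ 2" using sTp by auto
          have "morse_potential k u = exp u ^ 2 / 4 + k * exp u" unfolding morse_potential_def e2 by simp
          then show ?thesis using lo hi kx nn unfolding M_def abs_le_iff by linarith
        qed
        have "q > 0" using q1 by simp
        from bounded_rotation[OF this u12 M l]
        have "\<bar>\<theta> u2 - \<theta> u1\<bar> \<le> (q + M / q) * (u2 - u1) + 2 * pi" .
        also have "(q + M / q) * (u2 - u1) \<le> A"
        proof -
          have "M \<le> q ^ 2 + 6 * \<bar>k\<bar> * q ^ 2 + 8 * k ^ 2 * q ^ 2" unfolding M_def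
            using sT one_le_power[OF q1, of 2] mult_left_mono[of "sqrt T" "q ^ 2" "6 * \<bar>k\<bar>"] mult_left_mono[of 1 "q ^ 2" "8 * k ^ 2"]
            by simp
          then have "M \<le> (A - 1) * q * q" unfolding A_def by (simp add: algebra_simps power2_eq_square)
          then have "M / q \<le> (A - 1) * q" using \<open>q > 0\<close> by (simp add: pos_divide_le_eq)
          then have "(q + M / q) * (u2 - u1) \<le> (A * q) * (u2 - u1)"
            using u12 by (intro mult_right_mono) (auto simp: algebra_simps)
          also have "\<dots> = A * (q * (u2 - u1))" by simp
          also have "\<dots> \<le> A * 1" using len by (intro mult_left_mono) (auto simp: A_def)
          finally show ?thesis by simp
        qed
        finally show ?thesis by simp
      qed
      have "exp (2 * u1) / 4 < T" unfolding z1 using q1 by simp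
      from wkb_region_estimate[OF T(2) u01 this l] err0 err1
      have s1: "\<bar>(\<theta> u1 - \<theta> u0) - (wkb_phase T u1 - wkb_phase T u0)\<bar> \<le> 17 / 12 + pi * \<bar>k\<bar> + 2 * pi" by linarith
      show "\<bar>\<theta> u0 + weyl_main_term u0 T\<bar> \<le> C"
        using s1 s2 s3 ph1 elim(1) unfolding C_def abs_le_iff abs_less_iff by linarith
    qed
  qed
  then show ?thesis by blast
qed

text \<open>
  Since \<open>f\<close> is injective, the points counted correspond to the integers \<open>(f E + \<alpha>) / \<pi>\<close>. These fill, up to
  at most one at the upper end, the integers between \<open>(f T + \<alpha>) / \<pi>\<close> and \<open>\<alpha> / \<pi>\<close>, by the intermediate
  value theorem and the bound \<open>f < \<pi>\<close>.
\<close>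

lemma count_crossings:
  fixes f :: "real \<Rightarrow> real"
  assumes dec: "\<And>x y. x < y \<Longrightarrow> f y < f x" and cont: "continuous_on UNIV f"
    and pos: "0 < f E0" and lt: "\<And>x. x \<le> E0 \<Longrightarrow> f x < pi" and T: "E0 \<le> T"
  shows "\<bar>real (card {E. E < T \<and> sin (f E + \<alpha>) = 0}) + f T / pi\<bar> \<le> 2"
proof -
  define S where "S = {E. E < T \<and> sin (f E + \<alpha>) = 0}"
  define g where "g = (\<lambda>E. \<lfloor>(f E + \<alpha>) / pi\<rfloor>)"
  have gE: "f E + \<alpha> = of_int (g E) * pi" if "E \<in> S" for E
  proof -
    obtain n :: int where "f E + \<alpha> = of_int n * pi" using \<open>E \<in> S\<close> unfolding S_def by (auto simp: sin_zero_iff_int2)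
    then show ?thesis by (simp add: g_def)
  qed
  have inj: "inj_on g S"
  proof (rule inj_onI)
    fix x y assume "x \<in> S" "y \<in> S" "g x = g y"
    then have "f x = f y" using gE by (metis add_right_cancel)
    then show "x = y" using dec[of x y] dec[of y x] by (cases x y rule: linorder_cases) auto
  qed
  define a where "a = (f T + \<alpha>) / pi"
  define b where "b = \<alpha> / pi"
  have below: "f E < pi" for E
    using lt[of E0] lt[of E] dec[of E0 E] by (cases "E \<le> E0") auto
  have sub: "g ` S \<subseteq> {\<lfloor>a\<rfloor> + 1..\<lfloor>b\<rfloor> + 1}"
  proof clarify
    fix E assume E: "E \<in> S"
    have "f T < f E" using E dec unfolding S_def by auto
    then have "a < (f E + \<alpha>) / pi" unfolding a_def by (intro divide_strict_right_mono) auto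
    then have "a < of_int (g E)" using gE[OF E] by simp
    moreover have "(f E + \<alpha>) / pi < b + 1" unfolding b_def using below[of E] by (simp add: field_simps)
    then have "of_int (g E) < b + 1" using gE[OF E] by simp
    ultimately show "g E \<in> {\<lfloor>a\<rfloor> + 1..\<lfloor>b\<rfloor> + 1}" by simp linarith
  qed
  have sup: "{\<lfloor>a\<rfloor> + 1..\<lfloor>b\<rfloor>} \<subseteq> g ` S"
  proof
    fix n assume "n \<in> {\<lfloor>a\<rfloor> + 1..\<lfloor>b\<rfloor>}"
    then have n: "a < of_int n" "of_int n \<le> b" by simp_all linarith+
    then have m: "f T < of_int n * pi - \<alpha>" "of_int n * pi - \<alpha> \<le> 0"
      unfolding a_def b_def by (simp_all add: field_simps)
    obtain E where E: "E0 \<le> E" "E \<le> T" "f E = of_int n * pi - \<alpha>"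
      using IVT2'[of f T "of_int n * pi - \<alpha>" E0] m pos T continuous_on_subset[OF cont, of "{E0..T}"] by auto
    have "E < T" using E m by (cases "E = T") auto
    moreover have "sin (f E + \<alpha>) = 0" using E(3) by (simp add: sin_zero_iff_int2)
    ultimately have "E \<in> S" by (simp add: S_def)
    moreover have "g E = n" using E(3) by (simp add: g_def)
    ultimately show "n \<in> g ` S" by blast
  qed
  have fin: "finite (g ` S)" by (rule finite_subset[OF sub]) simp
  have cS: "card S = card (g ` S)" using card_image[OF inj] by simp
  have "card S \<le> card {\<lfloor>a\<rfloor> + 1..\<lfloor>b\<rfloor> + 1}" unfolding cS by (rule card_mono[OF _ sub]) simp
  then have up: "card S \<le> nat (\<lfloor>b\<rfloor> - \<lfloor>a\<rfloor> + 1)" by simp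
  have "card {\<lfloor>a\<rfloor> + 1..\<lfloor>b\<rfloor>} \<le> card S" unfolding cS by (rule card_mono[OF fin sup])
  then have lo: "nat (\<lfloor>b\<rfloor> - \<lfloor>a\<rfloor>) \<le> card S" by simp
  have ba: "b - a = - f T / pi" unfolding a_def b_def by (simp add: field_simps)
  have "- f T / pi > - 1" using below[of T] by (simp add: field_simps)
  then have "real (card S) \<le> b - a + 2 \<and> real (card S) \<ge> b - a - 1" using up lo ba by linarith
  then show ?thesis unfolding ba S_def[symmetric] by (simp add: abs_le_iff)
qed

theorem theorem3p2:
  fixes k u0 :: real
  shows "\<exists>C::real. \<forall>\<^sub>F T::real in at_top. \<forall>\<alpha>::real.
    \<bar>real (morse_count k T \<alpha> u0)
       - (1 / pi * sqrt T * ln (sqrt T) + 1 / pi * (2 * ln 2 - 1 - u0) * sqrt T)\<bar> \<le> C"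
proof -
  let ?E0 = "- ((k + 1/2)^2)"
  obtain \<Theta> :: "real \<Rightarrow> real \<Rightarrow> real" where \<Theta>:
    "continuous_on UNIV (\<lambda>p. \<Theta> (snd p) (fst p))"
    "\<And>E S. polar_lift (\<Theta> E) (psi k E) (psi' k E) S"
    "\<And>E. \<exists>b. \<forall>u\<ge>b. 0 < psi k E u \<and> 0 < \<Theta> E u \<and> \<Theta> E u < pi"
    "\<And>E u. E \<le> ?E0 \<Longrightarrow> 0 < \<Theta> E u \<and> \<Theta> E u < pi"
    using pruefer_angle_exists[of k] by blast
  define f where "f = (\<lambda>E. \<Theta> E u0)"
  have fc: "continuous_on UNIV f" unfolding f_def
    using continuous_on_compose2[OF \<Theta>(1), of UNIV "\<lambda>E. (u0, E)"] by (simp add: continuous_on_Pair)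
  have dec: "f y < f x" if "x < y" for x y
    unfolding f_def by (rule pruefer_angle_decreasing[OF \<Theta>(2) \<Theta>(2) \<Theta>(3) \<Theta>(3) that])
  have ev: "schroedinger_eigenvalue (morse_potential k) u0 \<alpha> (complex_of_real E) \<longleftrightarrow> sin (f E + \<alpha>) = 0" for E \<alpha>
  proof -
    obtain r where r: "r > 0" "psi k E u0 = r * sin (f E)" "psi' k E u0 = r * cos (f E)"
      using polar_liftD(2)[OF \<Theta>(2)[of E UNIV], of u0] by (auto simp: f_def)
    have "cos \<alpha> * psi k E u0 + sin \<alpha> * psi' k E u0 = r * sin (f E + \<alpha>)"
      unfolding r sin_add by (simp add: algebra_simps)
    then show ?thesis unfolding eigenvalue_iff using r by simp
  qed
  obtain C where C: "\<forall>\<^sub>F T in at_top. \<forall>\<theta>. polar_lift \<theta> (psi k T) (psi' k T) UNIV \<longrightarrow>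
     (\<exists>b. \<forall>u\<ge>b. 0 < psi k T u \<and> 0 < \<theta> u \<and> \<theta> u < pi) \<longrightarrow>
     \<bar>\<theta> u0 + weyl_main_term u0 T\<bar> \<le> C"
    using pruefer_angle_asymptotics[of k u0] by blast
  have "\<forall>\<^sub>F T in at_top. \<forall>\<alpha>. \<bar>real (morse_count k T \<alpha> u0)
       - (1 / pi * sqrt T * ln (sqrt T) + 1 / pi * (2 * ln 2 - 1 - u0) * sqrt T)\<bar> \<le> 2 + C / pi"
    using C eventually_ge_at_top[of ?E0]
  proof eventually_elim
    case (elim T)
    have fT: "\<bar>f T + weyl_main_term u0 T\<bar> \<le> C" using elim(1) \<Theta>(2)[of T UNIV] \<Theta>(3)[of T] unfolding f_def by blast
    show ?case
    proof
      fix \<alpha>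
      have "morse_count k T \<alpha> u0 = card {E. E < T \<and> sin (f E + \<alpha>) = 0}"
        unfolding morse_count_def ev by (simp only: conj_commute)
      moreover have "\<bar>real (card {E. E < T \<and> sin (f E + \<alpha>) = 0}) + f T / pi\<bar> \<le> 2"
        by (rule count_crossings[OF dec fc _ _ elim(2)]) (use \<Theta>(4)[of _ u0] in \<open>auto simp: f_def\<close>)
      moreover have "\<bar>(f T + weyl_main_term u0 T) / pi\<bar> \<le> C / pi"
        using fT by (simp add: divide_right_mono)
      moreover have "1 / pi * sqrt T * ln (sqrt T) + 1 / pi * (2 * ln 2 - 1 - u0) * sqrt T = weyl_main_term u0 T / pi"
        by (simp add: weyl_main_term_def add_divide_distrib)
      moreover have "(f T + weyl_main_term u0 T) / pi = f T / pi + weyl_main_term u0 T / pi" by (rule add_divide_distrib)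
      ultimately show "\<bar>real (morse_count k T \<alpha> u0)
       - (1 / pi * sqrt T * ln (sqrt T) + 1 / pi * (2 * ln 2 - 1 - u0) * sqrt T)\<bar> \<le> 2 + C / pi"
        by linarith
    qed
  qed
  then show ?thesis by blast
qed

end
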